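(* Let $\Gamma$ be a torsion-free finitely generated nilpotent group that is neither trivial nor isomorphic to $\mathbb{Z}$. Then there are $m\ge1$, polynomials $\eta_1,\dots,\eta_m$ and $\sigma$ with rational coefficients in the variables $\mathbf{x}=(x_1,\dots,x_m)$ and $\mathbf{y}=(y_1,\dots,y_m)$, all taking integer values at integer arguments, such that the following hold. (a) $\Gamma$ is isomorphic to $\mathbb{Z}^m$ with the multiplication $\mathbf{x}*\mathbf{y}=(\eta_1(\mathbf{x},\mathbf{y}),\dots,\eta_m(\mathbf{x},\mathbf{y}))$; identify $\Gamma$ with this group. (b) $\sigma:\Gamma\times\Gamma\to\mathbb{Z}$ is a 2-cocycle whose class is non-torsion in $H^2(\Gamma;\mathbb{Z})$, and its class satisfies: $[\sigma]$ is not in the kernel of the map $H^2(\Gamma;\mathbb{Z})\to\mathrm{Hom}(H_2(\Gamma;\mathbb{Z}),\mathbb{Z})$ induced by the Kronecker pairing, and, if $e\to\mathbb{Z}\xrightarrow{\iota}\tilde\Gamma\to\Gamma\to e$ is the central extension corresponding to $[\sigma]$, there is a sequence of finite index subgroups $\Gamma_k\le\tilde\Gamma$ with $\iota(\mathbb{Z})\cap\bigcap_k\Gamma_k=\{e\}$. (c) For every positive integer $n$ coprime to the denominators of all coefficients of $\eta_1,\dots,\eta_m$ and $\sigma$, the formula $$\rho_n(\mathbf{x})\,e_{y_1}\otimes e_{y_2}\otimes\cdots\otimes e_{y_m}=\exp\!\left(\tfrac{2\pi i}{n}\sigma(\mathbf{x},\mathbf{y})\right)e_{\eta_1(\mathbf{x},\mathbf{y})}\otimes\cdots\otimes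 e_{\eta_m(\mathbf{x},\mathbf{y})}$$ gives a well-defined function $\rho_n:\Gamma\to U((\mathbb{C}^n)^{\otimes m})$, where $e_0,\dots,e_{n-1}$ is the standard orthonormal basis of $\mathbb{C}^n$ and $e_{j+n}=e_j$ for all $j\in\mathbb{Z}$; and the sequence $(\rho_n)$, indexed by such $n$, is an asymptotic representation of $\Gamma$ that cannot be perturbed to a genuine representation.
   Context: Norms are operator norms. An asymptotic representation of $\Gamma$ is a sequence of functions $\rho_n:\Gamma\to U(k_n)$ with $\|\rho_n(gh)-\rho_n(g)\rho_n(h)\|\to0$ for all $g,h\in\Gamma$. It is perturbable to a genuine representation if there are unitary representations $\tilde\rho_n:\Gamma\to U(k_n)$ with $\|\rho_n(g)-\tilde\rho_n(g)\|\to0$ for all $g\in\Gamma$. Group cohomology is computed by inhomogeneous cochains with trivial action: a 2-cocycle $\sigma:\Gamma^2\to\mathbb{Z}$ satisfies $\sigma(h,k)-\sigma(gh,k)+\sigma(g,hk)-\sigma(g,h)=0$. A central extension $e\to\mathbb{Z}\to\tilde\Gamma\to\Gamma\to e$ corresponds to the class in $H^2(\Gamma;\mathbb{Z})$ of $\sigma(g,h)=\theta(g)\theta(h)\theta(gh)^{-1}\in\mathbb{Z}$ for any set-theoretic section $\theta$. *)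

theory Defs
  imports
    Complex_Main
    "HOL-Library.FuncSet"
    "HOL-Library.Poly_Mapping"
    "HOL-Library.Infinite_Set"
    "HOL-Algebra.Group"
    "HOL-Algebra.Coset"
    "HOL-Algebra.Generated_Groups"
    "HOL-Algebra.Elementary_Groups"
    "HOL-Algebra.Free_Abelian_Groups"
    "Jordan_Normal_Form.Matrix"
    "Jordan_Normal_Form.Schur_Decomposition"
begin

section \<open>Nilpotent, torsion-free and finitely generated groups\<close>

definition commutator :: "('a, 'b) monoid_scheme \<Rightarrow> 'a \<Rightarrow> 'a \<Rightarrow> 'a" where
  "commutator G g h = g \<otimes>\<^bsub>G\<^esub> h \<otimes>\<^bsub>G\<^esub> inv\<^bsub>G\<^esub> g \<otimes>\<^bsub>G\<^esub> inv\<^bsub>G\<^esub> h"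

primrec lower_central_series :: "('a, 'b) monoid_scheme \<Rightarrow> nat \<Rightarrow> 'a set" where
  "lower_central_series G 0 = carrier G"
| "lower_central_series G (Suc i) =
     generate G {commutator G g h | g h. g \<in> carrier G \<and> h \<in> lower_central_series G i}"

definition nilpotent_group :: "('a, 'b) monoid_scheme \<Rightarrow> bool" where
  "nilpotent_group G \<longleftrightarrow> group G \<and> (\<exists>c. lower_central_series G c = {\<one>\<^bsub>G\<^esub>})"

definition finitely_generated_group :: "('a, 'b) monoid_scheme \<Rightarrow> bool" where
  "finitely_generated_group G \<longleftrightarrow>
     group G \<and> (\<exists>S. finite S \<and> S \<subseteq> carrier G \<and> generate G S = carrier G)"

definition torsion_element :: "('a, 'b) monoid_scheme \<Rightarrow> 'a \<Rightarrow> bool" where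
  "torsion_element G x \<longleftrightarrow> x \<in> carrier G \<and> (\<exists>n::nat. n > 0 \<and> x [^]\<^bsub>G\<^esub> n = \<one>\<^bsub>G\<^esub>)"

definition torsion_free_group :: "('a, 'b) monoid_scheme \<Rightarrow> bool" where
  "torsion_free_group G \<longleftrightarrow> group G \<and> (\<forall>x. torsion_element G x \<longrightarrow> x = \<one>\<^bsub>G\<^esub>)"


section \<open>Second group cohomology and homology with trivial integer coefficients\<close>

text \<open>Cochains are extensional functions, so that equal cochains are equal as HOL functions.\<close>

definition coboundary1 :: "('a, 'b) monoid_scheme \<Rightarrow> ('a \<Rightarrow> int) \<Rightarrow> ('a \<times> 'a \<Rightarrow> int)" where
  "coboundary1 G f = (\<lambda>(g, h) \<in> carrier G \<times> carrier G. f h - f (g \<otimes>\<^bsub>G\<^esub> h) + f g)"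

definition cocycle2 :: "('a, 'b) monoid_scheme \<Rightarrow> ('a \<times> 'a \<Rightarrow> int) \<Rightarrow> bool" where
  "cocycle2 G s \<longleftrightarrow> s \<in> carrier G \<times> carrier G \<rightarrow>\<^sub>E UNIV \<and>
     (\<forall>g\<in>carrier G. \<forall>h\<in>carrier G. \<forall>k\<in>carrier G.
        s (h, k) - s (g \<otimes>\<^bsub>G\<^esub> h, k) + s (g, h \<otimes>\<^bsub>G\<^esub> k) - s (g, h) = 0)"

definition cocycle_group :: "('a, 'b) monoid_scheme \<Rightarrow> ('a \<times> 'a \<Rightarrow> int) monoid" where
  "cocycle_group G =
     \<lparr>carrier = {s. cocycle2 G s},
      monoid.mult = (\<lambda>s t. \<lambda>p \<in> carrier G \<times> carrier G. s p + t p),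
      one = (\<lambda>p \<in> carrier G \<times> carrier G. 0)\<rparr>"

definition coboundaries :: "('a, 'b) monoid_scheme \<Rightarrow> ('a \<times> 'a \<Rightarrow> int) set" where
  "coboundaries G = range (coboundary1 G)"

definition cohomology2 :: "('a, 'b) monoid_scheme \<Rightarrow> ('a \<times> 'a \<Rightarrow> int) set monoid" where
  "cohomology2 G = cocycle_group G Mod coboundaries G"

definition cohomology_class ::
  "('a, 'b) monoid_scheme \<Rightarrow> ('a \<times> 'a \<Rightarrow> int) \<Rightarrow> ('a \<times> 'a \<Rightarrow> int) set" where
  "cohomology_class G s = coboundaries G #>\<^bsub>cocycle_group G\<^esub> s"

text \<open>\<open>n\<close>-chains are finitely supported integer combinations of \<open>n\<close>-tuples; the boundary maps are
  dual to the coboundary maps above.\<close>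

definition boundary2 ::
  "('a, 'b) monoid_scheme \<Rightarrow> ('a \<times> 'a \<Rightarrow>\<^sub>0 int) \<Rightarrow> ('a \<Rightarrow>\<^sub>0 int)" where
  "boundary2 G = frag_extend (\<lambda>(g, h). frag_of h - frag_of (g \<otimes>\<^bsub>G\<^esub> h) + frag_of g)"

definition boundary3 ::
  "('a, 'b) monoid_scheme \<Rightarrow> ('a \<times> 'a \<times> 'a \<Rightarrow>\<^sub>0 int) \<Rightarrow> ('a \<times> 'a \<Rightarrow>\<^sub>0 int)" where
  "boundary3 G = frag_extend (\<lambda>(g, h, k).
     frag_of (h, k) - frag_of (g \<otimes>\<^bsub>G\<^esub> h, k) + frag_of (g, h \<otimes>\<^bsub>G\<^esub> k) - frag_of (g, h))"

definition cycle_group :: "('a, 'b) monoid_scheme \<Rightarrow> ('a \<times> 'a \<Rightarrow>\<^sub>0 int) monoid" where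
  "cycle_group G = (free_Abelian_group (carrier G \<times> carrier G))
     \<lparr>carrier := kernel (free_Abelian_group (carrier G \<times> carrier G))
                        (free_Abelian_group (carrier G)) (boundary2 G)\<rparr>"

definition boundaries :: "('a, 'b) monoid_scheme \<Rightarrow> ('a \<times> 'a \<Rightarrow>\<^sub>0 int) set" where
  "boundaries G =
     boundary3 G ` carrier (free_Abelian_group (carrier G \<times> carrier G \<times> carrier G))"

definition homology2 :: "('a, 'b) monoid_scheme \<Rightarrow> ('a \<times> 'a \<Rightarrow>\<^sub>0 int) set monoid" where
  "homology2 G = cycle_group G Mod boundaries G"

definition hom_group :: "('a, 'b) monoid_scheme \<Rightarrow> ('c, 'd) monoid_scheme \<Rightarrow> ('a \<Rightarrow> 'c) monoid" where
  "hom_group A B =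
     \<lparr>carrier = hom A B \<inter> extensional (carrier A),
      monoid.mult = (\<lambda>f g. \<lambda>x \<in> carrier A. f x \<otimes>\<^bsub>B\<^esub> g x),
      one = (\<lambda>x \<in> carrier A. \<one>\<^bsub>B\<^esub>)\<rparr>"

definition chain_pairing :: "('c \<Rightarrow> int) \<Rightarrow> ('c \<Rightarrow>\<^sub>0 int) \<Rightarrow> int" where
  "chain_pairing s c = (\<Sum>p\<in>Poly_Mapping.keys c. Poly_Mapping.lookup c p * s p)"

text \<open>The map from second cohomology to \<open>Hom(H\<^sub>2, \<int>)\<close>. All representatives of the two classes
  give the same value of the pairing, which \<^const>\<open>the_elem\<close> extracts.\<close>

definition kronecker_map ::
  "('a, 'b) monoid_scheme \<Rightarrow> ('a \<times> 'a \<Rightarrow> int) set \<Rightarrow> (('a \<times> 'a \<Rightarrow>\<^sub>0 int) set \<Rightarrow> int)" where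
  "kronecker_map G C = (\<lambda>Z \<in> carrier (homology2 G).
     the_elem ((\<lambda>(s, c). chain_pairing s c) ` (C \<times> Z)))"

definition kronecker_kernel :: "('a, 'b) monoid_scheme \<Rightarrow> ('a \<times> 'a \<Rightarrow> int) set set" where
  "kronecker_kernel G =
     kernel (cohomology2 G) (hom_group (homology2 G) integer_group) (kronecker_map G)"


section \<open>Central extensions by the integers\<close>

definition central_extension ::
  "('a, 'b) monoid_scheme \<Rightarrow> ('e, 'f) monoid_scheme \<Rightarrow> (int \<Rightarrow> 'e) \<Rightarrow> ('e \<Rightarrow> 'a) \<Rightarrow> bool" where
  "central_extension G E \<iota> \<pi> \<longleftrightarrow>
     group G \<and> group E \<and>
     \<iota> \<in> hom integer_group E \<and> inj \<iota> \<and>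
     \<pi> \<in> hom E G \<and> \<pi> ` carrier E = carrier G \<and>
     kernel E G \<pi> = range \<iota> \<and>
     (\<forall>z. \<forall>x\<in>carrier E. \<iota> z \<otimes>\<^bsub>E\<^esub> x = x \<otimes>\<^bsub>E\<^esub> \<iota> z)"

definition extension_section ::
  "('a, 'b) monoid_scheme \<Rightarrow> ('e, 'f) monoid_scheme \<Rightarrow> ('e \<Rightarrow> 'a) \<Rightarrow> ('a \<Rightarrow> 'e) \<Rightarrow> bool" where
  "extension_section G E \<pi> \<theta> \<longleftrightarrow> (\<forall>g\<in>carrier G. \<theta> g \<in> carrier E \<and> \<pi> (\<theta> g) = g)"

definition extension_cocycle ::
  "('a, 'b) monoid_scheme \<Rightarrow> ('e, 'f) monoid_scheme \<Rightarrow> (int \<Rightarrow> 'e) \<Rightarrow> ('a \<Rightarrow> 'e) \<Rightarrow> ('a \<times> 'a \<Rightarrow> int)" where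
  "extension_cocycle G E \<iota> \<theta> = (\<lambda>(g, h) \<in> carrier G \<times> carrier G.
     THE z. \<iota> z = \<theta> g \<otimes>\<^bsub>E\<^esub> \<theta> h \<otimes>\<^bsub>E\<^esub> inv\<^bsub>E\<^esub> (\<theta> (g \<otimes>\<^bsub>G\<^esub> h)))"

text \<open>The class of the cocycle does not depend on the section, and sections exist since \<open>\<pi>\<close> is onto;
  hence \<open>\<exists>\<theta>\<close> and \<open>\<forall>\<theta>\<close> are interchangeable here.\<close>

definition extension_corresponds ::
  "('a, 'b) monoid_scheme \<Rightarrow> ('e, 'f) monoid_scheme \<Rightarrow> (int \<Rightarrow> 'e) \<Rightarrow> ('e \<Rightarrow> 'a)
    \<Rightarrow> ('a \<times> 'a \<Rightarrow> int) set \<Rightarrow> bool" where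
  "extension_corresponds G E \<iota> \<pi> C \<longleftrightarrow>
     central_extension G E \<iota> \<pi> \<and>
     (\<exists>\<theta>. extension_section G E \<pi> \<theta> \<and> cohomology_class G (extension_cocycle G E \<iota> \<theta>) = C)"

definition finite_index_subgroup :: "('e, 'f) monoid_scheme \<Rightarrow> 'e set \<Rightarrow> bool" where
  "finite_index_subgroup E K \<longleftrightarrow> subgroup K E \<and> finite (rcosets\<^bsub>E\<^esub> K)"

text \<open>An extension of \<open>G\<close> by \<open>\<int>\<close> is in bijection with \<open>carrier G \<times> \<int>\<close>, so up to isomorphism every
  extension has elements of type \<open>'a \<times> int\<close>; quantifying over groups on this type therefore covers
  all extensions.\<close>

definition extension_separated :: "('a, 'b) monoid_scheme \<Rightarrow> ('a \<times> 'a \<Rightarrow> int) set \<Rightarrow> bool" where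
  "extension_separated G C \<longleftrightarrow>
     (\<forall>(E :: ('a \<times> int) monoid) \<iota> \<pi>. extension_corresponds G E \<iota> \<pi> C \<longrightarrow>
        (\<exists>K :: nat \<Rightarrow> ('a \<times> int) set.
           (\<forall>k. finite_index_subgroup E (K k)) \<and>
           range \<iota> \<inter> (\<Inter>k. K k) = {\<one>\<^bsub>E\<^esub>}))"

text \<open>Every class has a corresponding extension on this type.\<close>

lemma extension_exists:
  fixes G :: "('a, 'b) monoid_scheme"
  assumes "group G" "cocycle2 G s"
  shows "\<exists>(E :: ('a \<times> int) monoid) \<iota> \<pi>. extension_corresponds G E \<iota> \<pi> (cohomology_class G s)"
proof -
  interpret G: group G by fact
  have s: "s \<in> carrier G \<times> carrier G \<rightarrow>\<^sub>E UNIV"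
    and coc: "\<And>g h k. \<lbrakk>g \<in> carrier G; h \<in> carrier G; k \<in> carrier G\<rbrakk> \<Longrightarrow>
      s (g, h) + s (g \<otimes>\<^bsub>G\<^esub> h, k) = s (h, k) + s (g, h \<otimes>\<^bsub>G\<^esub> k)"
    using assms(2) unfolding cocycle2_def by (auto, smt (verit))
  define u where "u = s (\<one>\<^bsub>G\<^esub>, \<one>\<^bsub>G\<^esub>)"
  have l: "s (\<one>\<^bsub>G\<^esub>, k) = u" if "k \<in> carrier G" for k
    using coc[of "\<one>\<^bsub>G\<^esub>" "\<one>\<^bsub>G\<^esub>" k] that by (simp add: u_def)
  have r: "s (k, \<one>\<^bsub>G\<^esub>) = u" if "k \<in> carrier G" for k
    using coc[of k "\<one>\<^bsub>G\<^esub>" "\<one>\<^bsub>G\<^esub>"] that by (simp add: u_def)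
  define E :: "('a \<times> int) monoid" where
    "E = \<lparr>carrier = carrier G \<times> UNIV,
          monoid.mult = (\<lambda>(g, a) (h, b). (g \<otimes>\<^bsub>G\<^esub> h, a + b + s (g, h))),
          one = (\<one>\<^bsub>G\<^esub>, - u)\<rparr>"
  have E [simp]: "carrier E = carrier G \<times> UNIV" "\<one>\<^bsub>E\<^esub> = (\<one>\<^bsub>G\<^esub>, - u)"
    "(g, a) \<otimes>\<^bsub>E\<^esub> (h, b) = (g \<otimes>\<^bsub>G\<^esub> h, a + b + s (g, h))" for g a h b
    by (simp_all add: E_def)
  interpret E: group E
  proof (rule groupI)
    fix x assume "x \<in> carrier E"
    then obtain g a where x: "x = (g, a)" "g \<in> carrier G" by auto
    show "\<exists>y\<in>carrier E. y \<otimes>\<^bsub>E\<^esub> x = \<one>\<^bsub>E\<^esub>"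
      using x by (intro bexI[of _ "(inv\<^bsub>G\<^esub> g, - a - s (inv\<^bsub>G\<^esub> g, g) - u)"]) auto
  qed (auto simp: l r G.m_assoc coc)
  define \<iota> where "\<iota> = (\<lambda>z::int. (\<one>\<^bsub>G\<^esub>, z - u))"
  define \<theta> where "\<theta> = (\<lambda>g::'a. (g, 0::int))"
  have "central_extension G E \<iota> fst"
    unfolding central_extension_def
  proof (intro conjI)
    show "kernel E G fst = range \<iota>"
      by (auto simp: kernel_def \<iota>_def image_iff intro!: exI[of _ "_ + u"])
  qed (auto simp: \<iota>_def hom_def inj_def l r integer_group_def assms(1) E.is_group)
  moreover have "extension_section G E fst \<theta>"
    by (auto simp: extension_section_def \<theta>_def)
  moreover have "extension_cocycle G E \<iota> \<theta> = s"
  proof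
    fix p
    show "extension_cocycle G E \<iota> \<theta> p = s p"
    proof (cases "p \<in> carrier G \<times> carrier G")
      case True
      then obtain g h where p: "p = (g, h)" "g \<in> carrier G" "h \<in> carrier G" by auto
      have "\<iota> z = \<theta> g \<otimes>\<^bsub>E\<^esub> \<theta> h \<otimes>\<^bsub>E\<^esub> inv\<^bsub>E\<^esub> (\<theta> (g \<otimes>\<^bsub>G\<^esub> h)) \<longleftrightarrow> z = s p" for z
      proof -
        have "\<iota> z = \<theta> g \<otimes>\<^bsub>E\<^esub> \<theta> h \<otimes>\<^bsub>E\<^esub> inv\<^bsub>E\<^esub> (\<theta> (g \<otimes>\<^bsub>G\<^esub> h)) \<longleftrightarrow>
              \<theta> g \<otimes>\<^bsub>E\<^esub> \<theta> h = \<iota> z \<otimes>\<^bsub>E\<^esub> \<theta> (g \<otimes>\<^bsub>G\<^esub> h)"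
          using p by (subst eq_commute, intro E.inv_solve_right') (auto simp: \<theta>_def \<iota>_def)
        then show ?thesis using p by (auto simp: \<theta>_def \<iota>_def l)
      qed
      then show ?thesis using p by (simp add: extension_cocycle_def)
    next
      case False
      with s show ?thesis by (cases p) (auto simp: extension_cocycle_def PiE_def extensional_def)
    qed
  qed
  ultimately show ?thesis unfolding extension_corresponds_def by blast
qed


section \<open>Asymptotic representations\<close>

definition vec_norm2 :: "complex vec \<Rightarrow> real" where
  "vec_norm2 v = sqrt (\<Sum>i<dim_vec v. (cmod (v $ i))\<^sup>2)"

definition op_norm :: "complex mat \<Rightarrow> real" where
  "op_norm A = Sup {vec_norm2 (A *\<^sub>v v) | v. v \<in> carrier_vec (dim_col A) \<and> vec_norm2 v \<le> 1}"

definition unitary_group :: "nat \<Rightarrow> complex mat monoid" where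
  "unitary_group k =
     \<lparr>carrier = {A \<in> carrier_mat k k. mat_adjoint A * A = 1\<^sub>m k \<and> A * mat_adjoint A = 1\<^sub>m k},
      monoid.mult = (*),
      one = 1\<^sub>m k\<rparr>"

definition asymptotic_representation ::
  "('a, 'b) monoid_scheme \<Rightarrow> (nat \<Rightarrow> nat) \<Rightarrow> (nat \<Rightarrow> 'a \<Rightarrow> complex mat) \<Rightarrow> bool" where
  "asymptotic_representation G k \<rho> \<longleftrightarrow>
     (\<forall>n. \<rho> n \<in> carrier G \<rightarrow> carrier (unitary_group (k n))) \<and>
     (\<forall>g\<in>carrier G. \<forall>h\<in>carrier G.
        (\<lambda>n. op_norm (\<rho> n (g \<otimes>\<^bsub>G\<^esub> h) - \<rho> n g * \<rho> n h)) \<longlonglongrightarrow> 0)"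

definition perturbable ::
  "('a, 'b) monoid_scheme \<Rightarrow> (nat \<Rightarrow> nat) \<Rightarrow> (nat \<Rightarrow> 'a \<Rightarrow> complex mat) \<Rightarrow> bool" where
  "perturbable G k \<rho> \<longleftrightarrow>
     (\<exists>\<rho>'. (\<forall>n. \<rho>' n \<in> hom G (unitary_group (k n))) \<and>
           (\<forall>g\<in>carrier G. (\<lambda>n. op_norm (\<rho> n g - \<rho>' n g)) \<longlonglongrightarrow> 0))"


section \<open>Polynomials in two groups of variables\<close>

text \<open>A polynomial is a finitely supported map from monomials to rational coefficients, a monomial a
  finitely supported map from variables to exponents. The variables are \<open>x\<^sub>i = Inl i\<close> and
  \<open>y\<^sub>i = Inr i\<close>.\<close>

type_synonym xy_poly = "((nat + nat) \<Rightarrow>\<^sub>0 nat) \<Rightarrow>\<^sub>0 rat"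

definition poly_in_vars :: "nat \<Rightarrow> xy_poly \<Rightarrow> bool" where
  "poly_in_vars m p \<longleftrightarrow>
     (\<forall>t\<in>Poly_Mapping.keys p. Poly_Mapping.keys t \<subseteq> Inl ` {1..m} \<union> Inr ` {1..m})"

definition poly_eval :: "xy_poly \<Rightarrow> (nat \<Rightarrow> int) \<Rightarrow> (nat \<Rightarrow> int) \<Rightarrow> rat" where
  "poly_eval p x y =
     (\<Sum>t\<in>Poly_Mapping.keys p. Poly_Mapping.lookup p t *
        (\<Prod>v\<in>Poly_Mapping.keys t. of_int (case_sum x y v) ^ Poly_Mapping.lookup t v))"

text \<open>Integer vectors \<open>(x\<^sub>1, \<dots>, x\<^sub>m)\<close> are extensional functions on \<open>{1..m}\<close>.\<close>

abbreviation int_tuples :: "nat \<Rightarrow> (nat \<Rightarrow> int) set" where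
  "int_tuples m \<equiv> {1..m} \<rightarrow>\<^sub>E UNIV"

definition poly_int_valued :: "nat \<Rightarrow> xy_poly \<Rightarrow> bool" where
  "poly_int_valued m p \<longleftrightarrow> (\<forall>x\<in>int_tuples m. \<forall>y\<in>int_tuples m. poly_eval p x y \<in> \<int>)"

text \<open>Only used for integer-valued polynomials, where the floor changes nothing but the type.\<close>

definition poly_int :: "xy_poly \<Rightarrow> (nat \<Rightarrow> int) \<Rightarrow> (nat \<Rightarrow> int) \<Rightarrow> int" where
  "poly_int p x y = \<lfloor>poly_eval p x y\<rfloor>"

definition coprime_to_denominators :: "nat \<Rightarrow> xy_poly \<Rightarrow> bool" where
  "coprime_to_denominators n p \<longleftrightarrow>
     (\<forall>t. coprime (int n) (snd (quotient_of (Poly_Mapping.lookup p t))))"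

definition tuple_mult ::
  "nat \<Rightarrow> (nat \<Rightarrow> xy_poly) \<Rightarrow> (nat \<Rightarrow> int) \<Rightarrow> (nat \<Rightarrow> int) \<Rightarrow> (nat \<Rightarrow> int)" where
  "tuple_mult m \<eta> x y = (\<lambda>i\<in>{1..m}. poly_int (\<eta> i) x y)"

text \<open>The monoid record has a field for the unit; it is filled with the two-sided unit of the
  multiplication (unique if it exists).\<close>

definition tuple_group :: "nat \<Rightarrow> (nat \<Rightarrow> xy_poly) \<Rightarrow> (nat \<Rightarrow> int) monoid" where
  "tuple_group m \<eta> =
     \<lparr>carrier = int_tuples m,
      monoid.mult = tuple_mult m \<eta>,
      one = (THE e. e \<in> int_tuples m \<and>
               (\<forall>x\<in>int_tuples m. tuple_mult m \<eta> e x = x \<and> tuple_mult m \<eta> x e = x))\<rparr>"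

definition poly_cochain :: "nat \<Rightarrow> xy_poly \<Rightarrow> ((nat \<Rightarrow> int) \<times> (nat \<Rightarrow> int) \<Rightarrow> int)" where
  "poly_cochain m s = (\<lambda>(x, y) \<in> int_tuples m \<times> int_tuples m. poly_int s x y)"


section \<open>The maps on tensor powers\<close>

text \<open>\<open>(\<complex>\<^sup>n)\<^sup>\<otimes>\<^sup>m\<close> is realised as \<open>\<complex>\<close> to the power \<open>n ^ m\<close> by means of the Kronecker product of vectors,
  which sends the elementary tensors of standard basis vectors to the standard basis.\<close>

definition kron_vec :: "complex vec \<Rightarrow> complex vec \<Rightarrow> complex vec" where
  "kron_vec v w = vec (dim_vec v * dim_vec w) (\<lambda>i. v $ (i div dim_vec w) * w $ (i mod dim_vec w))"

definition tensor_vecs :: "complex vec list \<Rightarrow> complex vec" where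
  "tensor_vecs vs = foldr kron_vec vs (vec 1 (\<lambda>_. 1))"

definition periodic_basis_vec :: "nat \<Rightarrow> int \<Rightarrow> complex vec" where
  "periodic_basis_vec n j = unit_vec n (nat (j mod int n))"

definition basis_tensor :: "nat \<Rightarrow> nat \<Rightarrow> (nat \<Rightarrow> int) \<Rightarrow> complex vec" where
  "basis_tensor m n y = tensor_vecs (map (\<lambda>i. periodic_basis_vec n (y i)) [1..<Suc m])"

definition rho_formula ::
  "nat \<Rightarrow> (nat \<Rightarrow> xy_poly) \<Rightarrow> xy_poly \<Rightarrow> nat \<Rightarrow> (nat \<Rightarrow> int) \<Rightarrow> complex mat \<Rightarrow> bool" where
  "rho_formula m \<eta> s n x A \<longleftrightarrow>
     (\<forall>y\<in>int_tuples m.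
        A *\<^sub>v basis_tensor m n y =
          exp (2 * of_real pi * \<i> / of_nat n * of_int (poly_int s x y)) \<cdot>\<^sub>v
          basis_tensor m n (\<lambda>i. poly_int (\<eta> i) x y))"

definition rho ::
  "nat \<Rightarrow> (nat \<Rightarrow> xy_poly) \<Rightarrow> xy_poly \<Rightarrow> nat \<Rightarrow> (nat \<Rightarrow> int) \<Rightarrow> complex mat" where
  "rho m \<eta> s n x = (THE A. A \<in> carrier (unitary_group (n ^ m)) \<and> rho_formula m \<eta> s n x A)"

definition admissible_indices :: "nat \<Rightarrow> (nat \<Rightarrow> xy_poly) \<Rightarrow> xy_poly \<Rightarrow> nat set" where
  "admissible_indices m \<eta> s =
     {n. n > 0 \<and> (\<forall>i\<in>{1..m}. coprime_to_denominators n (\<eta> i)) \<and> coprime_to_denominators n s}"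

text \<open>So \<^const>\<open>enumerate\<close> lists the admissible indices in increasing order.\<close>

lemma infinite_admissible_indices: "infinite (admissible_indices m \<eta> s)"
proof -
  define P where "P = insert s (\<eta> ` {1..m})"
  define C where "C = (\<Union>p\<in>P. Poly_Mapping.lookup p ` Poly_Mapping.keys p)"
  define L where "L = (\<Prod>c\<in>C. snd (quotient_of c))"
  have fin: "finite C" unfolding C_def P_def by auto
  have dvdL: "snd (quotient_of c) dvd L" if "c \<in> C" for c
    unfolding L_def using fin that by (intro dvd_prodI)
  have L: "L > 0" unfolding L_def by (intro prod_pos) (auto intro: quotient_of_denom_pos')
  have "nat (1 + int k * L) \<in> admissible_indices m \<eta> s" for k
  proof -
    have cop: "coprime_to_denominators (nat (1 + int k * L)) p" if "p \<in> P" for p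
      unfolding coprime_to_denominators_def
    proof
      fix t
      show "coprime (int (nat (1 + int k * L))) (snd (quotient_of (Poly_Mapping.lookup p t)))"
      proof (cases "t \<in> Poly_Mapping.keys p")
        case True
        then have d: "snd (quotient_of (Poly_Mapping.lookup p t)) dvd L"
          using that by (intro dvdL) (auto simp: C_def)
        have "coprime (1 + int k * L) L"
          by (metis coprime_1_left coprime_iff_gcd_eq_1 gcd_add_mult mult.commute add.commute gcd.commute)
        then have "coprime (1 + int k * L) (snd (quotient_of (Poly_Mapping.lookup p t)))"
          using d coprime_divisors dvd_refl by blast
        then show ?thesis using L by simp
      qed (simp add: Poly_Mapping.in_keys_iff)
    qed
    have "1 + int k * L > 0" using L by (simp add: add_pos_nonneg)
    then show ?thesis
      using cop by (auto simp: admissible_indices_def P_def)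
  qed
  then have "range (\<lambda>k. nat (1 + int k * L)) \<subseteq> admissible_indices m \<eta> s" by auto
  moreover have "inj (\<lambda>k. nat (1 + int k * L))"
    using L by (auto simp: inj_on_def eq_nat_nat_iff)
  ultimately show ?thesis
    using finite_subset range_inj_infinite by blast
qed

end

theory Submission
  imports Defs "HOL-Analysis.Further_Topology" "HOL-Number_Theory.Cong"
begin

text \<open>
  A torsion-free finitely generated nilpotent group has a series
  \<open>\<Gamma> = N\<^sub>0 > N\<^sub>1 > \<dots> > N\<^sub>m = 1\<close> with \<open>[\<Gamma>, N\<^sub>i] \<subseteq> N\<^sub>i\<^sub>+\<^sub>1\<close> and
  \<open>N\<^sub>i = \<langle>a\<^sub>i\<^sub>+\<^sub>1\<rangle> N\<^sub>i\<^sub>+\<^sub>1\<close>, the quotients being infinite cyclic; its elements are the words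
  \<open>a\<^sub>m\<^sup>x\<^sup>m \<dots> a\<^sub>1\<^sup>x\<^sup>1\<close>. Call a function polynomial if it is killed by all products of sufficiently
  many left difference operators. Since conjugation acts unipotently on the polynomial functions on
  \<open>N\<^sub>i\<^sub>+\<^sub>1\<close>, the function \<open>u a\<^sub>i\<^sub>+\<^sub>1\<^sup>k \<mapsto> f u\<close> on \<open>N\<^sub>i\<close> is polynomial if \<open>f\<close> is. Hence the coordinates are
  polynomial functions, and Newton's forward difference formula, applied to the exponents of the word
  of \<open>x\<close> followed by the word of \<open>y\<close>, makes the multiplication polynomial.

  Let \<open>t = a\<^sub>1\<close> and let \<open>\<phi> : N\<^sub>1 \<rightarrow> \<int>\<close> be a homomorphism. For \<open>g\<close> with first coordinate \<open>x\<close> and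
  \<open>h \<in> v \<langle>t\<rangle>\<close> with \<open>v \<in> N\<^sub>1\<close>, the sums \<open>\<sigma>(g, h) = \<Sum>i<x. \<phi>(t\<^sup>i v t\<^sup>-\<^sup>i)\<close> form a cocycle, which is polynomial
  by the same formula. There are \<open>\<phi>\<close> and \<open>n \<in> N\<^sub>1\<close> with \<open>\<phi> n = 1\<close> and \<open>[t, n]\<close> torsion modulo
  \<open>[N\<^sub>1, N\<^sub>1]\<close>; they yield a 2-cycle on which \<open>\<sigma>\<close> does not vanish.

  The cocycle identity says \<open>\<rho>\<^sub>n(x) \<rho>\<^sub>n(y) = exp (2 \<pi> i \<sigma>(x, y) / n) \<rho>\<^sub>n(x y)\<close>, so \<open>\<rho>\<^sub>n\<close> lifts to a
  representation of the central extension with finite image that has kernel \<open>n \<int>\<close> on the central \<open>\<int>\<close>. If genuine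
  representations \<open>\<rho>'\<^sub>n\<close> were close to \<open>\<rho>\<^sub>n\<close>, the continuous logarithm of the determinant of
  \<open>\<rho>\<^sub>n \<rho>'\<^sub>n\<^sup>*\<close> would be a cochain whose coboundary is a nonzero multiple of \<open>\<sigma>\<close> on the 2-cycle.
\<close>

hide_type (open) Finite_Cartesian_Product.vec
hide_const (open) Finite_Cartesian_Product.vec Finite_Cartesian_Product.mat Finite_Cartesian_Product.row
  Finite_Cartesian_Product.column
no_notation vec_nth (infixl "$" 90)

section \<open>Noetherian nilpotent groups\<close>

text \<open>Why a suitable class exists: \<Gamma> is an extension of
  \<open>\<langle>t\<rangle>\<close> by \<open>N\<^sub>1\<close>, and in the Wang sequence the
  coinvariants of t on Hom(N_1, Z) map to the second cohomology, \<phi> going to \<sigma>. A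
  t-invariant \<phi> makes \<sigma> a cup product, which can be a torsion class, as for the
  Heisenberg group. So invariance is asked of n instead, in the abelianization of N_1 modulo
  torsion, and \<phi> is only required to satisfy \<phi> n = 1; the torus of t and n then detects
  \<sigma>. Unipotence of t provides n once N_1 is nontrivial, that is for m at least 2; the values
  0 and 1 of m are the trivial group and Z. The obstacle to polynomiality is that conjugation need
  not lower the plain degree of a function on N_i: it moves points in deeper directions. Hence
  differences in deeper directions count for more. Logarithms of determinants are followed along
  paths, because the sum of n^m arguments of eigenvalues may leave every principal strip. This makes
  the coboundary identity exact, so a single large n gives the contradiction and no limit is
  taken.\<close>

lemma int_subgroup_principal:
  fixes J :: "int set"
  assumes 0: "0 \<in> J" and diff: "\<And>i j. i \<in> J \<Longrightarrow> j \<in> J \<Longrightarrow> i - j \<in> J"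
  obtains b where "b \<in> J" "\<And>k. k \<in> J \<Longrightarrow> b dvd k"
proof (cases "J = {0}")
  case True
  then show ?thesis using that[of 0] by auto
next
  case False
  have neg: "- i \<in> J" if "i \<in> J" for i using diff[OF 0 that] by simp
  have add: "i + j \<in> J" if "i \<in> J" "j \<in> J" for i j using diff[OF that(1) neg[OF that(2)]] by simp
  obtain i where i: "i \<in> J" "i \<noteq> 0" using False 0 by auto
  then have "\<exists>n::nat. n > 0 \<and> int n \<in> J"
    using neg[of i] by (cases "i > 0") (auto intro: exI[of _ "nat \<bar>i\<bar>"])
  define n where "n = (LEAST n::nat. n > 0 \<and> int n \<in> J)"
  have n: "n > 0" "int n \<in> J"
    using LeastI_ex[OF \<open>\<exists>n::nat. n > 0 \<and> int n \<in> J\<close>] by (auto simp: n_def)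
  have nmult: "int k * int n \<in> J" for k
    by (induction k) (auto simp: 0 algebra_simps intro: add n)
  have mult: "k * int n \<in> J" for k
    using nmult[of "nat \<bar>k\<bar>"] neg[OF nmult[of "nat \<bar>k\<bar>"]] by (cases "k \<ge> 0") auto
  have "int n dvd k" if "k \<in> J" for k
  proof -
    have "k mod int n \<in> J"
      using diff[OF that mult[of "k div int n"]] by (simp add: minus_div_mult_eq_mod)
    moreover have "nat (k mod int n) < n" using n by (simp add: nat_less_iff)
    ultimately have "\<not> nat (k mod int n) > 0"
      using not_less_Least[of "nat (k mod int n)" "\<lambda>n. n > 0 \<and> int n \<in> J"] n
      by (auto simp: n_def)
    then have "k mod int n = 0" using pos_mod_sign[of "int n" k] n by linarith
    then show ?thesis by (simp add: dvd_eq_mod_eq_0)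
  qed
  then show ?thesis using that n by blast
qed

section \<open>Commutator identities\<close>

context group begin

lemma inv_cancel_left [simp]:
  "\<lbrakk>x \<in> carrier G; y \<in> carrier G\<rbrakk> \<Longrightarrow> inv x \<otimes> (x \<otimes> y) = y"
  "\<lbrakk>x \<in> carrier G; y \<in> carrier G\<rbrakk> \<Longrightarrow> x \<otimes> (inv x \<otimes> y) = y"
  by (simp_all flip: m_assoc)

lemma commutator_closed [simp]:
  "\<lbrakk>g \<in> carrier G; h \<in> carrier G\<rbrakk> \<Longrightarrow> commutator G g h \<in> carrier G"
  by (simp add: commutator_def)

lemma commutator_mult_right:
  "\<lbrakk>g \<in> carrier G; h \<in> carrier G; k \<in> carrier G\<rbrakk> \<Longrightarrow>
    commutator G g (h \<otimes> k) = commutator G g h \<otimes> (h \<otimes> commutator G g k \<otimes> inv h)"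
  by (simp add: commutator_def m_assoc inv_mult_group)

lemma commutator_mult_left:
  "\<lbrakk>g \<in> carrier G; h \<in> carrier G; k \<in> carrier G\<rbrakk> \<Longrightarrow>
    commutator G (g \<otimes> h) k = (g \<otimes> commutator G h k \<otimes> inv g) \<otimes> commutator G g k"
  by (simp add: commutator_def m_assoc inv_mult_group)

lemma commutator_inv_right:
  "\<lbrakk>g \<in> carrier G; h \<in> carrier G\<rbrakk> \<Longrightarrow>
    commutator G g (inv h) = inv h \<otimes> inv (commutator G g h) \<otimes> h"
  by (simp add: commutator_def m_assoc inv_mult_group)

lemma commutator_inv_left:
  "\<lbrakk>g \<in> carrier G; h \<in> carrier G\<rbrakk> \<Longrightarrow>
    commutator G (inv g) h = inv g \<otimes> inv (commutator G g h) \<otimes> g"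
  by (simp add: commutator_def m_assoc inv_mult_group)

lemma inv_commutator:
  "\<lbrakk>g \<in> carrier G; h \<in> carrier G\<rbrakk> \<Longrightarrow> inv (commutator G g h) = commutator G h g"
  by (simp add: commutator_def m_assoc inv_mult_group)

lemma conj_eq_commutator_mult:
  "\<lbrakk>g \<in> carrier G; h \<in> carrier G\<rbrakk> \<Longrightarrow> g \<otimes> h \<otimes> inv g = commutator G g h \<otimes> h"
  by (simp add: commutator_def m_assoc inv_mult_group)

lemma normal_conj:
  assumes "B \<lhd> G" "g \<in> carrier G" "b \<in> B"
  shows "g \<otimes> b \<otimes> inv g \<in> B" "inv g \<otimes> b \<otimes> g \<in> B"
  using assms normal.inv_op_closed1 normal.inv_op_closed2 by fastforce+

lemma commutator_in_normal:
  assumes "B \<lhd> G" "g \<in> carrier G" "b \<in> B"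
  shows "commutator G g b \<in> B"
proof -
  interpret B: normal B G by fact
  show ?thesis unfolding commutator_def
    using normal_conj(1)[OF assms] assms(3) by blast
qed

lemma normal_group_hom: "B \<lhd> G \<Longrightarrow> group_hom G (G Mod B) (\<lambda>a. B #> a)"
  by (intro group_hom.intro group_hom_axioms.intro is_group normal.factorgroup_is_group normal.r_coset_hom_Mod)

section \<open>Elements and subgroups central modulo a normal subgroup\<close>

definition central_mod :: "'a set \<Rightarrow> 'a set" where
  "central_mod B = {x \<in> carrier G. \<forall>g\<in>carrier G. commutator G g x \<in> B}"

lemma central_mod_subgroup:
  assumes "B \<lhd> G" shows "subgroup (central_mod B) G"
proof
  interpret B: normal B G by fact
  show "central_mod B \<subseteq> carrier G" by (auto simp: central_mod_def)
  show "x \<otimes> y \<in> central_mod B" if "x \<in> central_mod B" "y \<in> central_mod B" for x y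
    using that normal_conj(1)[OF assms] by (auto simp: central_mod_def commutator_mult_right)
  show "\<one> \<in> central_mod B" by (auto simp: central_mod_def commutator_def)
  show "inv x \<in> central_mod B" if "x \<in> central_mod B" for x
    using that normal_conj(2)[OF assms] by (auto simp: central_mod_def commutator_inv_right)
qed

lemma normal_subset_central_mod: "B \<lhd> G \<Longrightarrow> B \<subseteq> central_mod B"
  using commutator_in_normal normal_imp_subgroup subgroup.subset
  by (fastforce simp: central_mod_def)

lemma normal_if_central:
  assumes "subgroup C G" "B \<subseteq> C" "C \<subseteq> central_mod B"
  shows "C \<lhd> G"
proof (rule normal_invI[OF assms(1)])
  fix g c assume "g \<in> carrier G" "c \<in> C"
  then have "g \<otimes> c \<otimes> inv g = commutator G g c \<otimes> c" "commutator G g c \<in> B"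
    using assms(3) by (auto simp: central_mod_def intro: conj_eq_commutator_mult)
  then show "g \<otimes> c \<otimes> inv g \<in> C"
    using assms \<open>c \<in> C\<close> subgroup.m_closed by fastforce
qed

definition adjoin :: "'a set \<Rightarrow> 'a \<Rightarrow> 'a set" where
  "adjoin B x = {u \<otimes> x [^] (k::int) | u k. u \<in> B}"

lemma adjoin_subgroup:
  assumes "B \<lhd> G" "x \<in> carrier G" shows "subgroup (adjoin B x) G"
proof
  interpret B: normal B G by fact
  show "adjoin B x \<subseteq> carrier G" using assms by (auto simp: adjoin_def)
  show "\<one> \<in> adjoin B x" by (force simp: adjoin_def intro: exI[of _ \<one>] exI[of _ "0::int"])
  fix y assume "y \<in> adjoin B x"
  then obtain u k where y: "y = u \<otimes> x [^] (k::int)" "u \<in> B" by (auto simp: adjoin_def)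
  have "inv y = (inv (x [^] k) \<otimes> inv u \<otimes> x [^] k) \<otimes> x [^] (- k)"
    using y assms by (simp add: int_pow_neg inv_mult_group m_assoc)
  then show "inv y \<in> adjoin B x"
    using normal_conj(2)[OF assms(1)] y assms by (auto simp: adjoin_def)
  fix z assume "z \<in> adjoin B x"
  then obtain v l where z: "z = v \<otimes> x [^] (l::int)" "v \<in> B" by (auto simp: adjoin_def)
  have "y \<otimes> z = (u \<otimes> (x [^] k \<otimes> v \<otimes> inv (x [^] k))) \<otimes> x [^] (k + l)"
    using y z assms by (simp add: int_pow_mult m_assoc)
  then show "y \<otimes> z \<in> adjoin B x"
    using normal_conj(1)[OF assms(1)] y z assms unfolding adjoin_def by blast
qed

lemma subset_adjoin: "subgroup B G \<Longrightarrow> B \<subseteq> adjoin B x"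
  using subgroup.mem_carrier by (force simp: adjoin_def intro: exI[of _ "0::int"])

lemma mem_adjoin: "subgroup B G \<Longrightarrow> x \<in> carrier G \<Longrightarrow> x \<in> adjoin B x"
  using subgroup.one_closed by (force simp: adjoin_def intro: exI[of _ \<one>] exI[of _ "1::int"])

lemma adjoin_least:
  assumes "subgroup C G" "B \<subseteq> C" "x \<in> C" shows "adjoin B x \<subseteq> C"
  using assms subgroup_int_pow_closed subgroup.m_closed by (fastforce simp: adjoin_def)

lemma adjoin_normal:
  assumes "B \<lhd> G" "x \<in> central_mod B" shows "adjoin B x \<lhd> G"
proof (rule normal_if_central)
  have B: "subgroup B G" using assms by (simp add: normal_imp_subgroup)
  show "subgroup (adjoin B x) G"
    using adjoin_subgroup assms by (auto simp: central_mod_def)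
  show "B \<subseteq> adjoin B x" using subset_adjoin[OF B] .
  show "adjoin B x \<subseteq> central_mod B"
    using assms by (intro adjoin_least central_mod_subgroup normal_subset_central_mod)
qed

section \<open>Finite generation of all subgroups\<close>

definition noetherian :: "'a set \<Rightarrow> bool" where
  "noetherian L \<longleftrightarrow> (\<forall>H. subgroup H G \<longrightarrow> H \<subseteq> L \<longrightarrow> (\<exists>T. finite T \<and> T \<subseteq> H \<and> H = generate G T))"

lemma noetherian_mono: "noetherian L \<Longrightarrow> K \<subseteq> L \<Longrightarrow> noetherian K"
  by (auto simp: noetherian_def)

text \<open>The exponents of \<open>x\<close> that occur in \<open>H\<close> form an ideal of Z,
  generated by some \<open>b\<close>. One element of \<open>H\<close> with exponent
  \<open>b\<close>, together with generators of the intersection of \<open>H\<close> and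
  \<open>B\<close>, generates \<open>H\<close>.\<close>

lemma noetherian_adjoin:
  assumes "B \<lhd> G" "x \<in> carrier G" "noetherian B" shows "noetherian (adjoin B x)"
  unfolding noetherian_def
proof (intro allI impI)
  interpret B: normal B G by fact
  fix H assume H: "subgroup H G" "H \<subseteq> adjoin B x"
  interpret H: subgroup H G by fact
  \<comment> \<open>\<open>x\<close> may have finite order modulo \<open>B\<close>, so an element
    may have several exponents; \<open>J\<close> collects all of them and is still closed under
    differences.\<close>
  define J where "J = {k::int. \<exists>u\<in>B. u \<otimes> x [^] k \<in> H}"
  have "0 \<in> J" by (auto simp: J_def intro!: bexI[of _ \<one>])
  moreover have "i - j \<in> J" if ij: "i \<in> J" "j \<in> J" for i j
  proof -
    obtain u v where u: "u \<in> B" "u \<otimes> x [^] i \<in> H" and v: "v \<in> B" "v \<otimes> x [^] j \<in> H"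
      using ij by (auto simp: J_def)
    have "(u \<otimes> x [^] i) \<otimes> inv (v \<otimes> x [^] j) =
        (u \<otimes> (x [^] (i - j) \<otimes> inv v \<otimes> inv (x [^] (i - j)))) \<otimes> x [^] (i - j)"
      using u v assms by (simp add: int_pow_diff inv_mult_group m_assoc)
    moreover have "u \<otimes> (x [^] (i - j) \<otimes> inv v \<otimes> inv (x [^] (i - j))) \<in> B"
      using u v assms normal_conj(1)[OF assms(1)] by simp
    moreover have "(u \<otimes> x [^] i) \<otimes> inv (v \<otimes> x [^] j) \<in> H" using u v by simp
    ultimately show ?thesis unfolding J_def by (metis (mono_tags, lifting) mem_Collect_eq)
  qed
  ultimately obtain b where b: "b \<in> J" "\<And>k. k \<in> J \<Longrightarrow> b dvd k"
    using int_subgroup_principal by blast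
  obtain u where u: "u \<in> B" "u \<otimes> x [^] b \<in> H" using b by (auto simp: J_def)
  have "subgroup (H \<inter> B) G" using H.subgroup_axioms B.subgroup_axioms
    by (simp add: subgroups_Inter_pair)
  then obtain T where T: "finite T" "T \<subseteq> H \<inter> B" "H \<inter> B = generate G T"
    using assms(3) by (auto simp: noetherian_def)
  let ?h = "u \<otimes> x [^] b"
  have sub: "insert ?h T \<subseteq> carrier G" using T u H.subset by blast
  have "h \<in> generate G (insert ?h T)" if h: "h \<in> H" for h
  proof -
    obtain v k where v: "h = v \<otimes> x [^] (k::int)" "v \<in> B" using h H by (auto simp: adjoin_def)
    then have "k \<in> J" using h by (auto simp: J_def)
    then obtain q where q: "k = b * q" using b by (auto simp: dvd_def)
    \<comment> \<open>With \<open>k = b * q\<close> the elements \<open>h\<close> and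
      \<open>?h [^] q\<close> agree modulo \<open>B\<close>, since both are congruent to
      \<open>x [^] k\<close>.\<close>
    have inB: "inv (?h [^] q) \<otimes> h \<in> B"
    proof -
      have 1: "B #> ?h = B #> (x [^] b)"
        using u assms B.subset by (simp add: coset_mult_assoc[symmetric] coset_join2 B.subgroup_axioms)
      interpret hm: group_hom G "G Mod B" "\<lambda>a. B #> a"
        by (rule normal_group_hom[OF assms(1)])
      have "B #> (?h [^] q) = (B #> ?h) [^]\<^bsub>G Mod B\<^esub> q" using u assms by (simp add: hm.hom_int_pow)
      also have "\<dots> = B #> ((x [^] b) [^] q)" using 1 assms by (simp add: hm.hom_int_pow)
      also have "\<dots> = B #> (x [^] k)" using assms q by (simp add: int_pow_pow)
      also have "\<dots> = B #> h"
        using v assms B.subset by (simp add: coset_mult_assoc[symmetric] coset_join2 B.subgroup_axioms)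
      finally have eq: "B #> (?h [^] q) = B #> h" .
      have hc: "h \<in> carrier G" "?h [^] q \<in> carrier G" using h u assms by auto
      have "B #> (inv (?h [^] q) \<otimes> h) = inv\<^bsub>G Mod B\<^esub> (B #> (?h [^] q)) \<otimes>\<^bsub>G Mod B\<^esub> (B #> h)"
        using hc by simp
      also have "\<dots> = \<one>\<^bsub>G Mod B\<^esub>" using eq hc hm.H.l_inv hm.hom_closed by simp
      finally have "B #> (inv (?h [^] q) \<otimes> h) = B" by (simp add: FactGroup_def)
      then show ?thesis using hc coset_join1 B.subgroup_axioms by simp
    qed
    moreover have "inv (?h [^] q) \<otimes> h \<in> H"
      using h u subgroup_int_pow_closed[OF H(1)] by simp
    ultimately have "inv (?h [^] q) \<otimes> h \<in> generate G T" using T by blast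
    then have 1: "inv (?h [^] q) \<otimes> h \<in> generate G (insert ?h T)"
      using mono_generate[of T "insert ?h T"] by blast
    have gs: "subgroup (generate G (insert ?h T)) G" using generate_is_subgroup[OF sub] .
    have 2: "?h [^] q \<in> generate G (insert ?h T)"
      using subgroup_int_pow_closed[OF gs] generate.incl[of ?h] by blast
    have "?h [^] q \<otimes> (inv (?h [^] q) \<otimes> h) \<in> generate G (insert ?h T)"
      using subgroup.m_closed[OF gs 2 1] .
    then show ?thesis using h u assms by simp
  qed
  moreover have "generate G (insert ?h T) \<subseteq> H"
    using T u H by (intro generate_subgroup_incl) auto
  ultimately show "\<exists>T. finite T \<and> T \<subseteq> H \<and> H = generate G T"
    using T u by (intro exI[of _ "insert ?h T"]) auto
qed

section \<open>The lower central series\<close>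

declare lower_central_series.simps [simp del]

lemma lower_central_series_normal: "lower_central_series G i \<lhd> G"
proof (induction i)
  case 0
  show ?case by (simp add: normal_self lower_central_series.simps)
next
  case (Suc i)
  interpret L: normal "lower_central_series G i" G by fact
  show ?case unfolding lower_central_series.simps
  proof (rule normal_generateI)
    fix h g assume "h \<in> {commutator G g h |g h. g \<in> carrier G \<and> h \<in> lower_central_series G i}"
      and g: "g \<in> carrier G"
    then obtain a b where ab: "h = commutator G a b" "a \<in> carrier G" "b \<in> lower_central_series G i"
      by blast
    have "g \<otimes> h \<otimes> inv g = commutator G (g \<otimes> a \<otimes> inv g) (g \<otimes> b \<otimes> inv g)"
      using ab g by (simp add: commutator_def m_assoc inv_mult_group)
    then show "g \<otimes> h \<otimes> inv g \<in> {commutator G g h |g h. g \<in> carrier G \<and> h \<in> lower_central_series G i}"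
      using ab g normal_conj(1)[OF Suc] by blast
  qed auto
qed

lemma lower_central_series_commutator:
  "\<lbrakk>g \<in> carrier G; h \<in> lower_central_series G i\<rbrakk> \<Longrightarrow> commutator G g h \<in> lower_central_series G (Suc i)"
  by (auto simp: lower_central_series.simps intro!: generate.incl)

lemma lower_central_series_subset: "lower_central_series G i \<subseteq> carrier G"
  using normal_imp_subgroup[OF lower_central_series_normal] subgroup.subset by blast

lemma lower_central_series_central: "lower_central_series G i \<subseteq> central_mod (lower_central_series G (Suc i))"
  using lower_central_series_commutator lower_central_series_subset
  unfolding central_mod_def by blast

lemma lower_central_series_Suc_subset: "lower_central_series G (Suc i) \<subseteq> lower_central_series G i"
  unfolding lower_central_series.simps
  using commutator_in_normal[OF lower_central_series_normal] normal_imp_subgroup[OF lower_central_series_normal]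
  by (intro generate_subgroup_incl) auto

text \<open>Modulo the next term of the series, commutators are multiplicative in each argument. So
  the commutators of finitely many generators of the group with finitely many generators of one
  factor generate the next factor.\<close>

lemma lower_central_series_fin_gen:
  assumes "finitely_generated_group G"
  shows "\<exists>T. finite T \<and> T \<subseteq> lower_central_series G i \<and>
    lower_central_series G i \<subseteq> generate G (T \<union> lower_central_series G (Suc i))"
proof (induction i)
  case 0
  obtain S where S: "finite S" "S \<subseteq> carrier G" "generate G S = carrier G"
    using assms by (auto simp: finitely_generated_group_def)
  then show ?case
    using mono_generate[of S "S \<union> lower_central_series G (Suc 0)"]
    by (intro exI[of _ S]) (auto simp: lower_central_series.simps(1))
next
  case (Suc i)
  let ?L = "lower_central_series G"
  obtain S where S: "finite S" "S \<subseteq> carrier G" "generate G S = carrier G"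
    using assms by (auto simp: finitely_generated_group_def)
  obtain T where T: "finite T" "T \<subseteq> ?L i" "?L i \<subseteq> generate G (T \<union> ?L (Suc i))"
    using Suc by blast
  define C where "C = (\<lambda>(s, t). commutator G s t) ` (S \<times> T)"
  have CL: "C \<subseteq> ?L (Suc i)"
    using S(2) T(2) by (auto simp: C_def intro!: lower_central_series_commutator)
  define B where "B = generate G (C \<union> ?L (Suc (Suc i)))"
  have sub: "C \<union> ?L (Suc (Suc i)) \<subseteq> ?L (Suc i)"
    using CL lower_central_series_Suc_subset[of "Suc i"] by blast
  have Bs: "subgroup B G"
    unfolding B_def using sub lower_central_series_subset by (intro generate_is_subgroup) blast
  have BL: "B \<subseteq> ?L (Suc i)"
    unfolding B_def using sub normal_imp_subgroup[OF lower_central_series_normal]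
    by (intro generate_subgroup_incl)
  have LB: "?L (Suc (Suc i)) \<subseteq> B" and CB: "C \<subseteq> B" unfolding B_def by (auto intro: generate.incl)
  \<comment> \<open>A subgroup between two consecutive terms is normal because the factor is
    central. Normality is what makes the two sets below, one for each argument of the commutator,
    into subgroups.\<close>
  have Bn: "B \<lhd> G"
    using normal_if_central[OF Bs LB] BL lower_central_series_central by blast
  interpret B: normal B G by fact
  have sg: "subgroup {h \<in> carrier G. commutator G g h \<in> B} G" if g: "g \<in> carrier G" for g
  proof
    show "x \<otimes> y \<in> {h \<in> carrier G. commutator G g h \<in> B}"
      if "x \<in> {h \<in> carrier G. commutator G g h \<in> B}" "y \<in> {h \<in> carrier G. commutator G g h \<in> B}" for x y
      using that g normal_conj(1)[OF Bn] by (auto simp: commutator_mult_right)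
    show "\<one> \<in> {h \<in> carrier G. commutator G g h \<in> B}" using g by (auto simp: commutator_def)
    show "inv x \<in> {h \<in> carrier G. commutator G g h \<in> B}"
      if "x \<in> {h \<in> carrier G. commutator G g h \<in> B}" for x
      using that g normal_conj(2)[OF Bn] by (auto simp: commutator_inv_right)
  qed auto
  have sg': "subgroup {g \<in> carrier G. commutator G g h \<in> B} G" if h: "h \<in> carrier G" for h
  proof
    show "x \<otimes> y \<in> {g \<in> carrier G. commutator G g h \<in> B}"
      if "x \<in> {g \<in> carrier G. commutator G g h \<in> B}" "y \<in> {g \<in> carrier G. commutator G g h \<in> B}" for x y
      using that h normal_conj(1)[OF Bn] by (auto simp: commutator_mult_left)
    show "\<one> \<in> {g \<in> carrier G. commutator G g h \<in> B}" using h by (auto simp: commutator_def)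
    show "inv x \<in> {g \<in> carrier G. commutator G g h \<in> B}"
      if "x \<in> {g \<in> carrier G. commutator G g h \<in> B}" for x
      using that h normal_conj(2)[OF Bn] by (auto simp: commutator_inv_left)
  qed auto
  have 1: "commutator G s h \<in> B" if s: "s \<in> S" and h: "h \<in> ?L i" for s h
  proof -
    have "x \<in> carrier G \<and> commutator G s x \<in> B" if "x \<in> T \<union> ?L (Suc i)" for x
    proof -
      have x: "x \<in> carrier G" using that T lower_central_series_subset by blast
      have "commutator G s x \<in> C \<union> ?L (Suc (Suc i))"
        using that s S lower_central_series_commutator[of s x "Suc i"] by (auto simp: C_def)
      then show ?thesis using x CB LB by blast
    qed
    then have "T \<union> ?L (Suc i) \<subseteq> {h \<in> carrier G. commutator G s h \<in> B}" by blast
    then have "generate G (T \<union> ?L (Suc i)) \<subseteq> {h \<in> carrier G. commutator G s h \<in> B}"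
      using sg s S by (intro generate_subgroup_incl) auto
    then show ?thesis using T h by blast
  qed
  have 2: "commutator G g h \<in> B" if g: "g \<in> carrier G" and h: "h \<in> ?L i" for g h
  proof -
    have hc: "h \<in> carrier G" using h lower_central_series_subset by blast
    have "generate G S \<subseteq> {g \<in> carrier G. commutator G g h \<in> B}"
      using 1 h S sg'[OF hc] by (intro generate_subgroup_incl) auto
    then show ?thesis using g S by blast
  qed
  have "?L (Suc i) \<subseteq> B"
    unfolding lower_central_series.simps using 2 Bs by (intro generate_subgroup_incl) auto
  moreover have "finite C" using S T by (auto simp: C_def)
  ultimately show ?case using CL unfolding B_def by blast
qed

text \<open>Climbs from the trivial term of the lower central series, adjoining the generators of
  each factor one at a time. The intermediate subgroups lie between consecutive terms, so they are
  normal, as \<open>noetherian_adjoin\<close> requires.\<close>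

lemma fin_gen_nilpotent_noetherian:
  assumes "finitely_generated_group G" "nilpotent_group G"
  shows "noetherian (carrier G)"
proof -
  let ?L = "lower_central_series G"
  obtain c where c: "?L c = {\<one>}" using assms by (auto simp: nilpotent_group_def)
  have step: "noetherian (?L i)" if nS: "noetherian (?L (Suc i))" for i
  proof -
    obtain T where T: "finite T" "T \<subseteq> ?L i" "?L i \<subseteq> generate G (T \<union> ?L (Suc i))"
      using lower_central_series_fin_gen[OF assms(1)] by blast
    have "noetherian (generate G (T \<union> ?L (Suc i)))"
      using T(1,2)
    proof (induction T rule: finite_induct)
      case empty
      have "generate G ({} \<union> ?L (Suc i)) \<subseteq> ?L (Suc i)"
        using normal_imp_subgroup[OF lower_central_series_normal]
        by (intro generate_subgroup_incl) auto
      then show ?case using noetherian_mono nS by blast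
    next
      case (insert x F)
      let ?B = "generate G (F \<union> ?L (Suc i))"
      have sub: "F \<union> ?L (Suc i) \<subseteq> ?L i"
        using insert lower_central_series_Suc_subset by blast
      have Bs: "subgroup ?B G"
        using sub lower_central_series_subset by (intro generate_is_subgroup) blast
      have BL: "?B \<subseteq> ?L i"
        using sub normal_imp_subgroup[OF lower_central_series_normal]
        by (intro generate_subgroup_incl)
      have Bn: "?B \<lhd> G"
        by (rule normal_if_central[OF Bs, of "?L (Suc i)"])
          (use BL lower_central_series_central in \<open>auto intro: generate.incl\<close>)
      have x: "x \<in> carrier G" using insert lower_central_series_subset by blast
      have "noetherian (adjoin ?B x)"
        using insert by (intro noetherian_adjoin[OF Bn x]) auto
      moreover have "generate G (insert x F \<union> ?L (Suc i)) \<subseteq> adjoin ?B x"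
        using subset_adjoin[OF Bs] mem_adjoin[OF Bs x] adjoin_subgroup[OF Bn x]
        by (intro generate_subgroup_incl) (auto intro: generate.incl)
      ultimately show ?case using noetherian_mono by blast
    qed
    then show ?thesis using T noetherian_mono by blast
  qed
  have base: "noetherian (?L c)"
    unfolding noetherian_def c
  proof (intro allI impI)
    fix H assume "subgroup H G" "H \<subseteq> {\<one>}"
    then have "H = {\<one>}" using subgroup.one_closed by blast
    then show "\<exists>T. finite T \<and> T \<subseteq> H \<and> H = generate G T"
      by (intro exI[of _ "{}"]) (auto simp: generate_empty)
  qed
  have "noetherian (?L (c - j))" if "j \<le> c" for j
    using that
  proof (induction j)
    case (Suc j)
    then have "c - j = Suc (c - Suc j)" by simp
    then show ?case using Suc step by fastforce
  qed (use base in auto)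
  from this[of c] show ?thesis by (simp add: lower_central_series.simps)
qed

text \<open>The union of a chain is generated by a finite set, which already lies in a single member
  of the chain. Hence the union is that member, and Zorn's lemma applies.\<close>

lemma noetherian_maximal:
  assumes "noetherian (carrier G)" "S \<noteq> {}" "\<And>H. H \<in> S \<Longrightarrow> subgroup H G"
  shows "\<exists>M\<in>S. \<forall>X\<in>S. M \<subseteq> X \<longrightarrow> X = M"
proof (rule subset_Zorn_nonempty[OF assms(2)])
  fix C assume C: "C \<noteq> {}" "subset.chain S C"
  then have CS: "C \<subseteq> S" by (auto simp: subset.chain_def)
  have sub: "subgroup (\<Union>C) G"
  proof
    show "\<Union>C \<subseteq> carrier G" using CS assms(3) subgroup.subset by blast
    obtain X where "X \<in> C" using C(1) by auto
    then show "\<one> \<in> \<Union>C" using UnionI[OF _ subgroup.one_closed[of X G]] CS assms(3) by blast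
    show "inv x \<in> \<Union>C" if x: "x \<in> \<Union>C" for x
    proof -
      obtain X where X: "x \<in> X" "X \<in> C" using x by blast
      then have "subgroup X G" using CS assms(3) by blast
      then show ?thesis using UnionI[OF X(2) subgroup.m_inv_closed[OF _ X(1)]] by simp
    qed
    show "x \<otimes> y \<in> \<Union>C" if xy: "x \<in> \<Union>C" "y \<in> \<Union>C" for x y
    proof -
      obtain X Y where XY: "x \<in> X" "X \<in> C" "y \<in> Y" "Y \<in> C" using xy by blast
      then have "X \<subseteq> Y \<or> Y \<subseteq> X" using C(2) by (auto simp: subset.chain_def)
      moreover have "subgroup X G" "subgroup Y G" using XY CS assms(3) by blast+
      ultimately have "x \<otimes> y \<in> X \<or> x \<otimes> y \<in> Y"
        using XY subgroup.m_closed[of X G x y] subgroup.m_closed[of Y G x y] by auto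
      then show ?thesis using XY by auto
    qed
  qed
  obtain T where T: "finite T" "T \<subseteq> \<Union>C" "\<Union>C = generate G T"
    using assms(1)[unfolded noetherian_def, rule_format, OF sub subgroup.subset[OF sub]] by (elim exE conjE)
  obtain X where X: "X \<in> C" "T \<subseteq> X"
    by (rule finite_subset_Union_chain[OF T(1,2) C])
  have "X \<in> S" using X(1) CS by (rule subsetD[rotated])
  then have "\<Union>C \<subseteq> X" using T(3) generate_subgroup_incl[OF X(2) assms(3)] by simp
  then have "\<Union>C = X" using Union_upper[OF X(1)] by (rule equalityI)
  then show "\<Union>C \<in> S" using \<open>X \<in> S\<close> by simp
qed

end

section \<open>Central chains\<close>

context group begin

text \<open>For normal \<open>B\<close> this says that the quotient by \<open>B\<close> is
  torsion-free.\<close>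

definition isolated :: "'a set \<Rightarrow> bool" where
  "isolated B \<longleftrightarrow> (\<forall>x\<in>carrier G. \<forall>k::nat. 0 < k \<longrightarrow> x [^] k \<in> B \<longrightarrow> x \<in> B)"

lemma isolatedD:
  "\<lbrakk>isolated B; x \<in> carrier G; 0 < (k::nat); x [^] k \<in> B\<rbrakk> \<Longrightarrow> x \<in> B"
  by (simp add: isolated_def)

lemma conj_nat_pow:
  "\<lbrakk>g \<in> carrier G; x \<in> carrier G\<rbrakk> \<Longrightarrow> (g \<otimes> x \<otimes> inv g) [^] (k::nat) = g \<otimes> x [^] k \<otimes> inv g"
  by (induction k) (simp_all add: m_assoc)

lemma commute_int_pow:
  assumes "x \<in> carrier G" "y \<in> carrier G" "x \<otimes> y = y \<otimes> x"
  shows "x [^] (i::int) \<otimes> y = y \<otimes> x [^] i"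
proof -
  have "subgroup {z \<in> carrier G. z \<otimes> y = y \<otimes> z} G"
  proof
    fix u v assume u: "u \<in> {z \<in> carrier G. z \<otimes> y = y \<otimes> z}"
    then have uc: "u \<in> carrier G" by simp
    have "inv u \<otimes> y = inv u \<otimes> (y \<otimes> u) \<otimes> inv u" using u assms by (simp add: m_assoc)
    also have "\<dots> = inv u \<otimes> (u \<otimes> y) \<otimes> inv u" using u by simp
    also have "\<dots> = y \<otimes> inv u" using uc assms(2) by (simp add: m_assoc)
    finally show "inv u \<in> {z \<in> carrier G. z \<otimes> y = y \<otimes> z}" using u by simp
    assume v: "v \<in> {z \<in> carrier G. z \<otimes> y = y \<otimes> z}"
    have "(u \<otimes> v) \<otimes> y = u \<otimes> (y \<otimes> v)" using u v assms by (simp add: m_assoc)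
    also have "\<dots> = y \<otimes> (u \<otimes> v)" using u v assms by (simp flip: m_assoc)
    finally show "u \<otimes> v \<in> {z \<in> carrier G. z \<otimes> y = y \<otimes> z}" using u v by simp
  qed (use assms in auto)
  from subgroup_int_pow_closed[OF this, of x i] assms show ?thesis by simp
qed

text \<open>Two commuting elements with a common nontrivial power generate a cyclic group if there
  is no torsion. With d = gcd(k, j), k = d k', j = d j', the element
  \<open>x [^] (- j') \<otimes> y [^] k'\<close> is killed by d, hence trivial; for u k' + v j' = 1
  the element \<open>x [^] u \<otimes> y [^] v\<close> has k'-th power \<open>x\<close> and j'-th
  power \<open>y\<close>.\<close>

lemma commuting_common_root:
  assumes x: "x \<in> carrier G" and y: "y \<in> carrier G" and comm: "x \<otimes> y = y \<otimes> x"
    and eq: "y [^] k = x [^] (j::int)" and k: "k > (0::int)"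
    and tf: "\<And>p q. \<And>n::nat. 0 < n \<Longrightarrow> (x [^] (p::int) \<otimes> y [^] (q::int)) [^] n = \<one> \<Longrightarrow>
      x [^] p \<otimes> y [^] q = \<one>"
  obtains u v p q :: int where "(x [^] u \<otimes> y [^] v) [^] p = x" "(x [^] u \<otimes> y [^] v) [^] q = y"
proof -
  have cp: "x [^] a \<otimes> y [^] b = y [^] b \<otimes> x [^] a" for a b :: int
    using commute_int_pow[OF y _ commute_int_pow[OF x y comm, of a, symmetric], of b] x by simp
  have pw: "(x [^] a \<otimes> y [^] b) [^] c = x [^] (a * c) \<otimes> y [^] (b * c)" for a b c :: int
    using int_pow_mult_distrib[OF cp] x y by (simp add: int_pow_pow)
  define d where "d = gcd k j"
  have d: "d > 0" using k by (simp add: d_def)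
  obtain k' j' where kj: "k = d * k'" "j = d * j'" by (metis d_def gcd_dvd1 gcd_dvd2 dvd_def)
  have "coprime k' j'" using kj d k unfolding d_def
    by (metis gcd_coprime_exists div_gcd_coprime nonzero_mult_div_cancel_left less_irrefl)
  then obtain u v where uv: "u * k' + v * j' = 1"
    by (metis bezout_int coprime_imp_gcd_eq_1)
  have "(x [^] (- j') \<otimes> y [^] k') [^] (nat d) = (x [^] (- j') \<otimes> y [^] k') [^] d"
    using d by (metis int_nat_eq int_pow_int order_less_imp_le)
  also have "\<dots> = x [^] (- j) \<otimes> y [^] k" using kj by (simp add: pw mult.commute)
  also have "\<dots> = \<one>" using eq x by (simp add: int_pow_neg)
  finally have z: "(x [^] (- j') \<otimes> y [^] k') [^] (nat d) = \<one>" .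
  have "x [^] (- j') \<otimes> y [^] k' = \<one>" using d by (intro tf[OF _ z]) simp
  then have e: "y [^] k' = x [^] j'"
    using x y by (metis int_pow_closed int_pow_neg inv_equality inv_inv)
  have "(x [^] u \<otimes> y [^] v) [^] k' = x [^] (u * k') \<otimes> (y [^] k') [^] v"
    using y by (simp add: pw int_pow_pow mult.commute)
  also have "\<dots> = x [^] (u * k' + v * j')"
    using x by (simp add: e int_pow_pow int_pow_mult mult.commute)
  finally have 1: "(x [^] u \<otimes> y [^] v) [^] k' = x" using uv x by simp
  have "(x [^] u \<otimes> y [^] v) [^] j' = (x [^] j') [^] u \<otimes> y [^] (v * j')"
    using x by (simp add: pw int_pow_pow mult.commute)
  also have "\<dots> = y [^] (u * k' + v * j')"
    using y by (simp flip: e add: int_pow_pow int_pow_mult mult.commute)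
  finally have "(x [^] u \<otimes> y [^] v) [^] j' = y" using uv y by simp
  with 1 show ?thesis using that by blast
qed

end

lemma (in group_hom) commutator_hom:
  "\<lbrakk>x \<in> carrier G; y \<in> carrier G\<rbrakk> \<Longrightarrow> h (commutator G x y) = commutator H (h x) (h y)"
  by (simp add: commutator_def)

lemma (in group) commutator_eq_one_iff:
  "\<lbrakk>x \<in> carrier G; y \<in> carrier G\<rbrakk> \<Longrightarrow> commutator G x y = \<one> \<longleftrightarrow> x \<otimes> y = y \<otimes> x"
  unfolding commutator_def
  by (metis inv_closed inv_mult_group inv_solve_right' m_assoc m_closed l_one one_closed)

text \<open>If y = [x, g] is already known to commute with x in the image, then conjugating x by g
  multiplies it by the inverse of y; comparing k-th powers shows that y is torsion, hence trivial.
  As y lies one term deeper than g, induction runs upward from the last term. Stating this for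
  images under \<open>h\<close> covers quotients without transferring the series to them.\<close>

lemma (in group_hom) root_commutes:
  assumes tf: "\<And>x. \<And>k::nat. x \<in> carrier G \<Longrightarrow> 0 < k \<Longrightarrow> h x [^]\<^bsub>H\<^esub> k = \<one>\<^bsub>H\<^esub> \<Longrightarrow> h x = \<one>\<^bsub>H\<^esub>"
    and nil: "lower_central_series G c = {\<one>}"
    and x: "x \<in> carrier G" and k: "0 < (k::nat)"
    and com: "\<And>g. g \<in> carrier G \<Longrightarrow> h g \<otimes>\<^bsub>H\<^esub> h x [^]\<^bsub>H\<^esub> k = h x [^]\<^bsub>H\<^esub> k \<otimes>\<^bsub>H\<^esub> h g"
    and g: "g \<in> carrier G"
  shows "h g \<otimes>\<^bsub>H\<^esub> h x = h x \<otimes>\<^bsub>H\<^esub> h g"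
proof -
  have "h g \<otimes>\<^bsub>H\<^esub> h x = h x \<otimes>\<^bsub>H\<^esub> h g" if "g \<in> lower_central_series G (c - j)" "j \<le> c" for g j
    using that
  proof (induction j arbitrary: g)
    case 0
    then show ?case using nil x by simp
  next
    case (Suc j)
    have gc: "g \<in> carrier G" using Suc.prems G.lower_central_series_subset by blast
    define y where "y = commutator G x g"
    have yc: "y \<in> carrier G" using x gc by (simp add: y_def)
    have "c - j = Suc (c - Suc j)" using Suc.prems by simp
    then have "y \<in> lower_central_series G (c - j)"
      using G.lower_central_series_commutator[OF x Suc.prems(1)] by (simp add: y_def)
    then have yx: "h y \<otimes>\<^bsub>H\<^esub> h x = h x \<otimes>\<^bsub>H\<^esub> h y" using Suc by simp
    then have yx': "inv\<^bsub>H\<^esub> (h y) \<otimes>\<^bsub>H\<^esub> h x = h x \<otimes>\<^bsub>H\<^esub> inv\<^bsub>H\<^esub> (h y)"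
      using H.commute_int_pow[OF _ _ yx, of "-1"] x yc by (simp add: H.int_pow_neg)
    have e: "h g \<otimes>\<^bsub>H\<^esub> h x \<otimes>\<^bsub>H\<^esub> inv\<^bsub>H\<^esub> (h g) = inv\<^bsub>H\<^esub> (h y) \<otimes>\<^bsub>H\<^esub> h x"
      using x gc by (simp add: y_def commutator_hom H.inv_commutator)
        (simp add: commutator_def H.m_assoc)
    have "inv\<^bsub>H\<^esub> (h y) [^]\<^bsub>H\<^esub> k \<otimes>\<^bsub>H\<^esub> h x [^]\<^bsub>H\<^esub> k = (inv\<^bsub>H\<^esub> (h y) \<otimes>\<^bsub>H\<^esub> h x) [^]\<^bsub>H\<^esub> k"
      using H.pow_mult_distrib[OF yx'] x yc by simp
    also have "\<dots> = h g \<otimes>\<^bsub>H\<^esub> h x [^]\<^bsub>H\<^esub> k \<otimes>\<^bsub>H\<^esub> inv\<^bsub>H\<^esub> (h g)"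
      using x gc by (simp flip: e add: H.conj_nat_pow)
    also have "\<dots> = h x [^]\<^bsub>H\<^esub> k" using x gc by (simp add: com H.m_assoc)
    finally have "inv\<^bsub>H\<^esub> (h y) [^]\<^bsub>H\<^esub> k = \<one>\<^bsub>H\<^esub>"
      using x yc by (metis H.inv_closed H.l_cancel_one' H.nat_pow_closed H.r_cancel_one hom_closed)
    then have "h (inv y) [^]\<^bsub>H\<^esub> k = \<one>\<^bsub>H\<^esub>" using yc by simp
    then have "h (inv y) = \<one>\<^bsub>H\<^esub>" using tf[of "inv y"] yc k by simp
    then have "h y = \<one>\<^bsub>H\<^esub>" using yc by (metis H.inv_eq_1_iff hom_closed hom_inv)
    then have "commutator H (h x) (h g) = \<one>\<^bsub>H\<^esub>" using x gc by (simp add: y_def commutator_hom)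
    then show ?case using x gc H.commutator_eq_one_iff by simp
  qed
  from this[of g c] g show ?thesis by (simp add: lower_central_series.simps)
qed

context group begin

section \<open>Computing modulo a normal subgroup\<close>

lemma coset_eq_one_iff:
  assumes "B \<lhd> G" "x \<in> carrier G" shows "B #> x = \<one>\<^bsub>G Mod B\<^esub> \<longleftrightarrow> x \<in> B"
  using assms coset_join1[of B x] coset_join2[of x B] normal_imp_subgroup[OF assms(1)]
  by (auto simp: FactGroup_def)

lemma commute_mod_iff:
  assumes "B \<lhd> G" "g \<in> carrier G" "x \<in> carrier G"
  shows "commutator G g x \<in> B \<longleftrightarrow>
    (B #> g) \<otimes>\<^bsub>G Mod B\<^esub> (B #> x) = (B #> x) \<otimes>\<^bsub>G Mod B\<^esub> (B #> g)"
proof -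
  interpret hm: group_hom G "G Mod B" "\<lambda>a. B #> a" by (rule normal_group_hom[OF assms(1)])
  show ?thesis
    using coset_eq_one_iff[OF assms(1), of "commutator G g x"] hm.commutator_hom[of g x]
      hm.H.commutator_eq_one_iff[of "B #> g" "B #> x"] hm.hom_closed[of g] hm.hom_closed[of x] assms(2,3)
    by (metis commutator_closed)
qed

lemma coset_eq_iff_diff:
  assumes "B \<lhd> G" "x \<in> carrier G" "y \<in> carrier G"
  shows "B #> x = B #> y \<longleftrightarrow> x \<otimes> inv y \<in> B"
proof -
  interpret hm: group_hom G "G Mod B" "\<lambda>a. B #> a" by (rule normal_group_hom[OF assms(1)])
  have "B #> (x \<otimes> inv y) = (B #> x) \<otimes>\<^bsub>G Mod B\<^esub> inv\<^bsub>G Mod B\<^esub> (B #> y)"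
    using assms hm.hom_mult[of x "inv y"] hm.hom_inv[of y] by simp
  then show ?thesis
    using coset_eq_one_iff[OF assms(1), of "x \<otimes> inv y"] assms hm.hom_closed[of x] hm.hom_closed[of y]
    by (metis hm.H.inv_closed hm.H.inv_equality hm.H.inv_inv hm.H.r_inv inv_closed m_closed)
qed

text \<open>Grows upward, since each step is found above the subgroup already reached; the head of
  the list is the generator adjoined last. The bottom is a parameter because chains are needed from
  the trivial group to \<open>G\<close> and from \<open>derived_root\<close> to
  \<open>N 1\<close>.\<close>

inductive central_chain :: "'a set \<Rightarrow> 'a set \<Rightarrow> 'a list \<Rightarrow> bool" for I where
  base: "central_chain I I []"
| step: "central_chain I B xs \<Longrightarrow> x \<in> central_mod B \<Longrightarrow> (\<And>k::int. k \<noteq> 0 \<Longrightarrow> x [^] k \<notin> B) \<Longrightarrow>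
    central_chain I (adjoin B x) (x # xs)"

lemma isolated_int_pow:
  assumes "B \<lhd> G" "isolated B" "x \<in> carrier G" "x \<notin> B" "k \<noteq> (0::int)" shows "x [^] k \<notin> B"
proof
  assume k: "x [^] k \<in> B"
  have "x [^] (- k) \<in> B"
    using k assms subgroup.m_inv_closed[OF normal_imp_subgroup] by (simp add: int_pow_neg)
  then have "x [^] \<bar>k\<bar> \<in> B" using k by (simp add: abs_if)
  then have "x [^] nat \<bar>k\<bar> \<in> B" using int_pow_int[of G x "nat \<bar>k\<bar>"] by simp
  then show False using assms(2)[unfolded isolated_def, rule_format, of x "nat \<bar>k\<bar>"] assms by simp
qed

text \<open>Among the subgroups \<open>adjoin B x\<close> with \<open>x\<close> in \<open>M\<close>,
  outside \<open>B\<close> and central modulo \<open>B\<close>, a maximal one is isolated. If a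
  power of \<open>y\<close> lies in it, then \<open>y\<close> is in \<open>M\<close>, it is central
  modulo \<open>B\<close> by \<open>root_commutes\<close>, and it has a common root \<open>w\<close>
  with \<open>x\<close> modulo \<open>B\<close>.\<close>

lemma isolated_central_step:
  assumes noeth: "noetherian (carrier G)" and nil: "lower_central_series G c = {\<one>}"
    and B: "B \<lhd> G" "isolated B" and M: "M \<lhd> G" "isolated M" and BM: "B \<subseteq> M" "B \<noteq> M"
  obtains x where "x \<in> M" "x \<notin> B" "x \<in> central_mod B" "isolated (adjoin B x)"
proof -
  interpret hm: group_hom G "G Mod B" "\<lambda>a. B #> a" by (rule normal_group_hom[OF B(1)])
  interpret B: normal B G by fact
  interpret M: normal M G by fact
  have "\<exists>x. x \<in> M \<and> x \<notin> B \<and> x \<in> central_mod B"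
  proof -
    \<comment> \<open>At an index where the intersection with \<open>M\<close> drops into
      \<open>B\<close>, an element outside \<open>B\<close> is central modulo \<open>B\<close>: its
      commutators lie in \<open>M\<close> and in the next term.\<close>
    define P where "P = (\<lambda>i. M \<inter> lower_central_series G i \<subseteq> B)"
    have "P c" using nil by (auto simp: P_def)
    moreover have "\<not> P 0" using BM M.subset by (auto simp: P_def lower_central_series.simps)
    ultimately obtain i where i: "\<not> P i" "P (Suc i)"
      by (metis LeastI Least_le not0_implies_Suc lessI not_less)
    then obtain x where x: "x \<in> M" "x \<in> lower_central_series G i" "x \<notin> B" by (auto simp: P_def)
    have "commutator G g x \<in> B" if "g \<in> carrier G" for g
    proof -
      have "commutator G g x \<in> M \<inter> lower_central_series G (Suc i)"
        using commutator_in_normal[OF M(1) that x(1)] lower_central_series_commutator[OF that x(2)] by simp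
      then show ?thesis using i(2) unfolding P_def by (rule subsetD[rotated])
    qed
    then show ?thesis using x by (auto simp: central_mod_def)
  qed
  then have ne: "{adjoin B x |x. x \<in> M \<and> x \<notin> B \<and> x \<in> central_mod B} \<noteq> {}" by blast
  obtain C where C: "C \<in> {adjoin B x |x. x \<in> M \<and> x \<notin> B \<and> x \<in> central_mod B}"
      "\<forall>X\<in>{adjoin B x |x. x \<in> M \<and> x \<notin> B \<and> x \<in> central_mod B}. C \<subseteq> X \<longrightarrow> X = C"
  proof (rule bexE[OF noetherian_maximal[OF noeth ne]])
    fix H assume "H \<in> {adjoin B x |x. x \<in> M \<and> x \<notin> B \<and> x \<in> central_mod B}"
    then show "subgroup H G" using adjoin_subgroup[OF B(1)] by (auto simp: central_mod_def)
  qed auto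
  then obtain x where x: "x \<in> M" "x \<notin> B" "x \<in> central_mod B" "C = adjoin B x" by auto
  have xc: "x \<in> carrier G" using x by (simp add: central_mod_def)
  have Cc: "C \<subseteq> central_mod B"
    using adjoin_least[OF central_mod_subgroup[OF B(1)] normal_subset_central_mod[OF B(1)] x(3)] x(4) by simp
  have CM: "C \<subseteq> M"
    using adjoin_least[OF M.subgroup_axioms BM(1) x(1)] x(4) by simp
  have tf: "B #> z = \<one>\<^bsub>G Mod B\<^esub>"
    if "z \<in> carrier G" "0 < n" "(B #> z) [^]\<^bsub>G Mod B\<^esub> n = \<one>\<^bsub>G Mod B\<^esub>" for z and n :: nat
  proof -
    have "B #> (z [^] n) = \<one>\<^bsub>G Mod B\<^esub>" using that hm.hom_nat_pow[of z n] by simp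
    then have "z [^] n \<in> B" using coset_eq_one_iff[OF B(1)] that by simp
    then have "z \<in> B" using isolatedD[OF B(2) that(1,2)] by simp
    then show ?thesis using coset_eq_one_iff[OF B(1)] that by simp
  qed
  have "y \<in> C" if y: "y \<in> carrier G" "0 < n" "y [^] n \<in> C" for y and n :: nat
  proof (cases "y \<in> B")
    case True
    then show ?thesis using subset_adjoin[OF B.subgroup_axioms] x by blast
  next
    case False
    have yM: "y \<in> M" by (rule isolatedD[OF M(2) y(1,2) subsetD[OF CM y(3)]])
    have cn: "(B #> g) \<otimes>\<^bsub>G Mod B\<^esub> (B #> y) = (B #> y) \<otimes>\<^bsub>G Mod B\<^esub> (B #> g)" if "g \<in> carrier G" for g
    proof (rule hm.root_commutes[OF tf nil y(1,2) _ that])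
      fix g assume g: "g \<in> carrier G"
      have "commutator G g (y [^] n) \<in> B" using y Cc g by (auto simp: central_mod_def)
      then show "(B #> g) \<otimes>\<^bsub>G Mod B\<^esub> (B #> y) [^]\<^bsub>G Mod B\<^esub> n = (B #> y) [^]\<^bsub>G Mod B\<^esub> n \<otimes>\<^bsub>G Mod B\<^esub> (B #> g)"
        using commute_mod_iff[OF B(1) g, of "y [^] n"] y hm.hom_nat_pow[of y n] by simp
    qed
    then have yZ: "y \<in> central_mod B"
      using commute_mod_iff[OF B(1) _ y(1)] y by (auto simp: central_mod_def)
    obtain b j where bj: "y [^] n = b \<otimes> x [^] (j::int)" "b \<in> B"
      using y x by (auto simp: adjoin_def)
    have "y [^] int n \<otimes> inv (x [^] j) = b"
      using bj xc y by (simp add: int_pow_int m_assoc)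
    then have "B #> (y [^] int n) = B #> (x [^] j)"
      using bj(2) xc y coset_eq_iff_diff[OF B(1), of "y [^] int n" "x [^] j"] by simp
    then have eq: "(B #> y) [^]\<^bsub>G Mod B\<^esub> int n = (B #> x) [^]\<^bsub>G Mod B\<^esub> j"
      using hm.hom_int_pow[of y "int n"] hm.hom_int_pow[of x j] xc y by simp
    have img: "B #> (x [^] p \<otimes> y [^] q) =
        (B #> x) [^]\<^bsub>G Mod B\<^esub> p \<otimes>\<^bsub>G Mod B\<^esub> (B #> y) [^]\<^bsub>G Mod B\<^esub> q" for p q :: int
      using hm.hom_mult[of "x [^] p" "y [^] q"] hm.hom_int_pow[of y q] hm.hom_int_pow[of x p] xc y by simp
    obtain u v p q :: int where w:
      "((B #> x) [^]\<^bsub>G Mod B\<^esub> u \<otimes>\<^bsub>G Mod B\<^esub> (B #> y) [^]\<^bsub>G Mod B\<^esub> v) [^]\<^bsub>G Mod B\<^esub> p = B #> x"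
      "((B #> x) [^]\<^bsub>G Mod B\<^esub> u \<otimes>\<^bsub>G Mod B\<^esub> (B #> y) [^]\<^bsub>G Mod B\<^esub> v) [^]\<^bsub>G Mod B\<^esub> q = B #> y"
    proof (rule hm.H.commuting_common_root[of "B #> x" "B #> y" "int n" j])
      show "(B #> x) \<otimes>\<^bsub>G Mod B\<^esub> (B #> y) = (B #> y) \<otimes>\<^bsub>G Mod B\<^esub> (B #> x)" using cn xc by simp
      show "(B #> x) [^]\<^bsub>G Mod B\<^esub> p \<otimes>\<^bsub>G Mod B\<^esub> (B #> y) [^]\<^bsub>G Mod B\<^esub> q = \<one>\<^bsub>G Mod B\<^esub>"
        if "0 < k" "((B #> x) [^]\<^bsub>G Mod B\<^esub> p \<otimes>\<^bsub>G Mod B\<^esub> (B #> y) [^]\<^bsub>G Mod B\<^esub> q) [^]\<^bsub>G Mod B\<^esub> k = \<one>\<^bsub>G Mod B\<^esub>"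
        for p q :: int and k :: nat
        using tf[of "x [^] p \<otimes> y [^] q" k] that xc y unfolding img by simp
    qed (use eq y xc hm.hom_closed in auto)
    define w where "w = x [^] u \<otimes> y [^] v"
    have wc: "w \<in> carrier G" using xc y by (simp add: w_def)
    have wpow: "z \<in> adjoin B w" if "z \<in> carrier G" "B #> (w [^] r) = B #> z" for z and r :: int
    proof -
      have "z \<otimes> inv (w [^] r) \<in> B" using that coset_eq_iff_diff[OF B(1), of z "w [^] r"] wc by simp
      moreover have "z = z \<otimes> inv (w [^] r) \<otimes> w [^] r" using that wc by (simp add: m_assoc)
      ultimately show ?thesis unfolding adjoin_def by blast
    qed
    have w_img: "B #> w = (B #> x) [^]\<^bsub>G Mod B\<^esub> u \<otimes>\<^bsub>G Mod B\<^esub> (B #> y) [^]\<^bsub>G Mod B\<^esub> v"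
      by (simp only: w_def img)
    have wx: "B #> (w [^] p) = B #> x" "B #> (w [^] q) = B #> y"
      by (simp_all only: hm.hom_int_pow[OF wc] w_img w)
    have wM: "w \<in> M" "w \<in> central_mod B"
      unfolding w_def
      using x yM yZ subgroup_int_pow_closed[OF M.subgroup_axioms]
        subgroup_int_pow_closed[OF central_mod_subgroup[OF B(1)]]
        subgroup.m_closed[OF central_mod_subgroup[OF B(1)]] by auto
    have wB: "w \<notin> B"
    proof
      assume "w \<in> B"
      then have "w [^] p \<in> B" using subgroup_int_pow_closed[OF B.subgroup_axioms] by blast
      then have "B #> x = \<one>\<^bsub>G Mod B\<^esub>"
        using wx coset_eq_one_iff[OF B(1), of "w [^] p"] wc by simp
      then show False using x xc coset_eq_one_iff[OF B(1)] by simp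
    qed
    \<comment> \<open>Modulo \<open>B\<close> both \<open>x\<close> and \<open>y\<close> are powers
      of \<open>w\<close>. Maximality of \<open>C\<close> turns the inclusion into an equality,
      which puts \<open>y\<close> in \<open>C\<close>.\<close>
    have "C \<subseteq> adjoin B w"
      using x wpow[OF xc wx(1)] adjoin_subgroup[OF B(1) wc] subset_adjoin[OF B.subgroup_axioms]
      by (simp add: adjoin_least)
    then have "adjoin B w = C" using C(2) wM wB by blast
    then show ?thesis using wpow[OF y(1) wx(2)] by simp
  qed
  then have "isolated C" by (simp add: isolated_def)
  then show ?thesis using that x by simp
qed

text \<open>A maximal isolated subgroup reachable by a chain is \<open>M\<close>, since otherwise
  \<open>isolated_central_step\<close> would extend the chain. Isolation is kept in \<open>S\<close>
  so that the step can be repeated.\<close>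

lemma central_chain_exists:
  assumes noeth: "noetherian (carrier G)" and nil: "lower_central_series G c = {\<one>}"
    and I: "I \<lhd> G" "isolated I" and M: "M \<lhd> G" "isolated M" and IM: "I \<subseteq> M"
  shows "\<exists>xs. central_chain I M xs"
proof -
  define S where "S = {B. B \<lhd> G \<and> isolated B \<and> B \<subseteq> M \<and> (\<exists>xs. central_chain I B xs)}"
  have "I \<in> S" using I IM central_chain.base unfolding S_def by blast
  then have "\<exists>B\<in>S. \<forall>X\<in>S. B \<subseteq> X \<longrightarrow> X = B"
    by (intro noetherian_maximal[OF noeth]) (auto simp: S_def normal_imp_subgroup)
  then obtain B where B: "B \<in> S" "\<forall>X\<in>S. B \<subseteq> X \<longrightarrow> X = B" by blast
  have B': "B \<lhd> G" "isolated B" "B \<subseteq> M" using B by (auto simp: S_def)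
  have "B = M"
  proof (rule ccontr)
    assume "B \<noteq> M"
    then obtain x where x: "x \<in> M" "x \<notin> B" "x \<in> central_mod B" "isolated (adjoin B x)"
      using isolated_central_step[OF noeth nil B'(1,2) M B'(3)] by blast
    have xc: "x \<in> carrier G" using x by (simp add: central_mod_def)
    have "adjoin B x \<in> S"
      unfolding S_def using B' x M B(1) isolated_int_pow[OF B'(1,2) xc x(2)]
        adjoin_normal[OF B'(1) x(3)] adjoin_least[OF normal_imp_subgroup[OF M(1)] B'(3) x(1)]
      by (auto simp: S_def intro: central_chain.step)
    then have "adjoin B x = B" using B subset_adjoin[OF normal_imp_subgroup[OF B'(1)]] by blast
    then show False using mem_adjoin[OF normal_imp_subgroup[OF B'(1)] xc] x by blast
  qed
  then show ?thesis using B by (auto simp: S_def)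
qed

lemma central_chain_sequence:
  assumes "central_chain I M xs" "I \<lhd> G"
  shows "\<exists>N a. N 0 = M \<and> N (length xs) = I \<and> (\<forall>i\<le>length xs. N i \<lhd> G) \<and>
    (\<forall>i<length xs. N i = adjoin (N (Suc i)) (a (Suc i)) \<and> a (Suc i) \<in> central_mod (N (Suc i)) \<and>
       (\<forall>k::int. k \<noteq> 0 \<longrightarrow> a (Suc i) [^] k \<notin> N (Suc i)))"
  using assms(1)
proof induction
  case base
  then show ?case using assms(2) by (intro exI[of _ "\<lambda>_. I"]) auto
next
  case (step B xs x)
  then obtain N a where N: "N 0 = B" "N (length xs) = I" "\<forall>i\<le>length xs. N i \<lhd> G"
    "\<forall>i<length xs. N i = adjoin (N (Suc i)) (a (Suc i)) \<and> a (Suc i) \<in> central_mod (N (Suc i)) \<and>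
       (\<forall>k::int. k \<noteq> 0 \<longrightarrow> a (Suc i) [^] k \<notin> N (Suc i))" by auto
  have "B \<lhd> G" using N(3)[rule_format, of 0] N(1) by simp
  then have "adjoin B x \<lhd> G" using adjoin_normal[OF _ step.hyps(2)] by simp
  \<comment> \<open>The new top subgroup takes index 0 and its generator index 1; everything else
    moves up by one.\<close>
  define N' where "N' = case_nat (adjoin B x) N"
  define a' where "a' = (\<lambda>i::nat. if i = 1 then x else a (i - 1))"
  have "N' i \<lhd> G" if "i \<le> length (x # xs)" for i
    using that N(3) \<open>adjoin B x \<lhd> G\<close> by (cases i) (auto simp: N'_def)
  moreover have "N' i = adjoin (N' (Suc i)) (a' (Suc i)) \<and> a' (Suc i) \<in> central_mod (N' (Suc i)) \<and>
      (\<forall>k::int. k \<noteq> 0 \<longrightarrow> a' (Suc i) [^] k \<notin> N' (Suc i))" if "i < length (x # xs)" for i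
    using that N(1,4) step.hyps(2,3) by (cases i) (auto simp: N'_def a'_def)
  moreover have "N' 0 = adjoin B x" "N' (length (x # xs)) = I" using N(2) by (auto simp: N'_def)
  ultimately show ?case by blast
qed

end

section \<open>Polynomial coordinates\<close>

context group begin

text \<open>Every element of \<open>adjoin B x\<close> is \<open>u \<otimes> x [^] k\<close> with
  \<open>u\<close> in \<open>B\<close>; \<open>expo\<close> returns k and \<open>resid\<close>
  returns u. The base stands on the left to suit left differences: left factors from
  \<open>B\<close> pass through \<open>resid\<close>, right factors that are powers of
  \<open>x\<close> disappear. Outside \<open>adjoin B x\<close> the values are arbitrary.\<close>

definition expo :: "'a set \<Rightarrow> 'a \<Rightarrow> 'a \<Rightarrow> int" where
  "expo B x g = (THE k. \<exists>u\<in>B. g = u \<otimes> x [^] k)"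

definition resid :: "'a set \<Rightarrow> 'a \<Rightarrow> 'a \<Rightarrow> 'a" where
  "resid B x g = g \<otimes> x [^] (- expo B x g)"

definition ldiff :: "'a \<Rightarrow> ('a \<Rightarrow> rat) \<Rightarrow> 'a \<Rightarrow> rat" where
  "ldiff g F x = F (g \<otimes> x) - F x"

text \<open>As functions of n both sides agree at 0. Their increments agree by Pascal's rule and the
  formula for \<open>ldiff g F\<close>, which needs one difference less. Two-sided induction on n
  covers negative exponents.\<close>

lemma newton_expansion:
  assumes g: "g \<in> carrier G" and "z \<in> carrier G"
    and "\<And>z. z \<in> carrier G \<Longrightarrow> (ldiff g ^^ d) F z = 0"
  shows "F (g [^] (n::int) \<otimes> z) = (\<Sum>i<d. (of_int n gchoose i) * (ldiff g ^^ i) F z)"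
  using assms(2,3)
proof (induction d arbitrary: F n z)
  case 0
  then show ?case using g by simp
next
  case (Suc d)
  define h where "h = (\<lambda>n::int. F (g [^] n \<otimes> z))"
  define S where "S = (\<lambda>n::int. \<Sum>i<Suc d. (of_int n gchoose i) * (ldiff g ^^ i) F z)"
  have 1: "h (n + 1) - h n = S (n + 1) - S n" for n
  proof -
    have "g [^] (n + 1) \<otimes> z = g \<otimes> (g [^] n \<otimes> z)"
      using g Suc.prems(1) int_pow_mult[OF g, of 1 n] by (simp add: add.commute m_assoc)
    then have "h (n + 1) - h n = ldiff g F (g [^] n \<otimes> z)"
      by (simp add: h_def ldiff_def)
    also have "\<dots> = (\<Sum>i<d. (of_int n gchoose i) * (ldiff g ^^ i) (ldiff g F) z)"
      using Suc.prems by (intro Suc.IH) (simp_all add: funpow_swap1)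
    also have "\<dots> = (\<Sum>i<d. ((of_int (n + 1) gchoose Suc i) - (of_int n gchoose Suc i)) * (ldiff g ^^ Suc i) F z)"
      by (intro sum.cong) (simp_all add: gbinomial_Suc_Suc funpow_swap1)
    also have "\<dots> = S (n + 1) - S n"
      unfolding S_def sum.lessThan_Suc_shift by (simp add: sum_subtractf algebra_simps)
    finally show ?thesis .
  qed
  have 0: "h 0 = S 0"
    unfolding S_def sum.lessThan_Suc_shift using Suc.prems(1) by (simp add: h_def)
  have "h n = S n"
  proof (induction n rule: int_induct[where k = 0])
    case (step1 i)
    then show ?case using 1[of i] by simp
  next
    case (step2 i)
    then show ?case using 1[of "i - 1"] by simp
  qed (rule 0)
  then show ?case by (simp add: h_def S_def)
qed

section \<open>Exponent and residue modulo a subgroup with infinite cyclic quotient\<close>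

context
  fixes B x assumes B: "B \<lhd> G" and x: "x \<in> carrier G" and free: "\<And>k::int. k \<noteq> 0 \<Longrightarrow> x [^] k \<notin> B"
begin

lemma expo_eq: assumes "u \<in> B" shows "expo B x (u \<otimes> x [^] k) = k"
  unfolding expo_def
proof (rule the_equality)
  interpret B: normal B G by (rule B)
  show "\<exists>v\<in>B. u \<otimes> x [^] k = v \<otimes> x [^] k" using assms by blast
  fix l :: int assume "\<exists>v\<in>B. u \<otimes> x [^] k = v \<otimes> x [^] l"
  then obtain v where v: "v \<in> B" "u \<otimes> x [^] k = v \<otimes> x [^] l" by blast
  have uv: "u \<in> carrier G" "v \<in> carrier G" using v assms by simp_all
  have "inv v \<otimes> (u \<otimes> x [^] k) = x [^] l" by (simp only: v(2) inv_cancel_left(1)[OF uv(2) int_pow_closed[OF x]])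
  then have "inv v \<otimes> u \<otimes> x [^] k = x [^] l" using uv v assms x by (simp add: m_assoc)
  then have "inv v \<otimes> u = x [^] l \<otimes> inv (x [^] k)"
    using inv_solve_right[of "inv v \<otimes> u" "x [^] l" "x [^] k"] uv v assms x by auto
  then have "x [^] (l - k) = inv v \<otimes> u" using x by (simp add: int_pow_diff)
  also have "\<dots> \<in> B" using v assms by simp
  finally show "l = k" using free[of "l - k"] by auto
qed

lemma resid_eq: "u \<in> B \<Longrightarrow> resid B x (u \<otimes> x [^] (k::int)) = u"
  using x subgroup.mem_carrier[OF normal_imp_subgroup[OF B], of u]
  by (simp add: resid_def expo_eq m_assoc int_pow_neg)

lemma
  assumes "g \<in> adjoin B x"
  shows resid_in: "resid B x g \<in> B" and resid_expo: "g = resid B x g \<otimes> x [^] expo B x g"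
  using assms by (auto simp: adjoin_def resid_eq expo_eq)

lemma adjoin_cases:
  assumes "g \<in> adjoin B x" obtains u k where "u \<in> B" "g = u \<otimes> x [^] (k::int)" "u \<in> carrier G"
  using assms subgroup.mem_carrier[OF normal_imp_subgroup[OF B]] by (auto simp: adjoin_def)

lemma expo_mult:
  assumes "g \<in> adjoin B x" "h \<in> adjoin B x" shows "expo B x (g \<otimes> h) = expo B x g + expo B x h"
proof -
  obtain u k v l where uv: "u \<in> B" "g = u \<otimes> x [^] (k::int)" "u \<in> carrier G"
    "v \<in> B" "h = v \<otimes> x [^] (l::int)" "v \<in> carrier G" using assms by (metis adjoin_cases)
  have "g \<otimes> h = (u \<otimes> (x [^] k \<otimes> v \<otimes> inv (x [^] k))) \<otimes> x [^] (k + l)"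
    using uv x by (simp add: int_pow_mult m_assoc)
  moreover have "u \<otimes> (x [^] k \<otimes> v \<otimes> inv (x [^] k)) \<in> B"
    using uv x normal_conj(1)[OF B] subgroup.m_closed[OF normal_imp_subgroup[OF B]] by simp
  ultimately show ?thesis using uv by (simp add: expo_eq)
qed

lemma resid_pow_right:
  assumes "g \<in> adjoin B x" shows "resid B x (g \<otimes> x [^] (l::int)) = resid B x g"
proof -
  obtain u k where u: "u \<in> B" "g = u \<otimes> x [^] (k::int)" "u \<in> carrier G"
    using assms by (metis adjoin_cases)
  then have "g \<otimes> x [^] l = u \<otimes> x [^] (k + l)" using x by (simp add: int_pow_mult m_assoc)
  then show ?thesis using u by (simp add: resid_eq)
qed

lemma resid_mult_left:
  assumes "u \<in> B" "h \<in> adjoin B x" shows "resid B x (u \<otimes> h) = u \<otimes> resid B x h"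
proof -
  obtain v l where v: "v \<in> B" "h = v \<otimes> x [^] (l::int)" "v \<in> carrier G"
    using assms by (metis adjoin_cases)
  have u: "u \<in> carrier G" using assms subgroup.mem_carrier[OF normal_imp_subgroup[OF B]] by blast
  have "u \<otimes> h = (u \<otimes> v) \<otimes> x [^] l" using u v x by (simp add: m_assoc)
  moreover have "u \<otimes> v \<in> B" using assms v subgroup.m_closed[OF normal_imp_subgroup[OF B]] by simp
  ultimately show ?thesis using v by (simp add: resid_eq)
qed

text \<open>\<open>resid\<close> is constant on the left cosets of the powers of \<open>x\<close>,
  so \<open>h\<close> may be replaced by its residue. This lets \<open>weight_le_extend\<close>
  express a difference of a function of the residue again as a function of the residue.\<close>

lemma resid_mult_resid:
  assumes "g \<in> adjoin B x" "h \<in> adjoin B x"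
  shows "resid B x (g \<otimes> h) = resid B x (g \<otimes> resid B x h)"
proof -
  obtain v l where v: "v \<in> B" "h = v \<otimes> x [^] (l::int)" "v \<in> carrier G"
    using assms by (metis adjoin_cases)
  have gc: "g \<in> carrier G" using assms subgroup.mem_carrier[OF adjoin_subgroup[OF B x]] by blast
  have "g \<otimes> v \<in> adjoin B x"
    using assms v subset_adjoin[OF normal_imp_subgroup[OF B]] subgroup.m_closed[OF adjoin_subgroup[OF B x]]
    by blast
  then have "resid B x (g \<otimes> v \<otimes> x [^] l) = resid B x (g \<otimes> v)" by (rule resid_pow_right)
  then show ?thesis using v gc x by (simp add: resid_eq m_assoc)
qed

lemma expo_base: "u \<in> B \<Longrightarrow> expo B x u = 0" and resid_base: "u \<in> B \<Longrightarrow> resid B x u = u"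
  using expo_eq[of u 0] resid_eq[of u 0] subgroup.mem_carrier[OF normal_imp_subgroup[OF B]] by simp_all

lemma expo_gen: "expo B x (x [^] (k::int)) = k"
  using expo_eq[of \<one> k] subgroup.one_closed[OF normal_imp_subgroup[OF B]] x by simp

end

end

locale central_sequence = group G for G (structure) +
  fixes m :: nat and N :: "nat \<Rightarrow> 'a set" and a :: "nat \<Rightarrow> 'a"
  assumes N_0: "N 0 = carrier G" and N_m: "N m = {\<one>}"
    and N_normal: "i \<le> m \<Longrightarrow> N i \<lhd> G"
    and N_step: "i < m \<Longrightarrow> N i = adjoin (N (Suc i)) (a (Suc i))"
    and a_central: "i < m \<Longrightarrow> a (Suc i) \<in> central_mod (N (Suc i))"
    and a_free: "\<lbrakk>i < m; k \<noteq> (0::int)\<rbrakk> \<Longrightarrow> a (Suc i) [^] k \<notin> N (Suc i)"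
begin

lemma N_subgroup: "i \<le> m \<Longrightarrow> subgroup (N i) G"
  by (rule normal_imp_subgroup[OF N_normal])

lemma N_carrier: "i \<le> m \<Longrightarrow> x \<in> N i \<Longrightarrow> x \<in> carrier G"
  using subgroup.mem_carrier[OF N_subgroup] by blast

lemma a_carrier: "i < m \<Longrightarrow> a (Suc i) \<in> carrier G"
  using a_central by (auto simp: central_mod_def)

lemma a_in_N: "i < m \<Longrightarrow> a (Suc i) \<in> N i"
  using mem_adjoin[OF N_subgroup a_carrier] N_step by auto

lemma N_Suc_subset: "i < m \<Longrightarrow> N (Suc i) \<subseteq> N i"
  using subset_adjoin[OF N_subgroup] N_step by auto

lemma N_antimono: "j \<le> i \<Longrightarrow> i \<le> m \<Longrightarrow> N i \<subseteq> N j"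
proof (induction i rule: dec_induct)
  case (step i)
  then show ?case using N_Suc_subset[of i] by auto
qed auto

lemma N_commutator:
  assumes "i < m" "g \<in> carrier G" "x \<in> N i" shows "commutator G g x \<in> N (Suc i)"
proof -
  have "N i \<subseteq> central_mod (N (Suc i))"
    unfolding N_step[OF assms(1)] using assms(1)
    by (intro adjoin_least central_mod_subgroup N_normal normal_subset_central_mod a_central) auto
  then show ?thesis using assms by (auto simp: central_mod_def)
qed

abbreviation "kap i \<equiv> expo (N (Suc i)) (a (Suc i))"
abbreviation "nu i \<equiv> resid (N (Suc i)) (a (Suc i))"

lemma step_facts:
  assumes "i < m"
  shows "N (Suc i) \<lhd> G" "a (Suc i) \<in> carrier G" "\<And>k::int. k \<noteq> 0 \<Longrightarrow> a (Suc i) [^] k \<notin> N (Suc i)"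
  using assms N_normal a_carrier a_free by simp_all

lemma kap_mult: "\<lbrakk>i < m; g \<in> N i; h \<in> N i\<rbrakk> \<Longrightarrow> kap i (g \<otimes> h) = kap i g + kap i h"
  using expo_mult[OF step_facts] N_step by auto

lemma nu_in: "\<lbrakk>i < m; g \<in> N i\<rbrakk> \<Longrightarrow> nu i g \<in> N (Suc i)"
  using resid_in[OF step_facts] N_step by auto

lemma nu_kap: "\<lbrakk>i < m; g \<in> N i\<rbrakk> \<Longrightarrow> g = nu i g \<otimes> a (Suc i) [^] kap i g"
  using resid_expo[OF step_facts] N_step by auto

text \<open>Elements of \<open>N i\<close> have weight \<open>2\<^sup>i\<close>. As \<open>2\<^sup>i\<^sup>+\<^sup>1 \<ge> 2\<^sup>i + 2\<^sup>j\<close> for \<open>j \<le> i\<close>, conjugation changes a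
  function on \<open>N j\<close> by one whose weight is lower by \<open>2\<^sup>j\<close>, the weight of the generator that extends
  the domain in \<open>weight_le_extend\<close>. Weight \<open>0\<close> is reserved for the zero function.\<close>
function weight_le :: "nat \<Rightarrow> nat \<Rightarrow> ('a \<Rightarrow> rat) \<Rightarrow> bool" where
  "weight_le j 0 F \<longleftrightarrow> (\<forall>x\<in>N j. F x = 0)"
| "weight_le j (Suc d) F \<longleftrightarrow> (\<forall>i g. j \<le> i \<longrightarrow> i \<le> m \<longrightarrow> g \<in> N i \<longrightarrow> weight_le j (Suc d - 2 ^ i) (ldiff g F))"
  by pat_completeness auto
termination by (relation "Wellfounded.measure (\<lambda>(j, d, F). d)") (auto simp: diff_less)

declare weight_le.simps [simp del]

lemma weight_le_0: "weight_le j 0 F \<longleftrightarrow> (\<forall>x\<in>N j. F x = 0)"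
  by (simp add: weight_le.simps)

lemma weight_le_pos:
  "0 < d \<Longrightarrow> weight_le j d F \<longleftrightarrow> (\<forall>i g. j \<le> i \<longrightarrow> i \<le> m \<longrightarrow> g \<in> N i \<longrightarrow> weight_le j (d - 2 ^ i) (ldiff g F))"
  by (cases d) (simp_all add: weight_le.simps)

section \<open>Calculus of weights\<close>

lemma mult_in_N: "\<lbrakk>j \<le> i; i \<le> m; g \<in> N i; x \<in> N j\<rbrakk> \<Longrightarrow> g \<otimes> x \<in> N j"
  using N_antimono[of j i] subgroup.m_closed[OF N_subgroup[of j]] by auto

lemma weight_le_ldiff:
  assumes "weight_le j d F" "j \<le> i" "i \<le> m" "g \<in> N i" shows "weight_le j (d - 2 ^ i) (ldiff g F)"
proof (cases "d = 0")
  case True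
  have "g \<otimes> x \<in> N j" if "x \<in> N j" for x
    using that assms mult_in_N by blast
  then show ?thesis using assms True by (auto simp: weight_le_0 ldiff_def)
qed (use assms weight_le_pos in auto)

lemma weight_le_cong:
  assumes "weight_le j d F" "\<And>x. x \<in> N j \<Longrightarrow> F x = F' x" shows "weight_le j d F'"
  using assms
proof (induction d arbitrary: F F' rule: less_induct)
  case (less d)
  show ?case
  proof (cases "d = 0")
    case True
    then show ?thesis using less.prems by (auto simp: weight_le_0)
  next
    case False
    have "weight_le j (d - 2 ^ i) (ldiff g F')" if "j \<le> i" "i \<le> m" "g \<in> N i" for i g
      using False less.prems(2) mult_in_N[OF that]
      by (intro less.IH[OF _ weight_le_ldiff[OF less.prems(1) that]]) (auto simp: ldiff_def)
    then show ?thesis using False by (simp add: weight_le_pos)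
  qed
qed

lemma weight_le_zero: "(\<And>x. x \<in> N j \<Longrightarrow> F x = 0) \<Longrightarrow> weight_le j d F"
proof (induction d arbitrary: F rule: less_induct)
  case (less d)
  have "weight_le j (d - 2 ^ i) (ldiff g F)" if "j \<le> i" "i \<le> m" "g \<in> N i" "d \<noteq> 0" for i g
    using that less.prems mult_in_N[OF that(1,2,3)]
    by (intro less.IH) (auto simp: ldiff_def)
  then show ?case using less.prems by (cases "d = 0") (auto simp: weight_le_0 weight_le_pos)
qed

lemma weight_le_mono: "weight_le j d F \<Longrightarrow> d \<le> e \<Longrightarrow> weight_le j e F"
proof (induction d arbitrary: e F rule: less_induct)
  case (less d)
  show ?case
  proof (cases "d = 0")
    case True
    then show ?thesis using less.prems by (auto simp: weight_le_0 intro: weight_le_zero)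
  next
    case False
    have "weight_le j (e - 2 ^ i) (ldiff g F)" if "j \<le> i" "i \<le> m" "g \<in> N i" for i g
      using False less.prems(2)
      by (intro less.IH[OF _ weight_le_ldiff[OF less.prems(1) that]]) auto
    then show ?thesis using False less.prems(2) by (simp add: weight_le_pos)
  qed
qed

lemma weight_le_add:
  "weight_le j d F \<Longrightarrow> weight_le j d F' \<Longrightarrow> weight_le j d (\<lambda>x. F x + F' x)"
proof (induction d arbitrary: F F' rule: less_induct)
  case (less d)
  have "weight_le j (d - 2 ^ i) (ldiff g (\<lambda>x. F x + F' x))" if "j \<le> i" "i \<le> m" "g \<in> N i" "d \<noteq> 0" for i g
  proof -
    have "weight_le j (d - 2 ^ i) (\<lambda>x. ldiff g F x + ldiff g F' x)"
      using that less.prems by (intro less.IH weight_le_ldiff) auto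
    then show ?thesis by (rule weight_le_cong) (simp add: ldiff_def)
  qed
  then show ?case using less.prems by (cases "d = 0") (auto simp: weight_le_0 weight_le_pos)
qed

lemma conj_in_N: "\<lbrakk>i \<le> m; s \<in> carrier G; x \<in> N i\<rbrakk> \<Longrightarrow> s \<otimes> x \<otimes> inv s \<in> N i"
  using normal_conj(1)[OF N_normal] by blast

text \<open>Conjugation is an automorphism that preserves every \<open>N i\<close>, so it carries
  each direction of difference to one of the same weight.\<close>

lemma weight_le_conj:
  assumes "weight_le j d F" "s \<in> carrier G" "j \<le> m"
  shows "weight_le j d (\<lambda>x. F (s \<otimes> x \<otimes> inv s))"
  using assms(1)
proof (induction d arbitrary: F rule: less_induct)
  case (less d)
  have "weight_le j (d - 2 ^ i) (ldiff g (\<lambda>x. F (s \<otimes> x \<otimes> inv s)))"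
    if "j \<le> i" "i \<le> m" "g \<in> N i" "d \<noteq> 0" for i g
  proof -
    let ?g = "s \<otimes> g \<otimes> inv s"
    have "weight_le j (d - 2 ^ i) (\<lambda>x. ldiff ?g F (s \<otimes> x \<otimes> inv s))"
      using that less.prems assms by (intro less.IH weight_le_ldiff conj_in_N) auto
    then show ?thesis
    proof (rule weight_le_cong)
      fix x assume "x \<in> N j"
      then have "x \<in> carrier G" "g \<in> carrier G"
        using that assms(3) N_carrier[of j x] N_carrier[of i g] by auto
      then have "?g \<otimes> (s \<otimes> x \<otimes> inv s) = s \<otimes> (g \<otimes> x) \<otimes> inv s" using assms by (simp add: m_assoc)
      then show "ldiff ?g F (s \<otimes> x \<otimes> inv s) = ldiff g (\<lambda>x. F (s \<otimes> x \<otimes> inv s)) x"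
        by (simp add: ldiff_def)
    qed
  qed
  then show ?case using less.prems assms conj_in_N by (cases "d = 0") (auto simp: weight_le_0 weight_le_pos)
qed

lemma weight_le_left_translate:
  assumes "weight_le j d F" "g \<in> N j" "j \<le> m" shows "weight_le j d (\<lambda>x. F (g \<otimes> x))"
proof -
  have "weight_le j d (ldiff g F)"
    by (rule weight_le_mono[OF weight_le_ldiff[OF assms(1) order_refl assms(3,2)]]) simp
  then have "weight_le j d (\<lambda>x. F x + ldiff g F x)" by (rule weight_le_add[OF assms(1)])
  then show ?thesis by (rule weight_le_cong) (simp add: ldiff_def)
qed

text \<open>With q = [s, g] one has s (g x) s^-1 = q g (s x s^-1). Hence the difference of the
  conjugation defect in direction g is a difference of \<open>F\<close> in the deeper direction q
  plus the conjugation defect of \<open>ldiff g F\<close>; the first term is bounded directly, the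
  second by induction.\<close>

lemma weight_le_conj_diff:
  assumes "weight_le j d F" and s: "s \<in> carrier G" and j: "j < m"
  shows "weight_le j (d - 2 ^ j) (\<lambda>x. F (s \<otimes> x \<otimes> inv s) - F x)"
  using assms(1)
proof (induction d arbitrary: F rule: less_induct)
  case (less d)
  show ?case
  proof (cases "d - 2 ^ j = 0")
    case True
    \<comment> \<open>If d is at most 2^j, a single difference kills \<open>F\<close> on
      \<open>N j\<close>. The direction [s, x] is allowed to depend on the point x.\<close>
    have "F (s \<otimes> x \<otimes> inv s) - F x = 0" if x: "x \<in> N j" for x
    proof -
      have xc: "x \<in> carrier G" using x j N_carrier[of j x] by simp
      have q: "commutator G s x \<in> N j" using N_commutator[OF j s x] N_Suc_subset[OF j] by blast
      have "weight_le j 0 (ldiff (commutator G s x) F)"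
        using weight_le_ldiff[OF less.prems order_refl _ q] j True by simp
      then have "ldiff (commutator G s x) F x = 0" using x by (simp add: weight_le_0)
      then show ?thesis using xc s by (simp add: ldiff_def conj_eq_commutator_mult)
    qed
    then show ?thesis by (rule weight_le_zero)
  next
    case False
    have "weight_le j (d - 2 ^ j - 2 ^ i) (ldiff g (\<lambda>x. F (s \<otimes> x \<otimes> inv s) - F x))"
      if i: "j \<le> i" "i \<le> m" "g \<in> N i" for i g
    proof (cases "i = m")
      \<comment> \<open>For i = m there is no deeper subgroup to hold the commutator, but then g is
        the unit.\<close>
      case True
      then have "g = \<one>" using i N_m by simp
      have "ldiff g (\<lambda>x. F (s \<otimes> x \<otimes> inv s) - F x) x = 0" if "x \<in> N j" for x
        using that j N_carrier[of j x] \<open>g = \<one>\<close> by (simp add: ldiff_def)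
      then show ?thesis by (rule weight_le_zero)
    next
      case False
      then have im: "i < m" using i by simp
      define q where "q = commutator G s g"
      have gc: "g \<in> carrier G" using i N_carrier by blast
      have q: "q \<in> N (Suc i)" using N_commutator[OF im s] i by (simp add: q_def)
      have gj: "g \<in> N j" using i N_antimono by blast
      have e: "(2::nat) ^ j \<le> 2 ^ i" using i by simp
      have 1: "weight_le j (d - 2 ^ Suc i) (\<lambda>x. ldiff q F (g \<otimes> (s \<otimes> x \<otimes> inv s)))"
        using weight_le_conj[OF weight_le_left_translate[OF weight_le_ldiff[OF less.prems _ _ q] gj] s]
          i im j by simp
      have 2: "weight_le j (d - 2 ^ i - 2 ^ j) (\<lambda>x. ldiff g F (s \<otimes> x \<otimes> inv s) - ldiff g F x)"
        using False \<open>d - 2 ^ j \<noteq> 0\<close> by (intro less.IH weight_le_ldiff[OF less.prems] i) auto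
      have "weight_le j (d - 2 ^ j - 2 ^ i)
         (\<lambda>x. ldiff q F (g \<otimes> (s \<otimes> x \<otimes> inv s)) + (ldiff g F (s \<otimes> x \<otimes> inv s) - ldiff g F x))"
      proof (intro weight_le_add weight_le_mono[OF 1] weight_le_mono[OF 2])
        show "d - 2 ^ Suc i \<le> d - 2 ^ j - 2 ^ i"
          unfolding diff_diff_left power_Suc using e by (intro diff_le_mono2) linarith
      qed simp
      then show ?thesis
      proof (rule weight_le_cong)
        fix x assume "x \<in> N j"
        then have xc: "x \<in> carrier G" using N_carrier[of j] j by simp
        have "s \<otimes> (g \<otimes> x) \<otimes> inv s = q \<otimes> (g \<otimes> (s \<otimes> x \<otimes> inv s))"
          using xc gc s by (simp add: q_def commutator_def m_assoc)
        then show "ldiff q F (g \<otimes> (s \<otimes> x \<otimes> inv s)) + (ldiff g F (s \<otimes> x \<otimes> inv s) - ldiff g F x) =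
            ldiff g (\<lambda>x. F (s \<otimes> x \<otimes> inv s) - F x) x"
          by (simp add: ldiff_def)
      qed
    qed
    then show ?thesis using False by (simp add: weight_le_pos)
  qed
qed

text \<open>For g in \<open>N (Suc j)\<close> differences of the extended function come from those
  of \<open>F\<close>. Otherwise g = h s with s a power of \<open>a (Suc j)\<close>, and left
  multiplication by g acts on residues as y -> h (s y s^-1). The change of \<open>F\<close> is then
  a conjugate of \<open>ldiff h F\<close> plus the conjugation defect of \<open>F\<close>; both lose
  2^(j+1), which is at least the required 2^j.\<close>

lemma weight_le_extend:
  assumes "weight_le (Suc j) d F" and j: "j < m"
  shows "weight_le j d (\<lambda>x. F (nu j x))"
  using assms(1)
proof (induction d arbitrary: F rule: less_induct)
  case (less d)
  show ?case
  proof (cases "d = 0")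
    case True
    then show ?thesis using less.prems nu_in[OF j] by (simp add: weight_le_0)
  next
    case False
    have "weight_le j (d - 2 ^ i) (ldiff g (\<lambda>x. F (nu j x)))" if i: "j \<le> i" "i \<le> m" "g \<in> N i" for i g
    proof -
      have gj: "g \<in> N j" using i N_antimono by blast
      then have gc: "g \<in> carrier G" using N_carrier[of j] j by simp
      \<comment> \<open>A difference of \<open>F\<close> composed with \<open>nu j\<close> is again
        some function on \<open>N (Suc j)\<close> composed with \<open>nu j\<close>. Bounding the
        weight of that function closes the induction.\<close>
      have "weight_le (Suc j) (d - 2 ^ i) (\<lambda>y. F (nu j (g \<otimes> y)) - F y)"
      proof (cases "i = j")
        case False
        then have i': "Suc j \<le> i" using i by simp
        have gs: "g \<in> N (Suc j)" using i' i N_antimono by blast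
        show ?thesis
        proof (rule weight_le_cong[OF weight_le_ldiff[OF less.prems i' i(2,3)]])
          fix y assume "y \<in> N (Suc j)"
          then have "g \<otimes> y \<in> N (Suc j)" using mult_in_N[OF i' i(2,3)] by simp
          then show "ldiff g F y = F (nu j (g \<otimes> y)) - F y"
            using resid_base[OF step_facts[OF j]] by (simp add: ldiff_def)
        qed
      next
        case True
        obtain h k where h: "h \<in> N (Suc j)" "g = h \<otimes> a (Suc j) [^] (k::int)"
          using gj N_step[OF j] by (auto simp: adjoin_def)
        define s where "s = a (Suc j) [^] k"
        have s: "s \<in> carrier G" using a_carrier[OF j] by (simp add: s_def)
        have hc: "h \<in> carrier G" using h N_carrier j by (meson Suc_leI)
        have jm: "Suc j \<le> m" using j by simp
        have 1: "weight_le (Suc j) (d - 2 ^ i) (\<lambda>y. ldiff h F (s \<otimes> y \<otimes> inv s))"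
          using weight_le_mono[OF weight_le_conj[OF weight_le_ldiff[OF less.prems order_refl jm h(1)] s jm],
              of "d - 2 ^ i"] True by simp
        have 2: "weight_le (Suc j) (d - 2 ^ i) (\<lambda>y. F (s \<otimes> y \<otimes> inv s) - F y)"
        proof (cases "Suc j = m")
          case True
          then show ?thesis using N_m s by (intro weight_le_zero) auto
        next
          case False
          then show ?thesis
            using weight_le_mono[OF weight_le_conj_diff[OF less.prems s], of "d - 2 ^ i"] j True by simp
        qed
        show ?thesis
        proof (rule weight_le_cong[OF weight_le_add[OF 1 2]])
          fix y assume y: "y \<in> N (Suc j)"
          then have yc: "y \<in> carrier G" using N_carrier jm by blast
          have 3: "h \<otimes> (s \<otimes> y \<otimes> inv s) \<in> N (Suc j)"
            using mult_in_N[OF order_refl jm h(1) conj_in_N[OF jm s y]] .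
          have "g \<otimes> y = (h \<otimes> (s \<otimes> y \<otimes> inv s)) \<otimes> a (Suc j) [^] k"
            using h hc yc s a_carrier[OF j] by (simp add: s_def m_assoc)
          then have "nu j (g \<otimes> y) = h \<otimes> (s \<otimes> y \<otimes> inv s)"
            using resid_eq[OF step_facts[OF j] 3] by simp
          then show "ldiff h F (s \<otimes> y \<otimes> inv s) + (F (s \<otimes> y \<otimes> inv s) - F y) = F (nu j (g \<otimes> y)) - F y"
            by (simp add: ldiff_def)
        qed
      qed
      then have "weight_le j (d - 2 ^ i) (\<lambda>x. F (nu j (g \<otimes> nu j x)) - F (nu j x))"
        using False by (intro less.IH) auto
      then show ?thesis
      proof (rule weight_le_cong)
        fix x assume "x \<in> N j"
        then show "F (nu j (g \<otimes> nu j x)) - F (nu j x) = ldiff g (\<lambda>x. F (nu j x)) x"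
          using resid_mult_resid[OF step_facts[OF j]] gj N_step[OF j] by (simp add: ldiff_def)
      qed
    qed
    then show ?thesis using False by (simp add: weight_le_pos)
  qed
qed

text \<open>A difference of a homomorphism is constant, and a constant has weight 1. Directions cost
  at most 2^m, so 2^m + 1 leaves at least 1 after any difference.\<close>

lemma weight_le_hom:
  assumes j: "j \<le> m" and hom: "\<And>g h. g \<in> N j \<Longrightarrow> h \<in> N j \<Longrightarrow> F (g \<otimes> h) = F g + F h"
  shows "weight_le j (2 ^ m + 1) F"
proof -
  have "weight_le j (2 ^ m + 1 - 2 ^ i) (ldiff g F)" if i: "j \<le> i" "i \<le> m" "g \<in> N i" for i g
  proof -
    have gj: "g \<in> N j" using i N_antimono by blast
    have "weight_le j (1 - 2 ^ i) (ldiff h (\<lambda>x. F g))" for i h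
      by (rule weight_le_zero) (simp add: ldiff_def)
    then have "weight_le j 1 (\<lambda>x. F g)" by (simp add: weight_le_pos)
    moreover have "1 \<le> (2::nat) ^ m + 1 - 2 ^ i" using power_increasing[OF i(2), of "2::nat"] by linarith
    ultimately have "weight_le j (2 ^ m + 1 - 2 ^ i) (\<lambda>x. F g)" by (rule weight_le_mono)
    then show ?thesis by (rule weight_le_cong) (simp add: ldiff_def hom[OF gj])
  qed
  then show ?thesis by (simp add: weight_le_pos)
qed

section \<open>Coordinates and words\<close>

primrec resid_iter :: "nat \<Rightarrow> 'a \<Rightarrow> 'a" where
  "resid_iter 0 g = g"
| "resid_iter (Suc i) g = nu i (resid_iter i g)"

text \<open>The exponent of \<open>a i\<close>, read after the powers of \<open>a 1\<close> to
  \<open>a (i - 1)\<close> have been stripped from the right; coordinates are numbered from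
  1.\<close>

definition coord :: "nat \<Rightarrow> 'a \<Rightarrow> int" where
  "coord i g = kap (i - 1) (resid_iter (i - 1) g)"

lemma resid_iter_in: "i \<le> m \<Longrightarrow> g \<in> carrier G \<Longrightarrow> resid_iter i g \<in> N i"
  by (induction i) (auto simp: N_0 intro: nu_in)

lemma weight_le_resid_iter: "i \<le> m \<Longrightarrow> weight_le i d F \<Longrightarrow> weight_le 0 d (\<lambda>x. F (resid_iter i x))"
proof (induction i arbitrary: F)
  case (Suc i)
  then show ?case using Suc.IH[OF _ weight_le_extend[of i d F]] by simp
qed simp

lemma weight_le_coord:
  assumes "i \<in> {1..m}" shows "weight_le 0 (2 ^ m + 1) (\<lambda>x. of_int (coord i x))"
proof -
  obtain j where j: "i = Suc j" "j < m" using assms by (cases i) auto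
  have "weight_le j (2 ^ m + 1) (\<lambda>x. of_int (kap j x))"
    using j by (intro weight_le_hom) (auto simp: kap_mult)
  then show ?thesis using weight_le_resid_iter[of j] j by (simp add: coord_def)
qed

text \<open>Exponents are functions of a parameter \<open>p\<close>, so that a function on the group
  evaluated at the word becomes a function of \<open>p\<close>.\<close>

definition word :: "('a \<times> ('p \<Rightarrow> int)) list \<Rightarrow> 'p \<Rightarrow> 'a" where
  "word es p = foldr (\<lambda>(g, e) z. g [^] e p \<otimes> z) es \<one>"

lemma word_simps [simp]: "word [] p = \<one>" "word ((g, e) # es) p = g [^] e p \<otimes> word es p"
  by (simp_all add: word_def)

lemma word_closed: "fst ` set es \<subseteq> carrier G \<Longrightarrow> word es p \<in> carrier G"
  by (induction es) auto

lemma word_append: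
  "fst ` set es \<subseteq> carrier G \<Longrightarrow> fst ` set es' \<subseteq> carrier G \<Longrightarrow> word (es @ es') p = word es p \<otimes> word es' p"
  by (induction es) (auto simp: word_closed m_assoc)

text \<open>On \<open>N 0\<close>, the whole group, every difference lowers the weight by at least
  2^0 = 1, so d of them kill a function of weight d.\<close>

lemma weight_le_ldiff_funpow:
  assumes "weight_le 0 d F" "g \<in> carrier G"
  shows "weight_le 0 d ((ldiff g ^^ i) F)" "z \<in> carrier G \<Longrightarrow> (ldiff g ^^ d) F z = 0"
proof -
  have *: "weight_le 0 (d - i) ((ldiff g ^^ i) F)" for i
  proof (induction i)
    case (Suc i)
    then show ?case using weight_le_ldiff[OF Suc, of 0 g] assms N_0 by simp
  qed (use assms in simp)
  show "weight_le 0 d ((ldiff g ^^ i) F)" using weight_le_mono[OF *] by simp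
  show "z \<in> carrier G \<Longrightarrow> (ldiff g ^^ d) F z = 0" using *[of d] N_0 by (simp add: weight_le_0)
qed

text \<open>Newton's formula peels off the leftmost letter and leaves finitely many functions of
  bounded weight on the shorter word. \<open>Q\<close> stands for any class of functions of the
  parameters with the closure properties used here; it will be the polynomial functions.\<close>

lemma weight_le_word:
  fixes Q :: "('p \<Rightarrow> rat) \<Rightarrow> bool" and es :: "('a \<times> ('p \<Rightarrow> int)) list"
  assumes const: "\<And>c. Q (\<lambda>p. c)" and add: "\<And>f f'. Q f \<Longrightarrow> Q f' \<Longrightarrow> Q (\<lambda>p. f p + f' p)"
    and bin: "\<And>g e f i. (g, e) \<in> set es \<Longrightarrow> Q f \<Longrightarrow> Q (\<lambda>p. (of_int (e p) gchoose i) * f p)"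
    and es: "fst ` set es \<subseteq> carrier G"
    and "weight_le 0 d F"
  shows "Q (\<lambda>p. F (word es p))"
  using bin es assms(5)
proof (induction es arbitrary: F)
  case Nil
  then show ?case using const by simp
next
  case (Cons ge es)
  obtain g e where ge: "ge = (g, e)" by (cases ge)
  have g: "g \<in> carrier G" using Cons.prems ge by auto
  have "Q (\<lambda>p. (of_int (e p) gchoose i) * (ldiff g ^^ i) F (word es p))" for i
    using Cons.prems ge g
    by (intro Cons.prems(1)[of g e] Cons.IH weight_le_ldiff_funpow) auto
  then have "Q (\<lambda>p. \<Sum>i<n. (of_int (e p) gchoose i) * (ldiff g ^^ i) F (word es p))" for n
    by (induction n) (auto intro: const add)
  moreover have "F (word (ge # es) p) = (\<Sum>i<d. (of_int (e p) gchoose i) * (ldiff g ^^ i) F (word es p))" for p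
  proof -
    have "word es p \<in> carrier G" using Cons.prems(2) by (intro word_closed) auto
    from newton_expansion[OF g this weight_le_ldiff_funpow(2)[OF Cons.prems(3) g]] show ?thesis
      by (simp add: ge)
  qed
  ultimately show ?case by simp
qed

definition gens :: "nat \<Rightarrow> (nat \<Rightarrow> 'p \<Rightarrow> int) \<Rightarrow> ('a \<times> ('p \<Rightarrow> int)) list" where
  "gens i e = map (\<lambda>j. (a j, e j)) (rev [1..<Suc i])"

lemma gens_Suc: "gens (Suc i) e = (a (Suc i), e (Suc i)) # gens i e"
  by (simp add: gens_def)

lemma gens_carrier: "i \<le> m \<Longrightarrow> fst ` set (gens i e) \<subseteq> carrier G"
proof (induction i)
  case (Suc i)
  then show ?case using a_carrier[of i] by (simp add: gens_Suc)
qed (simp add: gens_def)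

abbreviation "element i x \<equiv> word (gens i (\<lambda>j x. x j)) x"

lemma element_closed: "i \<le> m \<Longrightarrow> element i x \<in> carrier G"
  by (rule word_closed[OF gens_carrier])

text \<open>The extra factor \<open>u\<close> in front lets the induction absorb the letter of
  largest index, since \<open>u \<otimes> a (Suc i) [^] x (Suc i)\<close> lies in
  \<open>N i\<close>.\<close>

lemma resid_iter_element:
  assumes "i \<le> m" "u \<in> N i"
  shows "resid_iter i (u \<otimes> element i x) = u \<and> (\<forall>j\<in>{1..i}. coord j (u \<otimes> element i x) = x j)"
  using assms
proof (induction i arbitrary: u)
  case 0
  then show ?case by (simp add: gens_def N_0)
next
  case (Suc i)
  have im: "i < m" using Suc.prems by simp
  have uc: "u \<in> carrier G" using Suc.prems N_carrier by blast
  let ?v = "u \<otimes> a (Suc i) [^] x (Suc i)"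
  have v: "?v \<in> N i" using N_step[OF im] Suc.prems by (auto simp: adjoin_def)
  have e: "u \<otimes> element (Suc i) x = ?v \<otimes> element i x"
    using uc a_carrier[OF im] element_closed[of i] im by (simp add: gens_Suc m_assoc)
  have IH: "resid_iter i (?v \<otimes> element i x) = ?v" "\<forall>j\<in>{1..i}. coord j (?v \<otimes> element i x) = x j"
    using Suc.IH[OF _ v] im by auto
  have "resid_iter (Suc i) (?v \<otimes> element i x) = u"
    using resid_eq[OF step_facts[OF im] Suc.prems(2)] by (simp add: IH)
  moreover have "coord (Suc i) (?v \<otimes> element i x) = x (Suc i)"
    using expo_eq[OF step_facts[OF im] Suc.prems(2)] by (simp add: coord_def IH)
  ultimately show ?case unfolding e using IH(2) le_Suc_eq by auto
qed

lemma coord_element: "j \<in> {1..m} \<Longrightarrow> coord j (element m x) = x j"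
  using resid_iter_element[of m \<one> x] N_m element_closed[of m x] by auto

lemma element_cong: "(\<And>j. j \<in> {1..i} \<Longrightarrow> x j = y j) \<Longrightarrow> element i x = element i y"
  by (induction i) (simp_all add: gens_Suc gens_def[of 0])

lemma element_coord:
  assumes g: "g \<in> carrier G" shows "element m (\<lambda>j. coord j g) = g"
proof -
  have "g = resid_iter i g \<otimes> element i (\<lambda>j. coord j g)" if "i \<le> m" for i
    using that
  proof (induction i)
    case 0
    then show ?case using g by (simp add: gens_def)
  next
    case (Suc i)
    then have im: "i < m" by simp
    let ?e = "element i (\<lambda>j. coord j g)"
    have r: "resid_iter i g \<in> N i" using resid_iter_in g im by simp
    have "resid_iter i g = nu i (resid_iter i g) \<otimes> a (Suc i) [^] coord (Suc i) g"
      using nu_kap[OF im r] by (simp add: coord_def)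
    then have "g = (nu i (resid_iter i g) \<otimes> a (Suc i) [^] coord (Suc i) g) \<otimes> ?e" using Suc im by simp
    then show ?case
      using nu_in[OF im r] N_carrier[of "Suc i"] a_carrier[OF im] element_closed[of i] im
      by (simp add: gens_Suc m_assoc)
  qed
  from this[of m] resid_iter_in[of m g] g N_m element_closed[of m "\<lambda>j. coord j g"] show ?thesis by simp
qed

end

section \<open>Cycles and cohomology classes\<close>

text \<open>The pairing of \<open>chain_pairing\<close> with values in an arbitrary commutative
  ring: complex logarithms will be paired with the same integral cycle as the cocycle.\<close>

definition ring_pairing :: "('c \<Rightarrow> 'r::comm_ring_1) \<Rightarrow> ('c \<Rightarrow>\<^sub>0 int) \<Rightarrow> 'r" where
  "ring_pairing s c = (\<Sum>p\<in>Poly_Mapping.keys c. of_int (Poly_Mapping.lookup c p) * s p)"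

lemma chain_pairing_eq: "chain_pairing = ring_pairing"
  by (simp add: fun_eq_iff chain_pairing_def ring_pairing_def)

lemma ring_pairing_superset:
  assumes "finite A" "Poly_Mapping.keys c \<subseteq> A"
  shows "ring_pairing s c = (\<Sum>p\<in>A. of_int (Poly_Mapping.lookup c p) * s p)"
  unfolding ring_pairing_def
  using assms by (intro sum.mono_neutral_left) (auto simp: in_keys_iff)

lemma ring_pairing_cmul: "ring_pairing s (frag_cmul k c) = of_int k * ring_pairing s c"
  using ring_pairing_superset[OF finite_keys keys_cmul, of s k c]
  by (simp add: ring_pairing_def sum_distrib_left mult.assoc)

lemma ring_pairing_simps [simp]:
  "ring_pairing s 0 = 0" "ring_pairing s (frag_of p) = s p"
  by (simp_all add: ring_pairing_def)

lemma ring_pairing_add: "ring_pairing s (c + d) = ring_pairing s c + ring_pairing s d"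
proof -
  have "Poly_Mapping.keys (c + d) \<subseteq> Poly_Mapping.keys c \<union> Poly_Mapping.keys d" by (rule keys_add)
  then show ?thesis
    using ring_pairing_superset[of "Poly_Mapping.keys c \<union> Poly_Mapping.keys d" _ s]
    by (simp add: lookup_add sum.distrib algebra_simps)
qed

lemma ring_pairing_minus: "ring_pairing s (- c) = - ring_pairing s c"
  using ring_pairing_cmul[of s "-1" c] by simp

lemma ring_pairing_diff: "ring_pairing s (c - d) = ring_pairing s c - ring_pairing s d"
  using ring_pairing_add[of s c "- d"] by (simp add: ring_pairing_minus)

lemma ring_pairing_cong:
  "(\<And>p. p \<in> Poly_Mapping.keys c \<Longrightarrow> s p = t p) \<Longrightarrow> ring_pairing s c = ring_pairing t c"
  by (simp add: ring_pairing_def)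

lemma ring_pairing_add_left: "ring_pairing (\<lambda>p. s p + t p) c = ring_pairing s c + ring_pairing t c"
  by (simp add: ring_pairing_def sum.distrib algebra_simps)

lemma of_int_ring_pairing:
  "of_int (ring_pairing s c) = (ring_pairing (\<lambda>p. of_int (s p)) c :: 'r::comm_ring_1)"
  by (simp add: ring_pairing_def)

lemma boundary2_simps [simp]:
  "boundary2 G 0 = 0"
  "boundary2 G (frag_of (g, h)) = frag_of h - frag_of (g \<otimes>\<^bsub>G\<^esub> h) + frag_of g"
  "boundary2 G (frag_cmul k c) = frag_cmul k (boundary2 G c)"
  "boundary2 G (c + d) = boundary2 G c + boundary2 G d"
  "boundary2 G (c - d) = boundary2 G c - boundary2 G d"
  by (simp_all add: boundary2_def frag_extend_add frag_extend_diff frag_extend_cmul)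

lemma ring_pairing_boundary2:
  "ring_pairing f (boundary2 G c) = ring_pairing (\<lambda>(g, h). f h - f (g \<otimes>\<^bsub>G\<^esub> h) + f g) c"
proof -
  have "Poly_Mapping.keys c \<subseteq> UNIV" by simp
  then show ?thesis
  proof (induction c rule: frag_induction)
    case (one x)
    show ?case by (cases x) (simp add: ring_pairing_add ring_pairing_diff)
  qed (simp_all add: ring_pairing_diff)
qed

lemma chain_pairing_boundary3:
  assumes s: "cocycle2 G s" and b: "Poly_Mapping.keys b \<subseteq> carrier G \<times> carrier G \<times> carrier G"
  shows "chain_pairing s (boundary3 G b) = 0"
  using b
proof (induction b rule: frag_induction)
  case (one x)
  then obtain g h k where x: "x = (g, h, k)" "g \<in> carrier G" "h \<in> carrier G" "k \<in> carrier G" by auto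
  then have "s (h, k) - s (g \<otimes>\<^bsub>G\<^esub> h, k) + s (g, h \<otimes>\<^bsub>G\<^esub> k) - s (g, h) = 0"
    using s unfolding cocycle2_def by blast
  then show ?case
    by (simp add: x(1) boundary3_def chain_pairing_eq ring_pairing_add ring_pairing_diff)
qed (simp_all add: boundary3_def frag_extend_diff chain_pairing_eq ring_pairing_diff)

lemma chain_pairing_coboundary1:
  assumes "Poly_Mapping.keys c \<subseteq> carrier G \<times> carrier G" "boundary2 G c = 0"
  shows "chain_pairing (coboundary1 G f) c = 0"
proof -
  have "ring_pairing (coboundary1 G f) c = ring_pairing (\<lambda>(g, h). f h - f (g \<otimes>\<^bsub>G\<^esub> h) + f g) c"
    using assms(1) by (intro ring_pairing_cong) (auto simp: coboundary1_def)
  also have "\<dots> = 0" using ring_pairing_boundary2[of f G c] assms(2) by simp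
  finally show ?thesis by (simp add: chain_pairing_eq)
qed

lemma cohomology_class_pairing:
  assumes c: "Poly_Mapping.keys c \<subseteq> carrier G \<times> carrier G" "boundary2 G c = 0"
    and t: "t \<in> cohomology_class G s"
  shows "chain_pairing t c = chain_pairing s c"
proof -
  obtain f where f: "t = (\<lambda>p\<in>carrier G \<times> carrier G. coboundary1 G f p + s p)"
    using t by (auto simp: cohomology_class_def r_coset_def coboundaries_def cocycle_group_def)
  have "ring_pairing t c = ring_pairing (\<lambda>p. coboundary1 G f p + s p) c"
    using c(1) by (intro ring_pairing_cong) (auto simp: f)
  also have "\<dots> = ring_pairing s c"
    using chain_pairing_coboundary1[OF c, of f] by (simp add: ring_pairing_add_left chain_pairing_eq)
  finally show ?thesis by (simp add: chain_pairing_eq)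
qed

lemma cohomology_class_cocycle:
  assumes "group G" "cocycle2 G s" "t \<in> cohomology_class G s"
  shows "cocycle2 G t"
proof -
  interpret group G by fact
  obtain f where f: "t = (\<lambda>p\<in>carrier G \<times> carrier G. coboundary1 G f p + s p)"
    using assms(3) by (auto simp: cohomology_class_def r_coset_def coboundaries_def cocycle_group_def)
  show ?thesis
    unfolding cocycle2_def
  proof (intro conjI ballI)
    fix g h k assume "g \<in> carrier G" "h \<in> carrier G" "k \<in> carrier G"
    moreover from this have "s (h, k) - s (g \<otimes>\<^bsub>G\<^esub> h, k) + s (g, h \<otimes>\<^bsub>G\<^esub> k) - s (g, h) = 0"
      using assms(2) unfolding cocycle2_def by blast
    ultimately show "t (h, k) - t (g \<otimes>\<^bsub>G\<^esub> h, k) + t (g, h \<otimes>\<^bsub>G\<^esub> k) - t (g, h) = 0"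
      by (simp add: f coboundary1_def m_assoc)
  qed (simp add: f)
qed

lemma cohomology_class_self:
  assumes "cocycle2 G s" shows "s \<in> cohomology_class G s"
proof -
  have "s = (\<lambda>p\<in>carrier G \<times> carrier G. coboundary1 G (\<lambda>_. 0) p + s p)"
    using assms by (fastforce simp: cocycle2_def coboundary1_def fun_eq_iff PiE_def extensional_def)
  then show ?thesis
    unfolding cohomology_class_def r_coset_def coboundaries_def cocycle_group_def by auto
qed

text \<open>The pairing kills coboundaries and boundaries, so the set passed to
  \<open>the_elem\<close> is a singleton and the image of the class takes the nonzero value at the
  class of \<open>c\<close>.\<close>

lemma not_in_kronecker_kernel:
  assumes G: "group G" and s: "cocycle2 G s"
    and c: "Poly_Mapping.keys c \<subseteq> carrier G \<times> carrier G" "boundary2 G c = 0"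
    and ne: "chain_pairing s c \<noteq> 0"
  shows "cohomology_class G s \<notin> kronecker_kernel G"
proof
  define Z where "Z = boundaries G #>\<^bsub>cycle_group G\<^esub> c"
  assume "cohomology_class G s \<in> kronecker_kernel G"
  then have k: "kronecker_map G (cohomology_class G s) = (\<lambda>x\<in>carrier (homology2 G). 0)"
    by (simp add: kronecker_kernel_def kernel_def hom_group_def)
  have "c \<in> carrier (cycle_group G)"
    using c by (simp add: cycle_group_def kernel_def)
  then have Z: "Z \<in> carrier (homology2 G)"
    by (auto simp: homology2_def FactGroup_def RCOSETS_def Z_def)
  have val: "chain_pairing t z = chain_pairing s c" if tz: "t \<in> cohomology_class G s" "z \<in> Z" for t z
  proof -
    obtain b where b: "z = boundary3 G b + c" "Poly_Mapping.keys b \<subseteq> carrier G \<times> carrier G \<times> carrier G"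
      using tz(2) by (auto simp: Z_def r_coset_def boundaries_def cycle_group_def)
    have "chain_pairing t z = chain_pairing t c"
      using chain_pairing_boundary3[OF cohomology_class_cocycle[OF G s tz(1)] b(2)]
      by (simp add: b(1) chain_pairing_eq ring_pairing_add)
    then show ?thesis using cohomology_class_pairing[OF c tz(1)] by simp
  qed
  have "c \<in> Z"
    unfolding Z_def r_coset_def boundaries_def cycle_group_def
    by (auto intro!: bexI[of _ 0] simp: boundary3_def)
  then have "(\<lambda>(s, c). chain_pairing s c) ` (cohomology_class G s \<times> Z) = {chain_pairing s c}"
  proof -
    have "(\<lambda>(t, z). chain_pairing t z) ` (cohomology_class G s \<times> Z) =
        (\<lambda>_. chain_pairing s c) ` (cohomology_class G s \<times> Z)"
      by (intro image_cong refl) (use val in \<open>simp add: split_beta mem_Times_iff\<close>)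
    moreover have "cohomology_class G s \<times> Z \<noteq> {}" using \<open>c \<in> Z\<close> cohomology_class_self[OF s] by blast
    ultimately show ?thesis by (simp only: image_constant_conv if_False)
  qed
  then have "kronecker_map G (cohomology_class G s) Z = chain_pairing s c"
    using Z by (simp add: kronecker_map_def)
  then show False using k Z ne by simp
qed

text \<open>Every representative of the k-th power pairs with \<open>c\<close> to k times the
  original value, while the unit class contains the zero cochain. Unfolding the power directly
  avoids the group axioms for \<open>cohomology2 G\<close>.\<close>

lemma not_torsion_cohomology_class:
  assumes c: "Poly_Mapping.keys c \<subseteq> carrier G \<times> carrier G" "boundary2 G c = 0"
    and ne: "chain_pairing s c \<noteq> 0"
  shows "\<not> torsion_element (cohomology2 G) (cohomology_class G s)"
proof
  let ?C = "cohomology_class G s"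
  assume "torsion_element (cohomology2 G) ?C"
  then obtain n :: nat where n: "n > 0" "?C [^]\<^bsub>cohomology2 G\<^esub> n = \<one>\<^bsub>cohomology2 G\<^esub>"
    by (auto simp: torsion_element_def)
  have *: "chain_pairing t c = int k * chain_pairing s c" if "t \<in> ?C [^]\<^bsub>cohomology2 G\<^esub> k" for t and k :: nat
    using that
  proof (induction k arbitrary: t)
    case 0
    then show ?case
      using chain_pairing_coboundary1[OF c]
      by (auto simp: nat_pow_def cohomology2_def FactGroup_def coboundaries_def)
  next
    case (Suc k)
    have "?C [^]\<^bsub>cohomology2 G\<^esub> Suc k = (?C [^]\<^bsub>cohomology2 G\<^esub> k) <#>\<^bsub>cocycle_group G\<^esub> ?C"
      by (simp add: nat_pow_def cohomology2_def FactGroup_def)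
    then obtain u v where uv: "u \<in> ?C [^]\<^bsub>cohomology2 G\<^esub> k" "v \<in> ?C"
      "t = (\<lambda>p\<in>carrier G \<times> carrier G. u p + v p)"
      using Suc.prems by (auto simp: set_mult_def cocycle_group_def)
    have "ring_pairing t c = ring_pairing (\<lambda>p. u p + v p) c"
      using c(1) by (intro ring_pairing_cong) (auto simp: uv)
    then show ?case
      using Suc.IH[OF uv(1)] cohomology_class_pairing[OF c uv(2)]
      by (simp add: chain_pairing_eq ring_pairing_add_left algebra_simps)
  qed
  have "coboundary1 G (\<lambda>_. 0) \<in> \<one>\<^bsub>cohomology2 G\<^esub>"
    by (simp add: cohomology2_def FactGroup_def coboundaries_def)
  then show False
    using *[of "coboundary1 G (\<lambda>_. 0)" n] n ne chain_pairing_coboundary1[OF c] by simp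
qed

context group begin

section \<open>A homomorphism on N_1 and an almost invariant element\<close>

lemma central_chain_normal: "central_chain I B xs \<Longrightarrow> I \<lhd> G \<Longrightarrow> B \<lhd> G"
  by (induction rule: central_chain.induct) (auto intro: adjoin_normal)

text \<open>\<open>n\<close> is the generator of the lowest step of the chain, which makes it
  central modulo \<open>I\<close> itself, and \<open>\<phi>\<close> is its exponent. Along each
  further generator \<open>\<phi>\<close> is extended through \<open>resid\<close>; it stays
  additive because commutators of elements of \<open>B\<close> lie in \<open>I\<close>, where
  \<open>\<phi>\<close> vanishes.\<close>

lemma central_chain_hom:
  assumes "central_chain I B xs" "I \<lhd> G" "B \<noteq> I"
    "\<And>x y. x \<in> B \<Longrightarrow> y \<in> B \<Longrightarrow> commutator G x y \<in> I"
  shows "\<exists>n (\<phi>::'a \<Rightarrow> int). n \<in> B \<and> n \<in> central_mod I \<and> \<phi> n = 1 \<and> (\<forall>u\<in>I. \<phi> u = 0) \<and>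
    (\<forall>u\<in>B. \<forall>v\<in>B. \<phi> (u \<otimes> v) = \<phi> u + \<phi> v)"
  using assms
proof (induction rule: central_chain.induct)
  case (step B xs x)
  have B: "B \<lhd> G" using central_chain_normal step by blast
  have x: "x \<in> carrier G" using step.hyps(2) by (simp add: central_mod_def)
  note facts = B x step.hyps(3)
  have BA: "B \<subseteq> adjoin B x" by (rule subset_adjoin[OF normal_imp_subgroup[OF B]])
  have xA: "x \<in> adjoin B x" by (rule mem_adjoin[OF normal_imp_subgroup[OF B] x])
  show ?case
  proof (cases "B = I")
    case True
    have "expo B x x = 1" using expo_gen[OF facts, of 1] x by simp
    then show ?thesis
      using True xA step.hyps(2) expo_base[OF facts] expo_mult[OF facts]
      by (intro exI[of _ x] exI[of _ "expo B x"]) simp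
  next
    case False
    have cB: "commutator G x y \<in> I" if "x \<in> B" "y \<in> B" for x y
      using step.prems(3)[OF subsetD[OF BA that(1)] subsetD[OF BA that(2)]] .
    obtain n and \<phi> :: "'a \<Rightarrow> int" where n: "n \<in> B" "n \<in> central_mod I" "\<phi> n = 1" "\<forall>u\<in>I. \<phi> u = 0"
      "\<forall>u\<in>B. \<forall>v\<in>B. \<phi> (u \<otimes> v) = \<phi> u + \<phi> v"
      using step.IH[OF step.prems(1) False cB] by blast
    have IB: "I \<subseteq> B" using step.hyps(1)
    proof (induction rule: central_chain.induct)
      case (step B xs x)
      then show ?case
        using subset_adjoin[OF normal_imp_subgroup[OF central_chain_normal[OF step.hyps(1) \<open>I \<lhd> G\<close>]]] by blast
    qed simp
    have "\<phi> (resid B x (g \<otimes> h)) = \<phi> (resid B x g) + \<phi> (resid B x h)"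
      if gh: "g \<in> adjoin B x" "h \<in> adjoin B x" for g h
    proof -
      obtain u k v l where uv: "u \<in> B" "g = u \<otimes> x [^] (k::int)" "u \<in> carrier G"
        "v \<in> B" "h = v \<otimes> x [^] (l::int)" "v \<in> carrier G"
        using gh adjoin_cases[OF facts] by metis
      have c: "commutator G (x [^] k) v \<in> I"
        using step.prems(3)[OF subgroup_int_pow_closed[OF adjoin_subgroup[OF B x] xA] subsetD[OF BA uv(4)]] .
      have cv: "commutator G (x [^] k) v \<otimes> v \<in> B"
        using subgroup.m_closed[OF normal_imp_subgroup[OF B] subsetD[OF IB c] uv(4)] .
      have "g \<otimes> h = (u \<otimes> (commutator G (x [^] k) v \<otimes> v)) \<otimes> x [^] (k + l)"
        using uv x by (simp add: int_pow_mult m_assoc commutator_def)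
      then have "resid B x (g \<otimes> h) = u \<otimes> (commutator G (x [^] k) v \<otimes> v)"
        using resid_eq[OF facts] cv uv subgroup.m_closed[OF normal_imp_subgroup[OF B]] by simp
      then show ?thesis using n uv c cv IB resid_eq[OF facts] by auto
    qed
    moreover have "resid B x u = u" if "u \<in> B" for u using resid_base[OF facts that] .
    ultimately show ?thesis using n BA IB
      by (intro exI[of _ n] exI[of _ "\<lambda>g. \<phi> (resid B x g)"]) auto
  qed
qed simp

end

context central_sequence begin

lemma kap_nat_pow: "i < m \<Longrightarrow> g \<in> N i \<Longrightarrow> kap i (g [^] (k::nat)) = int k * kap i g"
proof (induction k)
  case 0
  then show ?case
    using expo_base[OF step_facts, of i \<one>] subgroup.one_closed[OF N_subgroup[of "Suc i"]] by simp
next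
  case (Suc k)
  have "g [^] k \<in> N i"
    using Suc.prems subgroup_int_pow_closed[OF N_subgroup, of i g "int k"] by (simp add: int_pow_int)
  then show ?case using Suc by (simp add: kap_mult algebra_simps)
qed

lemma kap_a: "i < m \<Longrightarrow> kap i (a (Suc i)) = 1"
  using expo_gen[OF step_facts, of i 1] a_carrier by simp

lemma N_1_isolated:
  assumes "0 < m" "g \<in> carrier G" "0 < (k::nat)" "g [^] k \<in> N 1" shows "g \<in> N 1"
proof -
  have "int k * kap 0 g = 0"
    using kap_nat_pow[of 0 g k] expo_base[OF step_facts, of 0] assms N_0 by simp
  then have "g = nu 0 g" using nu_kap[of 0 g] nu_in[of 0 g] N_carrier[of 1] assms N_0 by simp
  then show ?thesis using nu_in[of 0 g] assms N_0 by simp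
qed

text \<open>The isolator of the derived subgroup in \<open>N 1\<close>; the quotient of
  \<open>N 1\<close> by it is the abelianization modulo torsion.\<close>

definition derived_root :: "'a set" where
  "derived_root = {x \<in> N 1. \<exists>k::nat. 0 < k \<and> x [^] k \<in> derived G (N 1)}"

text \<open>Closure under products holds because \<open>N 1\<close> becomes abelian modulo its
  derived subgroup. Isolation holds in all of \<open>G\<close>, as \<open>N 1\<close> is itself
  isolated.\<close>

lemma derived_root_facts:
  assumes m: "0 < m"
  shows "derived_root \<lhd> G" "isolated derived_root" "derived G (N 1) \<subseteq> derived_root"
proof -
  define D where "D = derived G (N 1)"
  have N1: "N 1 \<lhd> G" "subgroup (N 1) G" using N_normal N_subgroup m by simp_all
  have D: "D \<lhd> G" unfolding D_def by (rule derived_is_normal[OF N1(1)])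
  have DN: "D \<subseteq> N 1" unfolding D_def by (rule derived_incl[OF order_refl N1(2)])
  have Dsg: "subgroup D G" by (rule normal_imp_subgroup[OF D])
  have comm: "commutator G x y \<in> D" if "x \<in> N 1" "y \<in> N 1" for x y
    unfolding D_def derived_def commutator_def using that by (intro generate.incl) auto
  have mem: "x \<in> derived_root \<longleftrightarrow> x \<in> N 1 \<and> (\<exists>k::nat. 0 < k \<and> x [^] k \<in> D)" for x
    by (simp add: derived_root_def D_def)
  interpret hm: group_hom G "G Mod D" "\<lambda>x. D #> x" by (rule normal_group_hom[OF D])
  have root: "x \<in> derived_root \<longleftrightarrow> x \<in> N 1 \<and> (\<exists>k::nat. 0 < k \<and> (D #> x) [^]\<^bsub>G Mod D\<^esub> k = \<one>\<^bsub>G Mod D\<^esub>)" for x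
  proof -
    have "x [^] k \<in> D \<longleftrightarrow> (D #> x) [^]\<^bsub>G Mod D\<^esub> k = \<one>\<^bsub>G Mod D\<^esub>" if "x \<in> N 1" for k :: nat
    proof -
      have "x \<in> carrier G" using that subgroup.mem_carrier[OF N1(2)] by blast
      then show ?thesis using coset_eq_one_iff[OF D, of "x [^] k"] hm.hom_nat_pow[of x k] by simp
    qed
    then show ?thesis unfolding mem by blast
  qed
  have sub: "derived_root \<subseteq> N 1" by (auto simp: derived_root_def)
  have sg: "subgroup derived_root G"
  proof
    show "derived_root \<subseteq> carrier G" using sub subgroup.subset[OF N1(2)] by blast
    show "\<one> \<in> derived_root"
      using subgroup.one_closed[OF N1(2)] subgroup.one_closed[OF Dsg]
      unfolding mem by (intro conjI exI[of _ 1]) simp_all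
    fix x assume x: "x \<in> derived_root"
    then obtain k :: nat where k: "0 < k" "x [^] k \<in> D" "x \<in> N 1" by (auto simp: mem)
    have xc: "x \<in> carrier G" using k subgroup.mem_carrier[OF N1(2)] by blast
    have "inv x [^] k = inv (x [^] k)" using xc by (simp add: nat_pow_inv)
    then have "inv x [^] k \<in> D" using subgroup.m_inv_closed[OF Dsg k(2)] by simp
    then show "inv x \<in> derived_root"
      using k subgroup.m_inv_closed[OF N1(2) k(3)] by (auto simp: mem)
    fix y assume y: "y \<in> derived_root"
    then obtain l :: nat where l: "0 < l" "(D #> y) [^]\<^bsub>G Mod D\<^esub> l = \<one>\<^bsub>G Mod D\<^esub>" "y \<in> N 1" using root by blast
    have yc: "y \<in> carrier G" using l subgroup.mem_carrier[OF N1(2)] by blast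
    have kx: "(D #> x) [^]\<^bsub>G Mod D\<^esub> k = \<one>\<^bsub>G Mod D\<^esub>"
      using coset_eq_one_iff[OF D, of "x [^] k"] hm.hom_nat_pow[of x k] xc k by simp
    have cl: "D #> x \<in> carrier (G Mod D)" "D #> y \<in> carrier (G Mod D)" using hm.hom_closed xc yc by blast+
    have c: "(D #> x) \<otimes>\<^bsub>G Mod D\<^esub> (D #> y) = (D #> y) \<otimes>\<^bsub>G Mod D\<^esub> (D #> x)"
      using commute_mod_iff[OF D xc yc] comm[OF k(3) l(3)] by blast
    have "((D #> x) \<otimes>\<^bsub>G Mod D\<^esub> (D #> y)) [^]\<^bsub>G Mod D\<^esub> (k * l) =
        ((D #> x) [^]\<^bsub>G Mod D\<^esub> k) [^]\<^bsub>G Mod D\<^esub> l \<otimes>\<^bsub>G Mod D\<^esub> ((D #> y) [^]\<^bsub>G Mod D\<^esub> l) [^]\<^bsub>G Mod D\<^esub> k"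
      unfolding hm.H.pow_mult_distrib[OF c cl] hm.H.nat_pow_pow[OF cl(1)] hm.H.nat_pow_pow[OF cl(2)]
      by (simp only: mult.commute)
    also have "\<dots> = \<one>\<^bsub>G Mod D\<^esub>" unfolding kx l(2) hm.H.nat_pow_one by (rule hm.H.l_one[OF hm.H.one_closed])
    finally have "(D #> (x \<otimes> y)) [^]\<^bsub>G Mod D\<^esub> (k * l) = \<one>\<^bsub>G Mod D\<^esub>" unfolding hm.hom_mult[OF xc yc] .
    then show "x \<otimes> y \<in> derived_root"
      unfolding root using k(1,3) l(1,3) subgroup.m_closed[OF N1(2)]
      by (intro conjI exI[of _ "k * l"]) simp_all
  qed
  show "derived_root \<lhd> G"
  proof (rule normal_invI[OF sg])
    fix g x assume g: "g \<in> carrier G" and x: "x \<in> derived_root"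
    then obtain k :: nat where k: "0 < k" "x [^] k \<in> D" "x \<in> N 1" by (auto simp: mem)
    have "x \<in> carrier G" using k subgroup.mem_carrier[OF N1(2)] by blast
    then have "(g \<otimes> x \<otimes> inv g) [^] k \<in> D"
      using conj_nat_pow[OF g] normal_conj(1)[OF D g k(2)] by simp
    then show "g \<otimes> x \<otimes> inv g \<in> derived_root"
      using k(1) normal_conj(1)[OF N1(1) g k(3)] by (auto simp: mem)
  qed
  show "isolated derived_root"
    unfolding isolated_def
  proof (intro ballI allI impI)
    fix x and k :: nat assume x: "x \<in> carrier G" "0 < k" "x [^] k \<in> derived_root"
    then obtain l :: nat where l: "0 < l" "(x [^] k) [^] l \<in> D" "x [^] k \<in> N 1"
      by (auto simp: mem)
    then have "x [^] (k * l) \<in> D" using x by (simp add: nat_pow_pow)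
    then show "x \<in> derived_root"
      using N_1_isolated[OF m x(1,2) l(3)] x(2) l(1) nat_0_less_mult_iff
      unfolding mem by blast
  qed
  show "derived G (N 1) \<subseteq> derived_root"
  proof
    fix x assume "x \<in> derived G (N 1)"
    then have x: "x \<in> D" by (simp add: D_def)
    then have "x [^] (1::nat) \<in> D" using subgroup.mem_carrier[OF Dsg x] by simp
    then show "x \<in> derived_root" unfolding mem using x DN by (intro conjI exI[of _ 1]) auto
  qed
qed

text \<open>The abelianization of \<open>N 1\<close> is infinite: the exponent \<open>kap 1\<close>
  is additive, kills commutators and takes the value 1 at \<open>a 2\<close>.\<close>

lemma derived_root_neq: assumes m: "1 < m" shows "derived_root \<noteq> N 1"
proof
  assume eq: "derived_root = N 1"
  have a: "a 2 \<in> N 1" using a_in_N[of 1] m by (simp add: numeral_2_eq_2)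
  then obtain k :: nat where k: "0 < k" "a 2 [^] k \<in> derived G (N 1)"
    using eq by (auto simp: derived_root_def)
  have N1: "subgroup (N 1) G" using N_subgroup m by simp
  have "subgroup {x \<in> N 1. kap 1 x = 0} G"
  proof
    show "{x \<in> N 1. kap 1 x = 0} \<subseteq> carrier G" using subgroup.subset[OF N1] by blast
    have one: "kap 1 \<one> = 0" using kap_mult[of 1 \<one> \<one>] subgroup.one_closed[OF N1] m by simp
    then show "\<one> \<in> {x \<in> N 1. kap 1 x = 0}" using subgroup.one_closed[OF N1] by simp
    fix x assume x: "x \<in> {x \<in> N 1. kap 1 x = 0}"
    then have xc: "x \<in> carrier G" using subgroup.mem_carrier[OF N1] by blast
    show "inv x \<in> {x \<in> N 1. kap 1 x = 0}"
      using kap_mult[of 1 x "inv x"] x xc one m subgroup.m_inv_closed[OF N1] by simp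
    fix y assume y: "y \<in> {x \<in> N 1. kap 1 x = 0}"
    show "x \<otimes> y \<in> {x \<in> N 1. kap 1 x = 0}"
      using kap_mult[of 1 x y] x y m subgroup.m_closed[OF N1] by simp
  qed
  moreover have "derived_set G (N 1) \<subseteq> {x \<in> N 1. kap 1 x = 0}"
  proof
    fix z assume "z \<in> derived_set G (N 1)"
    then obtain x y where xy: "x \<in> N 1" "y \<in> N 1" "z = commutator G x y" by (auto simp: commutator_def)
    have zN: "z \<in> N 1" using xy N_commutator[of 1] N_Suc_subset[of 1] m N_carrier[of 1 x] by auto
    have "z \<otimes> (y \<otimes> x) = x \<otimes> y"
      using xy N_carrier[of 1 x] N_carrier[of 1 y] m by (simp add: commutator_def m_assoc)
    then have "kap 1 z = 0"
      using kap_mult[of 1 x y] kap_mult[of 1 y x] kap_mult[of 1 z "y \<otimes> x"] xy zN m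
        subgroup.m_closed[OF N1] by simp
    then show "z \<in> {x \<in> N 1. kap 1 x = 0}" using zN by simp
  qed
  ultimately have "derived G (N 1) \<subseteq> {x \<in> N 1. kap 1 x = 0}"
    unfolding derived_def by (rule generate_subgroup_incl[rotated])
  then have "kap 1 (a 2 [^] k) = 0" using k by blast
  then show False using kap_nat_pow[of 1 "a 2" k] kap_a[of 1] a m k by (simp add: numeral_2_eq_2)
qed

text \<open>Apply \<open>central_chain_hom\<close> between \<open>derived_root\<close> and
  \<open>N 1\<close>. Centrality of \<open>n\<close> modulo \<open>derived_root\<close> says that
  some power of [a 1, n] lies in the derived subgroup of \<open>N 1\<close>, with no invariance
  asked of \<open>\<phi>\<close>.\<close>

lemma exists_hom:
  assumes "1 < m" "noetherian (carrier G)" "lower_central_series G c = {\<one>}"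
  obtains n k and \<phi> :: "'a \<Rightarrow> int" where "n \<in> N 1" "\<phi> n = 1" "0 < (k::nat)"
    "commutator G (a 1) n [^] k \<in> derived G (N 1)"
    "\<And>u v. u \<in> N 1 \<Longrightarrow> v \<in> N 1 \<Longrightarrow> \<phi> (u \<otimes> v) = \<phi> u + \<phi> v"
proof -
  have m: "0 < m" using assms by simp
  have iso: "isolated (N 1)" using N_1_isolated[OF m] by (simp add: isolated_def)
  have sub: "derived_root \<subseteq> N 1" by (auto simp: derived_root_def)
  obtain xs where xs: "central_chain derived_root (N 1) xs"
    using central_chain_exists[OF assms(2,3) derived_root_facts(1,2)[OF m] N_normal iso sub] m by auto
  have comm: "commutator G x y \<in> derived_root" if "x \<in> N 1" "y \<in> N 1" for x y
  proof -
    have "commutator G x y \<in> derived G (N 1)"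
      unfolding derived_def commutator_def using that by (intro generate.incl) auto
    then show ?thesis using derived_root_facts(3)[OF m] by blast
  qed
  obtain n and \<phi> :: "'a \<Rightarrow> int" where n: "n \<in> N 1" "n \<in> central_mod derived_root" "\<phi> n = 1"
    "\<forall>u\<in>N 1. \<forall>v\<in>N 1. \<phi> (u \<otimes> v) = \<phi> u + \<phi> v"
    using central_chain_hom[OF xs derived_root_facts(1)[OF m] _ comm] derived_root_neq[OF assms(1)] by metis
  have "commutator G (a 1) n \<in> derived_root" using n(2) a_carrier[OF m] by (simp add: central_mod_def)
  then show ?thesis using that n by (auto simp: derived_root_def)
qed

end

text \<open>With \<open>w = [t, n]\<close> the relation \<open>t n = w n t\<close> gives the chain \<open>(t, n) - (w n, t) - (w, n)\<close> of boundary \<open>-w\<close>.\<close>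
lemma (in group) exists_cycle:
  assumes K: "subgroup K G" and t: "t \<in> carrier G" and n: "n \<in> K" and w: "commutator G t n \<in> K"
    and k: "commutator G t n [^] (k::nat) \<in> derived G K"
    and s: "\<And>x y. x \<in> K \<Longrightarrow> y \<in> carrier G \<Longrightarrow> s (x, y) = 0"
  shows "\<exists>c. Poly_Mapping.keys c \<subseteq> carrier G \<times> carrier G \<and> boundary2 G c = 0 \<and>
    chain_pairing s c = int k * s (t, n)"
proof -
  interpret K: subgroup K G by fact
  \<comment> \<open>\<open>Z\<close> consists of the 1-chains that bound inside \<open>K\<close>.
    Modulo \<open>Z\<close> the map x -> \<open>frag_of x\<close> is a homomorphism from
    \<open>K\<close> to an abelian group, so it kills the derived subgroup.\<close>
  define Z where "Z = {e. \<exists>b. Poly_Mapping.keys b \<subseteq> K \<times> K \<and> boundary2 G b = e}"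
  have Z0: "0 \<in> Z" by (auto simp: Z_def intro!: exI[of _ 0])
  have Zadd: "x + y \<in> Z" if xy: "x \<in> Z" "y \<in> Z" for x y
  proof -
    obtain b c where "Poly_Mapping.keys b \<subseteq> K \<times> K" "boundary2 G b = x"
      "Poly_Mapping.keys c \<subseteq> K \<times> K" "boundary2 G c = y" using xy by (auto simp: Z_def)
    then show ?thesis unfolding Z_def using keys_add[of b c]
      by (intro CollectI exI[of _ "b + c"]) auto
  qed
  have Zdiff: "x - y \<in> Z" if xy: "x \<in> Z" "y \<in> Z" for x y
  proof -
    obtain b c where "Poly_Mapping.keys b \<subseteq> K \<times> K" "boundary2 G b = x"
      "Poly_Mapping.keys c \<subseteq> K \<times> K" "boundary2 G c = y" using xy by (auto simp: Z_def)
    then show ?thesis unfolding Z_def using keys_diff[of b c]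
      by (intro CollectI exI[of _ "b - c"]) auto
  qed
  have Zmul: "frag_of y - frag_of (x \<otimes> y) + frag_of x \<in> Z" if "x \<in> K" "y \<in> K" for x y
    unfolding Z_def using that by (intro CollectI exI[of _ "frag_of (x, y)"]) auto
  have Z1: "frag_of \<one> \<in> Z" using Zmul[of \<one> \<one>] by simp
  have Zprod: "frag_of (x \<otimes> y) \<in> Z \<longleftrightarrow> frag_of x + frag_of y \<in> Z" if "x \<in> K" "y \<in> K" for x y
    using Zadd[OF Zmul[OF that], of "frag_of (x \<otimes> y)"] Zdiff[OF _ Zmul[OF that], of "frag_of x + frag_of y"]
    by (auto simp: algebra_simps)
  have Zpow: "frag_cmul (int j) (frag_of x) - frag_of (x [^] j) \<in> Z" if x: "x \<in> K" for x and j :: nat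
  proof (induction j)
    case 0
    then show ?case using Zdiff[OF Z0 Z1] by simp
  next
    case (Suc j)
    have "x [^] j \<in> K" using subgroup_int_pow_closed[OF K x, of "int j"] by (simp add: int_pow_int)
    from Zadd[OF Suc Zmul[OF this x]] show ?case
      by (simp add: frag_cmul_distrib algebra_simps)
  qed
  have com: "frag_of (commutator G x y) \<in> Z" if xy: "x \<in> K" "y \<in> K" for x y
  proof -
    have 1: "frag_of (inv z) + frag_of z \<in> Z" if "z \<in> K" for z
      using Zprod[of "inv z" z] Z1 that by simp
    have e: "commutator G x y \<otimes> (y \<otimes> x) = x \<otimes> y"
      using xy by (simp add: commutator_def m_assoc)
    have cK: "commutator G x y \<in> K" using xy by (simp add: commutator_def)
    have "frag_of (y \<otimes> x) - frag_of (x \<otimes> y) + frag_of (commutator G x y) \<in> Z"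
      using Zmul[OF cK, of "y \<otimes> x"] xy e by simp
    from Zadd[OF Zdiff[OF this Zmul[OF xy]] Zmul[OF xy(2,1)]]
    have "frag_of (commutator G x y) \<in> Z" by (simp add: algebra_simps)
    then show ?thesis .
  qed
  have "subgroup {x \<in> K. frag_of x \<in> Z} G"
  proof
    fix x assume x: "x \<in> {x \<in> K. frag_of x \<in> Z}"
    then have "frag_of (inv x) + frag_of x \<in> Z" using Zprod[of "inv x" x] Z1 by simp
    from Zdiff[OF this, of "frag_of x"] x show "inv x \<in> {x \<in> K. frag_of x \<in> Z}" by simp
    fix y assume y: "y \<in> {x \<in> K. frag_of x \<in> Z}"
    show "x \<otimes> y \<in> {x \<in> K. frag_of x \<in> Z}" using x y Zprod[of x y] Zadd by simp
  qed (use Z1 K.subset in auto)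
  moreover have "derived_set G K \<subseteq> {x \<in> K. frag_of x \<in> Z}"
    using com by (auto simp: commutator_def)
  ultimately have "derived G K \<subseteq> {x \<in> K. frag_of x \<in> Z}"
    unfolding derived_def by (rule generate_subgroup_incl[rotated])
  then have wk: "frag_of (commutator G t n [^] k) \<in> Z" using k by blast
  let ?w = "commutator G t n"
  from Zadd[OF Zpow[OF w, of k] wk] obtain b where b: "Poly_Mapping.keys b \<subseteq> K \<times> K"
    "boundary2 G b = frag_cmul (int k) (frag_of ?w)" by (auto simp: Z_def)
  \<comment> \<open>\<open>b\<close> fills k times w inside \<open>K\<close> and cancels the
    boundary of the k copies. As \<open>s\<close> vanishes when its first argument is in
    \<open>K\<close>, only the k copies of \<open>(t, n)\<close> contribute to the pairing.\<close>
  define c where "c = frag_cmul (int k) (frag_of (t, n) - frag_of (?w \<otimes> n, t) - frag_of (?w, n)) + b"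
  have wn: "?w \<otimes> n \<in> K" using w n by simp
  have nc: "n \<in> carrier G" "?w \<in> carrier G" using n w by simp_all
  have "(?w \<otimes> n) \<otimes> t = t \<otimes> n" using t nc by (simp add: commutator_def m_assoc)
  then have "boundary2 G c = 0"
    unfolding c_def boundary2_simps b(2) by (simp flip: frag_cmul_distrib2)
  moreover have "Poly_Mapping.keys c \<subseteq> carrier G \<times> carrier G"
  proof -
    define e where "e = frag_of (t, n) - frag_of (?w \<otimes> n, t) - frag_of (?w, n)"
    have "Poly_Mapping.keys e \<subseteq> {(t, n), (?w \<otimes> n, t), (?w, n)}"
      unfolding e_def
      using keys_diff[of "frag_of (t, n) - frag_of (?w \<otimes> n, t)" "frag_of (?w, n)"]
        keys_diff[of "frag_of (t, n)" "frag_of (?w \<otimes> n, t)"] by auto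
    then have "Poly_Mapping.keys e \<subseteq> carrier G \<times> carrier G" using t nc by blast
    moreover have "K \<times> K \<subseteq> carrier G \<times> carrier G" using K.subset by blast
    moreover have "Poly_Mapping.keys c \<subseteq> Poly_Mapping.keys e \<union> Poly_Mapping.keys b"
      unfolding c_def using keys_add[of "frag_cmul (int k) e" b] keys_cmul[of "int k" e]
      unfolding e_def by blast
    ultimately show ?thesis using b(1) by blast
  qed
  moreover have "chain_pairing s b = 0"
    unfolding chain_pairing_def
  proof (rule sum.neutral, rule ballI)
    fix p assume "p \<in> Poly_Mapping.keys b"
    then have "p \<in> K \<times> K" using b(1) by blast
    then show "Poly_Mapping.lookup b p * s p = 0" using s by auto
  qed
  then have "chain_pairing s c = int k * s (t, n)"
    unfolding c_def using s[OF wn t] s[OF w nc(1)] by (simp add: chain_pairing_eq ring_pairing_add ring_pairing_diff ring_pairing_cmul)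
  ultimately show ?thesis by blast
qed

section \<open>Polynomials and the polynomial cocycle\<close>

definition monom_eval :: "((nat + nat) \<Rightarrow>\<^sub>0 nat) \<Rightarrow> (nat \<Rightarrow> int) \<Rightarrow> (nat \<Rightarrow> int) \<Rightarrow> rat" where
  "monom_eval t x y = (\<Prod>v\<in>Poly_Mapping.keys t. of_int (case_sum x y v) ^ Poly_Mapping.lookup t v)"

lemma poly_eval_monom:
  "poly_eval p x y = (\<Sum>t\<in>Poly_Mapping.keys p. Poly_Mapping.lookup p t * monom_eval t x y)"
  by (simp add: poly_eval_def monom_eval_def)

lemma poly_eval_superset:
  assumes "finite A" "Poly_Mapping.keys p \<subseteq> A"
  shows "poly_eval p x y = (\<Sum>t\<in>A. Poly_Mapping.lookup p t * monom_eval t x y)"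
  unfolding poly_eval_monom using assms by (intro sum.mono_neutral_left) (auto simp: in_keys_iff)

lemma monom_eval_superset:
  assumes "finite A" "Poly_Mapping.keys t \<subseteq> A"
  shows "monom_eval t x y = (\<Prod>v\<in>A. of_int (case_sum x y v) ^ Poly_Mapping.lookup t v)"
  unfolding monom_eval_def using assms by (intro prod.mono_neutral_left) (auto simp: in_keys_iff)

lemma monom_eval_add: "monom_eval (s + t) x y = monom_eval s x y * monom_eval t x y"
proof -
  have "Poly_Mapping.keys (s + t) \<subseteq> Poly_Mapping.keys s \<union> Poly_Mapping.keys t" by (rule keys_add)
  then show ?thesis
    using monom_eval_superset[of "Poly_Mapping.keys s \<union> Poly_Mapping.keys t" _ x y]
    by (simp add: lookup_add power_add prod.distrib)
qed

definition poly_function :: "nat \<Rightarrow> ((nat \<Rightarrow> int) \<Rightarrow> (nat \<Rightarrow> int) \<Rightarrow> rat) \<Rightarrow> bool" where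
  "poly_function m f \<longleftrightarrow> (\<exists>p. poly_in_vars m p \<and> (\<forall>x y. poly_eval p x y = f x y))"

lemma poly_function_add:
  assumes "poly_function m f" "poly_function m g" shows "poly_function m (\<lambda>x y. f x y + g x y)"
proof -
  obtain p q where pq: "poly_in_vars m p" "\<And>x y. poly_eval p x y = f x y"
    "poly_in_vars m q" "\<And>x y. poly_eval q x y = g x y"
    using assms unfolding poly_function_def by metis
  have k: "Poly_Mapping.keys (p + q) \<subseteq> Poly_Mapping.keys p \<union> Poly_Mapping.keys q" by (rule keys_add)
  let ?A = "Poly_Mapping.keys p \<union> Poly_Mapping.keys q"
  have "poly_eval (p + q) x y = poly_eval p x y + poly_eval q x y" for x y
  proof -
    have "finite ?A" by simp
    from poly_eval_superset[OF this k] poly_eval_superset[OF this Un_upper1]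
      poly_eval_superset[OF this Un_upper2]
    show ?thesis by (simp only: lookup_add sum.distrib distrib_right)
  qed
  then have "poly_eval (p + q) x y = f x y + g x y" for x y by (simp only: pq(2,4))
  moreover have "poly_in_vars m (p + q)" using pq k unfolding poly_in_vars_def by blast
  ultimately show ?thesis unfolding poly_function_def by blast
qed

lemma poly_function_monom:
  assumes "Poly_Mapping.keys t \<subseteq> Inl ` {1..m} \<union> Inr ` {1..m}"
  shows "poly_function m (\<lambda>x y. c * monom_eval t x y)"
  unfolding poly_function_def
proof (intro exI conjI allI)
  show "poly_in_vars m (Poly_Mapping.single t c)" using assms by (simp add: poly_in_vars_def)
  show "poly_eval (Poly_Mapping.single t c) x y = c * monom_eval t x y" for x y
    by (simp add: poly_eval_superset[of "{t}"])
qed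

lemma poly_function_const: "poly_function m (\<lambda>x y. c)"
  using poly_function_monom[of 0 m c] by (simp add: monom_eval_def)

lemma poly_function_sum:
  "finite A \<Longrightarrow> (\<And>t. t \<in> A \<Longrightarrow> poly_function m (f t)) \<Longrightarrow> poly_function m (\<lambda>x y. \<Sum>t\<in>A. f t x y)"
  by (induction A rule: finite_induct) (auto intro: poly_function_add poly_function_const)

lemma poly_function_mult_monom:
  assumes "poly_function m f" "Poly_Mapping.keys t \<subseteq> Inl ` {1..m} \<union> Inr ` {1..m}"
  shows "poly_function m (\<lambda>x y. c * monom_eval t x y * f x y)"
proof -
  obtain p where p: "poly_in_vars m p" "\<And>x y. poly_eval p x y = f x y"
    using assms unfolding poly_function_def by metis
  have "poly_function m (\<lambda>x y. \<Sum>u\<in>Poly_Mapping.keys p.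
      c * Poly_Mapping.lookup p u * monom_eval (t + u) x y)"
  proof (rule poly_function_sum, simp, rule poly_function_monom)
    fix u assume "u \<in> Poly_Mapping.keys p"
    then show "Poly_Mapping.keys (t + u) \<subseteq> Inl ` {1..m} \<union> Inr ` {1..m}"
      using keys_add[of t u] assms(2) p(1) unfolding poly_in_vars_def by blast
  qed
  moreover have eq: "(\<Sum>u\<in>Poly_Mapping.keys p. c * Poly_Mapping.lookup p u * monom_eval (t + u) x y)
      = c * monom_eval t x y * f x y" for x y
    unfolding p(2)[symmetric] poly_eval_monom sum_distrib_left
    by (intro sum.cong refl) (simp add: monom_eval_add)
  ultimately show ?thesis by (simp only: eq)
qed

lemma poly_function_cmult: "poly_function m f \<Longrightarrow> poly_function m (\<lambda>x y. c * f x y)"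
  using poly_function_mult_monom[of m f 0 c] by (simp add: monom_eval_def)

lemma poly_function_mult_var:
  assumes "poly_function m f" "v \<in> Inl ` {1..m} \<union> Inr ` {1..m}"
  shows "poly_function m (\<lambda>x y. of_int (case_sum x y v) * f x y)"
  using poly_function_mult_monom[of m f "Poly_Mapping.single v 1" 1] assms
  by (simp add: monom_eval_def)

lemma poly_function_mult_gbinomial:
  assumes "poly_function m f" "v \<in> Inl ` {1..m} \<union> Inr ` {1..m}"
  shows "poly_function m (\<lambda>x y. (of_int (case_sum x y v) gchoose i) * f x y)"
proof (induction i)
  case 0
  then show ?case using assms by simp
next
  case (Suc i)
  \<comment> \<open>The recurrence (i + 1) C(a, i + 1) = (a - i) C(a, i). It is through this
    division that denominators enter the coefficients.\<close>
  have rec: "a gchoose Suc i = 1 / of_nat (Suc i) * (a * (a gchoose i)) + (- of_nat i / of_nat (Suc i)) * (a gchoose i)"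
    for a :: rat
    using gbinomial_mult_1[of a i] by (simp add: field_simps del: of_nat_Suc)
  have "poly_function m (\<lambda>x y.
      1 / of_nat (Suc i) * (of_int (case_sum x y v) * ((of_int (case_sum x y v) gchoose i) * f x y))
      + (- of_nat i / of_nat (Suc i)) * ((of_int (case_sum x y v) gchoose i) * f x y))"
    by (intro poly_function_add poly_function_cmult poly_function_mult_var Suc assms)
  then show ?case unfolding rec by (simp add: algebra_simps)
qed

section \<open>The multiplication and the cocycle as polynomials\<close>

context central_sequence begin

definition product_gens :: "('a \<times> ((nat \<Rightarrow> int) \<times> (nat \<Rightarrow> int) \<Rightarrow> int)) list" where
  "product_gens = gens m (\<lambda>j p. fst p j) @ gens m (\<lambda>j p. snd p j)"

lemma word_gens_cong:
  "(\<And>j. j \<in> {1..i} \<Longrightarrow> e j p = e' j p') \<Longrightarrow> word (gens i e) p = word (gens i e') p'"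
  by (induction i) (simp_all add: gens_Suc gens_def[of 0])

lemma word_product_gens: "word product_gens (x, y) = element m x \<otimes> element m y"
proof -
  have "word (gens m (\<lambda>j p. fst p j)) (x, y) = element m x" by (rule word_gens_cong) simp
  moreover have "word (gens m (\<lambda>j p. snd p j)) (x, y) = element m y" by (rule word_gens_cong) simp
  ultimately show ?thesis
    unfolding product_gens_def word_append[OF gens_carrier[OF order_refl] gens_carrier[OF order_refl]]
    by (simp only:)
qed

lemma set_gens: "(g, e) \<in> set (gens i f) \<Longrightarrow> \<exists>j\<in>{1..i}. e = f j"
  by (auto simp: gens_def)

lemma poly_function_product:
  assumes "weight_le 0 d F"
  shows "poly_function m (\<lambda>x y. F (element m x \<otimes> element m y))"
proof -
  have "poly_function m (\<lambda>x y. F (word product_gens (x, y)))"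
  proof (rule weight_le_word[where Q = "\<lambda>f. poly_function m (\<lambda>x y. f (x, y))"])
    fix g e f i assume "(g, e) \<in> set product_gens" and f: "poly_function m (\<lambda>x y. f (x, y))"
    then obtain j where j: "j \<in> {1..m}" "e = (\<lambda>p. fst p j) \<or> e = (\<lambda>p. snd p j)"
      using set_gens[of g e m "\<lambda>j p. fst p j"] set_gens[of g e m "\<lambda>j p. snd p j"]
      unfolding product_gens_def set_append by blast
    from j(2) show "poly_function m (\<lambda>x y. (of_int (e (x, y)) gchoose i) * f (x, y))"
    proof
      assume "e = (\<lambda>p. fst p j)"
      then show ?thesis using poly_function_mult_gbinomial[OF f, of "Inl j" i] j(1) by simp
    next
      assume "e = (\<lambda>p. snd p j)"
      then show ?thesis using poly_function_mult_gbinomial[OF f, of "Inr j" i] j(1) by simp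
    qed
  qed (use assms gens_carrier[OF order_refl] in
      \<open>auto intro: poly_function_const poly_function_add simp: product_gens_def\<close>)
  then show ?thesis by (simp only: word_product_gens)
qed

lemma poly_function_right:
  assumes "weight_le 0 d F"
  shows "poly_function m (\<lambda>x y. F (element m y))"
proof -
  have "poly_function m (\<lambda>x y. F (word (gens m (\<lambda>j p::(nat \<Rightarrow> int) \<times> (nat \<Rightarrow> int). snd p j)) (x, y)))"
  proof (rule weight_le_word[where Q = "\<lambda>f. poly_function m (\<lambda>x y. f (x, y))"])
    fix g e and f :: "(nat \<Rightarrow> int) \<times> (nat \<Rightarrow> int) \<Rightarrow> rat" and i
    assume "(g, e) \<in> set (gens m (\<lambda>j p::(nat \<Rightarrow> int) \<times> (nat \<Rightarrow> int). snd p j))" and f: "poly_function m (\<lambda>x y. f (x, y))"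
    then obtain j where "j \<in> {1..m}" "e = (\<lambda>p. snd p j)" using set_gens by blast
    then show "poly_function m (\<lambda>x y. (of_int (e (x, y)) gchoose i) * f (x, y))"
      using poly_function_mult_gbinomial[OF f, of "Inr j" i] by simp
  qed (use assms gens_carrier[OF order_refl] in \<open>auto intro: poly_function_const poly_function_add\<close>)
  moreover have "word (gens m (\<lambda>j p. snd p j)) (x, y) = element m y" for x y :: "nat \<Rightarrow> int"
    by (rule word_gens_cong) simp
  ultimately show ?thesis by simp
qed

text \<open>Extends \<open>\<phi>\<close> from \<open>N 1\<close> to the group by dropping the power
  of \<open>a 1\<close> on the right. The extension is in general not a homomorphism.\<close>

definition ext_hom :: "('a \<Rightarrow> int) \<Rightarrow> 'a \<Rightarrow> rat" where
  "ext_hom \<phi> x = of_int (\<phi> (nu 0 x))"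

text \<open>By Newton's formula this is \<open>\<Sum>i<k. ext_hom \<phi> (t\<^sup>i h)\<close> with \<open>t = a 1\<close> for \<open>k \<ge> 0\<close>; the binomial form also covers
  negative \<open>k\<close> and is visibly polynomial.\<close>
definition newton_sum :: "('a \<Rightarrow> int) \<Rightarrow> int \<Rightarrow> 'a \<Rightarrow> rat" where
  "newton_sum \<phi> k h =
    (\<Sum>i<2 ^ m + 1. (of_int k gchoose Suc i) * (ldiff (a 1) ^^ i) (ext_hom \<phi>) h)"

definition ext_cocycle :: "('a \<Rightarrow> int) \<Rightarrow> 'a \<Rightarrow> 'a \<Rightarrow> int" where
  "ext_cocycle \<phi> g h = \<lfloor>newton_sum \<phi> (kap 0 g) h\<rfloor>"

context
  fixes \<phi> :: "'a \<Rightarrow> int"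
  assumes m: "0 < m" and hom: "\<And>u v. u \<in> N 1 \<Longrightarrow> v \<in> N 1 \<Longrightarrow> \<phi> (u \<otimes> v) = \<phi> u + \<phi> v"
begin

lemma facts0: "N 1 \<lhd> G" "a 1 \<in> carrier G" "\<And>k::int. k \<noteq> 0 \<Longrightarrow> a 1 [^] k \<notin> N 1"
  using step_facts[OF m] by simp_all

lemma adjoin0: "g \<in> carrier G \<Longrightarrow> g \<in> adjoin (N 1) (a 1)"
  using N_step[OF m] N_0 by simp

lemma nu0_in: "g \<in> carrier G \<Longrightarrow> nu 0 g \<in> N 1"
  using nu_in[OF m] N_0 by simp

lemma kap0_mult: "g \<in> carrier G \<Longrightarrow> h \<in> carrier G \<Longrightarrow> kap 0 (g \<otimes> h) = kap 0 g + kap 0 h"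
  using kap_mult[OF m] N_0 by simp

lemma weight_le_ext_hom: "weight_le 0 (2 ^ m + 1) (ext_hom \<phi>)"
proof -
  have "weight_le 1 (2 ^ m + 1) (\<lambda>x. of_int (\<phi> x))"
    using m by (intro weight_le_hom) (auto simp: hom)
  then show ?thesis using weight_le_extend[of 0] m by (simp add: ext_hom_def[abs_def])
qed

text \<open>The failure of additivity is a left translation of the second argument by a power of
  \<open>a 1\<close>. Summed over powers of \<open>a 1\<close>, this relation becomes the cocycle
  identity.\<close>

lemma ext_hom_mult:
  assumes "g \<in> carrier G" "h \<in> carrier G"
  shows "ext_hom \<phi> (g \<otimes> h) = ext_hom \<phi> g + ext_hom \<phi> (a 1 [^] kap 0 g \<otimes> h)"
proof -
  have u: "nu 0 g \<in> N 1" "nu 0 g \<in> carrier G" using nu0_in assms N_carrier[of 1] m by auto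
  have c: "a 1 [^] kap 0 g \<otimes> h \<in> carrier G" using assms facts0 by simp
  have "g = nu 0 g \<otimes> a 1 [^] kap 0 g" using nu_kap[OF m] N_0 assms by simp
  then have "g \<otimes> h = nu 0 g \<otimes> (a 1 [^] kap 0 g \<otimes> h)" using u assms facts0 by (metis m_assoc int_pow_closed)
  then have "nu 0 (g \<otimes> h) = nu 0 g \<otimes> nu 0 (a 1 [^] kap 0 g \<otimes> h)"
    using resid_mult_left[OF facts0 u(1) adjoin0[OF c]] by simp
  then show ?thesis using hom[OF u(1) nu0_in[OF c]] by (simp add: ext_hom_def)
qed

lemma newton_sum_0: "newton_sum \<phi> 0 h = 0"
  by (simp add: newton_sum_def)

text \<open>Pascal's rule reduces the increment to the Newton expansion of
  \<open>ext_hom \<phi>\<close>; its weight 2^m + 1 explains the number of terms in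
  \<open>newton_sum\<close>.\<close>

lemma newton_sum_step:
  assumes "h \<in> carrier G"
  shows "newton_sum \<phi> (k + 1) h = newton_sum \<phi> k h + ext_hom \<phi> (a 1 [^] k \<otimes> h)"
proof -
  have "ext_hom \<phi> (a 1 [^] k \<otimes> h) =
      (\<Sum>i<2 ^ m + 1. (of_int k gchoose i) * (ldiff (a 1) ^^ i) (ext_hom \<phi>) h)"
    using newton_expansion[OF facts0(2) assms weight_le_ldiff_funpow(2)[OF weight_le_ext_hom facts0(2)]] .
  moreover have "newton_sum \<phi> (k + 1) h =
      (\<Sum>i<2 ^ m + 1. (of_int k gchoose i) * (ldiff (a 1) ^^ i) (ext_hom \<phi>) h +
        (of_int k gchoose Suc i) * (ldiff (a 1) ^^ i) (ext_hom \<phi>) h)"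
    by (simp only: newton_sum_def of_int_add of_int_1 gbinomial_Suc_Suc distrib_right)
  ultimately show ?thesis by (simp only: newton_sum_def sum.distrib add.commute)
qed

lemma newton_sum_Ints: "h \<in> carrier G \<Longrightarrow> newton_sum \<phi> k h \<in> \<int>"
proof (induction k rule: int_induct[where k = 0])
  case (step2 i)
  then show ?case using newton_sum_step[of h "i - 1"]
    by (simp add: ext_hom_def)
qed (simp_all add: newton_sum_0 newton_sum_step ext_hom_def)

lemma of_int_ext_cocycle:
  "h \<in> carrier G \<Longrightarrow> of_int (ext_cocycle \<phi> g h) = newton_sum \<phi> (kap 0 g) h"
  using newton_sum_Ints[of h "kap 0 g"] unfolding ext_cocycle_def by (metis Ints_cases floor_of_int)

text \<open>Only the exponent k of g matters. The identity is trivial for k = 0, and its increment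
  in k is \<open>ext_hom_mult\<close> applied to \<open>a 1 [^] k \<otimes> h\<close> and
  \<open>j\<close>; induction in both directions reaches every integer.\<close>

lemma ext_cocycle_identity:
  assumes "g \<in> carrier G" "h \<in> carrier G" "j \<in> carrier G"
  shows "ext_cocycle \<phi> h j - ext_cocycle \<phi> (g \<otimes> h) j + ext_cocycle \<phi> g (h \<otimes> j) - ext_cocycle \<phi> g h = 0"
proof -
  define l where "l = kap 0 h"
  have step: "ext_hom \<phi> (a 1 [^] k \<otimes> (h \<otimes> j)) = ext_hom \<phi> (a 1 [^] k \<otimes> h) + ext_hom \<phi> (a 1 [^] (k + l) \<otimes> j)" for k :: int
  proof -
    have "kap 0 (a 1 [^] k \<otimes> h) = k + l"
      using kap0_mult[of "a 1 [^] k" h] facts0 assms expo_gen[OF facts0, of k] by (simp add: l_def)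
    then show ?thesis
      using ext_hom_mult[of "a 1 [^] k \<otimes> h" j] assms facts0 by (simp add: m_assoc)
  qed
  have "newton_sum \<phi> l j - newton_sum \<phi> (k + l) j + newton_sum \<phi> k (h \<otimes> j) - newton_sum \<phi> k h = 0" for k
  proof (induction k rule: int_induct[where k = 0])
    case base
    then show ?case by (simp add: newton_sum_0)
  next
    case (step1 i)
    then show ?case
      using newton_sum_step[of j "i + l"] newton_sum_step[of "h \<otimes> j" i] newton_sum_step[of h i] step[of i] assms
      by (simp add: algebra_simps)
  next
    case (step2 i)
    then show ?case
      using newton_sum_step[of j "i - 1 + l"] newton_sum_step[of "h \<otimes> j" "i - 1"] newton_sum_step[of h "i - 1"]
        step[of "i - 1"] assms
      by (simp add: algebra_simps)
  qed
  from this[of "kap 0 g"]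
  have "of_int (ext_cocycle \<phi> h j - ext_cocycle \<phi> (g \<otimes> h) j + ext_cocycle \<phi> g (h \<otimes> j) - ext_cocycle \<phi> g h) = (0::rat)"
    using assms kap0_mult by (simp add: of_int_ext_cocycle l_def)
  then show ?thesis by (simp only: of_int_eq_0_iff)
qed

lemma ext_cocycle_N_1: "g \<in> N 1 \<Longrightarrow> ext_cocycle \<phi> g h = 0"
  using expo_base[OF facts0] by (simp add: ext_cocycle_def newton_sum_0)

lemma ext_cocycle_a_1: "n \<in> N 1 \<Longrightarrow> ext_cocycle \<phi> (a 1) n = \<phi> n"
proof -
  assume n: "n \<in> N 1"
  then have nc: "n \<in> carrier G" using N_carrier[of 1] m by simp
  have "newton_sum \<phi> 1 n = ext_hom \<phi> n"
    using newton_sum_step[OF nc, of 0] nc by (simp add: newton_sum_0)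
  then show ?thesis
    using kap_a[OF m] resid_base[OF facts0 n] by (simp add: ext_cocycle_def ext_hom_def)
qed

text \<open>The first coordinate of a word is its exponent \<open>x 1\<close>, so
  \<open>newton_sum\<close> is a sum of binomials in \<open>x 1\<close> times polynomial functions
  of \<open>y\<close>.\<close>

lemma poly_function_ext_cocycle:
  "poly_function m (\<lambda>x y. of_int (ext_cocycle \<phi> (element m x) (element m y)))"
proof -
  have "coord 1 (element m x) = kap 0 (element m x)" for x by (simp add: coord_def)
  then have k: "kap 0 (element m x) = x 1" for x using coord_element[of 1 x] m by simp
  have "poly_function m (\<lambda>x y. \<Sum>i<2 ^ m + 1.
      (of_int (case_sum x y (Inl 1)) gchoose Suc i) * (ldiff (a 1) ^^ i) (ext_hom \<phi>) (element m y))"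
    using m weight_le_ldiff_funpow(1)[OF weight_le_ext_hom facts0(2)]
    by (intro poly_function_sum poly_function_mult_gbinomial poly_function_right) auto
  then show ?thesis
    by (simp add: of_int_ext_cocycle element_closed k newton_sum_def)
qed

end

end

section \<open>The projective representations\<close>

lemma clear_denominators:
  assumes "coprime_to_denominators n p"
  shows "\<exists>(D::int) c. coprime D (int n) \<and>
    (\<forall>t\<in>Poly_Mapping.keys p. of_int D * Poly_Mapping.lookup p t = of_int (c t))"
proof -
  define a where "a = (\<lambda>t. fst (quotient_of (Poly_Mapping.lookup p t)))"
  define b where "b = (\<lambda>t. snd (quotient_of (Poly_Mapping.lookup p t)))"
  define D where "D = prod b (Poly_Mapping.keys p)"
  define c where "c = (\<lambda>t. a t * prod b (Poly_Mapping.keys p - {t}))"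
  have "of_int D * Poly_Mapping.lookup p t = of_int (c t)" if t: "t \<in> Poly_Mapping.keys p" for t
  proof -
    have b0: "b t \<noteq> 0" using quotient_of_denom_pos'[of "Poly_Mapping.lookup p t"] by (simp add: b_def)
    have "Poly_Mapping.lookup p t = of_int (a t) / of_int (b t)"
      unfolding a_def b_def by (rule quotient_of_div) simp
    then show ?thesis
      using b0 prod.remove[OF _ t, of b] by (simp add: D_def c_def)
  qed
  moreover have "coprime D (int n)"
    using assms unfolding D_def b_def coprime_to_denominators_def
    by (intro prod_coprime_left) (simp add: coprime_commute)
  ultimately show ?thesis by blast
qed

lemma of_int_poly_int:
  "poly_int_valued m p \<Longrightarrow> x \<in> int_tuples m \<Longrightarrow> y \<in> int_tuples m \<Longrightarrow> of_int (poly_int p x y) = poly_eval p x y"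
  unfolding poly_int_valued_def poly_int_def by (metis Ints_cases floor_of_int)

text \<open>An integer-valued polynomial with rational coefficients need not respect congruences.
  After multiplication by the product D of the denominators it has integer coefficients and does,
  and D cancels because it is coprime to n.\<close>

lemma poly_int_cong:
  assumes p: "poly_in_vars m p" "poly_int_valued m p" "coprime_to_denominators n p"
    and x: "x \<in> int_tuples m" and y: "y \<in> int_tuples m" "y' \<in> int_tuples m"
    and yy: "\<And>i. i \<in> {1..m} \<Longrightarrow> [y i = y' i] (mod int n)"
  shows "[poly_int p x y = poly_int p x y'] (mod int n)"
proof -
  obtain D :: int and c where D: "coprime D (int n)"
    "\<And>t. t \<in> Poly_Mapping.keys p \<Longrightarrow> of_int D * Poly_Mapping.lookup p t = of_int (c t)"
    using clear_denominators[OF p(3)] by blast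
  define M where "M = (\<lambda>t (y::nat \<Rightarrow> int). \<Prod>v\<in>Poly_Mapping.keys t. (case_sum x y v) ^ Poly_Mapping.lookup t v)"
  have e: "D * poly_int p x y = (\<Sum>t\<in>Poly_Mapping.keys p. c t * M t y)" if "y \<in> int_tuples m" for y
  proof -
    have "of_int (D * poly_int p x y) = of_int D * poly_eval p x y"
      using of_int_poly_int[OF p(2) x that] by simp
    also have "\<dots> = (\<Sum>t\<in>Poly_Mapping.keys p. (of_int D * Poly_Mapping.lookup p t) * of_int (M t y))"
      by (simp add: poly_eval_def sum_distrib_left M_def mult.assoc)
    also have "\<dots> = of_int (\<Sum>t\<in>Poly_Mapping.keys p. c t * M t y)" by (simp add: D(2))
    finally show ?thesis by (simp only: of_int_eq_iff)
  qed
  have "[M t y = M t y'] (mod int n)" if t: "t \<in> Poly_Mapping.keys p" for t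
    unfolding M_def
  proof (intro cong_prod cong_pow)
    fix v assume "v \<in> Poly_Mapping.keys t"
    then have "v \<in> Inl ` {1..m} \<union> Inr ` {1..m}" using p(1) t unfolding poly_in_vars_def by blast
    then show "[case_sum x y v = case_sum x y' v] (mod int n)" using yy by auto
  qed
  then have "[(\<Sum>t\<in>Poly_Mapping.keys p. c t * M t y) = (\<Sum>t\<in>Poly_Mapping.keys p. c t * M t y')] (mod int n)"
    by (intro cong_sum cong_mult cong_refl)
  then have "[D * poly_int p x y = D * poly_int p x y'] (mod int n)" by (simp only: e y)
  then show ?thesis using D(1) by (simp add: cong_mult_lcancel)
qed

section \<open>Indices of the tensor basis\<close>

fun enc :: "nat \<Rightarrow> nat list \<Rightarrow> nat" where
  "enc n [] = 0"
| "enc n (d # ds) = d * n ^ length ds + enc n ds"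

lemma enc_less: "(\<And>d. d \<in> set ds \<Longrightarrow> d < n) \<Longrightarrow> enc n ds < n ^ length ds"
proof (induction ds)
  case (Cons d ds)
  then have "enc n ds < n ^ length ds" "d < n" by auto
  then have "d * n ^ length ds + enc n ds < Suc d * n ^ length ds" by simp
  also have "\<dots> \<le> n * n ^ length ds" using \<open>d < n\<close> by (intro mult_le_mono1) simp
  finally show ?case by simp
qed simp

lemma enc_inj:
  assumes "length ds = length es" "\<And>d. d \<in> set ds \<Longrightarrow> d < n" "\<And>d. d \<in> set es \<Longrightarrow> d < n" "enc n ds = enc n es"
  shows "ds = es"
  using assms
proof (induction ds es rule: list_induct2)
  case (Cons d ds e es)
  have "enc n ds < n ^ length ds" "enc n es < n ^ length ds"
    using enc_less[of ds n] enc_less[of es n] Cons.prems Cons.hyps by simp_all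
  moreover have "d * n ^ length ds + enc n ds = e * n ^ length ds + enc n es"
    using Cons.prems(3) Cons.hyps by simp
  ultimately have "d = e \<and> enc n ds = enc n es"
    by (metis add.commute add_left_cancel div_mult_self1 div_less add.left_neutral less_nat_zero_code)
  then show ?case using Cons by simp
qed simp

lemma enc_surj: "I < n ^ k \<Longrightarrow> \<exists>ds. length ds = k \<and> (\<forall>d\<in>set ds. d < n) \<and> enc n ds = I"
proof (induction k arbitrary: I)
  case (Suc k)
  have n: "n > 0" using Suc.prems by (cases n) auto
  obtain ds where ds: "length ds = k" "\<forall>d\<in>set ds. d < n" "enc n ds = I mod n ^ k"
    using Suc.IH[of "I mod n ^ k"] n by auto
  have "I div n ^ k < n" using Suc.prems by (simp add: less_mult_imp_div_less)
  then show ?case using ds div_mult_mod_eq[of I "n ^ k"] by (intro exI[of _ "I div n ^ k # ds"]) simp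
qed simp

lemma kron_unit_vec:
  assumes "i < a" "j < b" shows "kron_vec (unit_vec a i) (unit_vec b j) = unit_vec (a * b) (i * b + j)"
proof (rule eq_vecI)
  fix l assume "l < dim_vec (unit_vec (a * b) (i * b + j) :: complex vec)"
  then have l: "l < a * b" by simp
  have b: "b > 0" using assms by simp
  have "l div b < a" "l mod b < b" using l b by (simp_all add: less_mult_imp_div_less)
  moreover have "l div b = i \<and> l mod b = j \<longleftrightarrow> l = i * b + j" using assms b by auto
  ultimately show "vec_index (kron_vec (unit_vec a i) (unit_vec b j)) l = vec_index (unit_vec (a * b) (i * b + j)) l"
    using l assms by (auto simp: kron_vec_def unit_vec_def)
qed (simp add: kron_vec_def)

text \<open>In a Kronecker product the first factor is the most significant digit, which is why
  \<open>enc\<close> reads its list as a base n numeral with the leading digit in front.\<close>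

lemma tensor_unit_vecs:
  "(\<And>d. d \<in> set ds \<Longrightarrow> d < n) \<Longrightarrow> tensor_vecs (map (unit_vec n) ds) = unit_vec (n ^ length ds) (enc n ds)"
proof (induction ds)
  case Nil
  then show ?case by (auto simp: tensor_vecs_def unit_vec_def intro!: eq_vecI)
next
  case (Cons d ds)
  have "tensor_vecs (map (unit_vec n) (d # ds)) = kron_vec (unit_vec n d) (unit_vec (n ^ length ds) (enc n ds))"
    using Cons by (simp add: tensor_vecs_def)
  also have "\<dots> = unit_vec (n ^ length (d # ds)) (enc n (d # ds))"
    using Cons.prems enc_less[of ds n] by (simp add: kron_unit_vec)
  finally show ?case .
qed

definition tuple_index :: "nat \<Rightarrow> nat \<Rightarrow> (nat \<Rightarrow> int) \<Rightarrow> nat" where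
  "tuple_index m n y = enc n (map (\<lambda>i. nat (y i mod int n)) [1..<Suc m])"

lemma nat_mod_less: "n > 0 \<Longrightarrow> nat (k mod int n) < n"
  by (simp add: nat_less_iff)

lemma basis_tensor_eq:
  assumes n: "n > 0" shows "basis_tensor m n y = unit_vec (n ^ m) (tuple_index m n y)"
proof -
  let ?ds = "map (\<lambda>i. nat (y i mod int n)) [1..<Suc m]"
  have "basis_tensor m n y = tensor_vecs (map (unit_vec n) ?ds)"
    unfolding basis_tensor_def periodic_basis_vec_def map_map comp_def ..
  also have "\<dots> = unit_vec (n ^ length ?ds) (enc n ?ds)"
    by (rule tensor_unit_vecs) (use nat_mod_less[OF n] in \<open>auto simp del: upt_Suc\<close>)
  finally show ?thesis by (simp add: tuple_index_def del: upt_Suc)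
qed

lemma tuple_index_less: "n > 0 \<Longrightarrow> tuple_index m n y < n ^ m"
  using enc_less[of "map (\<lambda>i. nat (y i mod int n)) [1..<Suc m]" n] nat_mod_less
  by (auto simp: tuple_index_def simp del: upt_Suc)

lemma tuple_index_eq_iff:
  assumes n: "n > 0"
  shows "tuple_index m n y = tuple_index m n y' \<longleftrightarrow> (\<forall>i\<in>{1..m}. [y i = y' i] (mod int n))"
proof
  assume "tuple_index m n y = tuple_index m n y'"
  then have "map (\<lambda>i. nat (y i mod int n)) [1..<Suc m] = map (\<lambda>i. nat (y' i mod int n)) [1..<Suc m]"
    unfolding tuple_index_def using nat_mod_less[OF n] by (intro enc_inj[of _ _ n]) (auto simp del: upt_Suc)
  then have "\<forall>i\<in>set [1..<Suc m]. nat (y i mod int n) = nat (y' i mod int n)"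
    by (simp only: map_eq_conv)
  then have "\<forall>i\<in>{1..m}. nat (y i mod int n) = nat (y' i mod int n)" by (simp only: set_upt atLeastLessThanSuc_atLeastAtMost)
  then show "\<forall>i\<in>{1..m}. [y i = y' i] (mod int n)"
    using n by (auto simp: cong_def nat_eq_iff2 split: if_splits)
next
  assume "\<forall>i\<in>{1..m}. [y i = y' i] (mod int n)"
  then have "map (\<lambda>i. nat (y i mod int n)) [1..<Suc m] = map (\<lambda>i. nat (y' i mod int n)) [1..<Suc m]"
    by (intro map_cong refl) (auto simp: cong_def simp del: upt_Suc)
  then show "tuple_index m n y = tuple_index m n y'" by (simp only: tuple_index_def)
qed

lemma tuple_index_surj:
  assumes "I < n ^ m" shows "\<exists>y\<in>int_tuples m. tuple_index m n y = I"
proof -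
  obtain ds where ds: "length ds = m" "\<forall>d\<in>set ds. d < n" "enc n ds = I" using enc_surj[OF assms] by blast
  define y where "y = (\<lambda>i\<in>{1..m}. int (ds ! (i - 1)))"
  have "map (\<lambda>i. nat (y i mod int n)) [1..<Suc m] = ds"
  proof (rule nth_equalityI)
    fix j assume "j < length (map (\<lambda>i. nat (y i mod int n)) [1..<Suc m])"
    then have j: "j < m" by (simp del: upt_Suc)
    then have "ds ! j < n" using ds by simp
    then show "map (\<lambda>i. nat (y i mod int n)) [1..<Suc m] ! j = ds ! j"
      using j by (simp add: y_def nth_append del: upt_Suc)
  qed (simp add: ds del: upt_Suc)
  then have "tuple_index m n y = I" using ds by (simp add: tuple_index_def)
  moreover have "y \<in> int_tuples m" by (auto simp: y_def)
  ultimately show ?thesis by blast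
qed

section \<open>Roots of unity and monomial matrices\<close>

definition root_exp :: "nat \<Rightarrow> int \<Rightarrow> complex" where
  "root_exp n k = exp (2 * of_real pi * \<i> / of_nat n * of_int k)"

lemma root_exp_0 [simp]: "root_exp n 0 = 1"
  by (simp add: root_exp_def)

lemma root_exp_add: "root_exp n (k + l) = root_exp n k * root_exp n l"
  by (simp add: root_exp_def distrib_left exp_add)

lemma norm_root_exp [simp]: "cmod (root_exp n k) = 1"
proof -
  have "2 * of_real pi * \<i> / of_nat n * of_int k = \<i> * of_real (2 * pi / real n * of_int k)" by simp
  then show ?thesis unfolding root_exp_def by (simp only: norm_exp_i_times)
qed

lemma root_exp_eq_1_iff: assumes "n > 0" shows "root_exp n k = 1 \<longleftrightarrow> int n dvd k"
proof -
  have "root_exp n k = 1 \<longleftrightarrow> (\<exists>j::int. 2 * pi / real n * of_int k = of_int (2 * j) * pi)"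
    unfolding root_exp_def by (subst exp_eq_1) simp
  also have "\<dots> \<longleftrightarrow> (\<exists>j::int. (of_int k :: real) = of_int (int n * j))"
    using assms by (simp add: field_simps)
  also have "\<dots> \<longleftrightarrow> int n dvd k" by (simp only: of_int_eq_iff dvd_def)
  finally show ?thesis .
qed

lemma root_exp_cong: assumes "n > 0" "[k = l] (mod int n)" shows "root_exp n k = root_exp n l"
proof -
  have "root_exp n (k - l) = 1" using assms by (simp add: root_exp_eq_1_iff cong_iff_dvd_diff)
  then show ?thesis using root_exp_add[of n "k - l" l] by simp
qed

lemma mult_unit_vec:
  fixes A :: "complex mat"
  assumes "A \<in> carrier_mat k l" "j < l" shows "A *\<^sub>v unit_vec l j = col A j"
  using assms by (intro eq_vecI) (auto simp: scalar_prod_right_unit)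

lemma smult_mat_vec:
  fixes A :: "complex mat"
  assumes "A \<in> carrier_mat k l" "v \<in> carrier_vec l" shows "(c \<cdot>\<^sub>m A) *\<^sub>v v = c \<cdot>\<^sub>v (A *\<^sub>v v)"
  using assms by (intro eq_vecI) auto

lemma mat_adjoint_index:
  "i < dim_col A \<Longrightarrow> j < dim_row A \<Longrightarrow> mat_adjoint A $$ (i, j) = cnj (A $$ (j, i))"
  by (simp add: mat_adjoint_def mat_of_rows_def conjugate_complex_def)

lemma mat_adjoint_carrier: "A \<in> carrier_mat k l \<Longrightarrow> mat_adjoint A \<in> carrier_mat l k"
  by (auto simp: mat_adjoint_def mat_of_rows_def)

lemma monomial_unitary:
  fixes w :: "nat \<Rightarrow> complex"
  assumes p: "\<And>j. j < k \<Longrightarrow> p j < k" "inj_on p {..<k}" and w: "\<And>j. j < k \<Longrightarrow> cmod (w j) = 1"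
  shows "mat k k (\<lambda>(i, j). if i = p j then w j else 0) \<in> carrier (unitary_group k)"
proof -
  let ?A = "mat k k (\<lambda>(i, j). if i = p j then w j else 0)"
  have A: "?A \<in> carrier_mat k k" by simp
  have "mat_adjoint ?A * ?A = 1\<^sub>m k"
  proof (rule eq_matI)
    fix i j assume "i < dim_row (1\<^sub>m k :: complex mat)" "j < dim_col (1\<^sub>m k :: complex mat)"
    then have ij: "i < k" "j < k" by simp_all
    have "(mat_adjoint ?A * ?A) $$ (i, j) = (\<Sum>l = 0..<k. mat_adjoint ?A $$ (i, l) * ?A $$ (l, j))"
      using ij mat_adjoint_carrier[OF A] by (simp add: scalar_prod_def)
    also have "\<dots> = (\<Sum>l = 0..<k. if l = p j then (if p j = p i then cnj (w i) * w j else 0) else 0)"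
      using ij by (intro sum.cong) (auto simp: mat_adjoint_index)
    also have "\<dots> = (if p j = p i then cnj (w i) * w j else 0)" using p(1)[OF ij(2)] by simp
    also have "\<dots> = (if i = j then 1 else 0)"
    proof -
      have "p j = p i \<longleftrightarrow> i = j" using p(2) ij by (auto dest: inj_onD)
      moreover have "cnj (w i) * w i = 1"
        using w[OF ij(1)] complex_norm_square[of "w i"] by (simp add: mult.commute)
      ultimately show ?thesis by auto
    qed
    finally show "(mat_adjoint ?A * ?A) $$ (i, j) = 1\<^sub>m k $$ (i, j)" using ij by simp
  qed (use mat_adjoint_carrier[OF A] in auto)
  then show ?thesis
    using A mat_adjoint_carrier[OF A] mat_mult_left_right_inverse[of "mat_adjoint ?A" k ?A]
    by (simp add: unitary_group_def)
qed

text \<open>Nilpotency is no longer used from here on: the projective representations, the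
  separation and the perturbation argument work for any group law and cocycle given by
  integer-valued polynomials, the last one also with a cycle that detects the cocycle.\<close>

locale poly_cocycle =
  fixes m :: nat and \<eta> :: "nat \<Rightarrow> xy_poly" and s :: xy_poly
  assumes grp: "group (tuple_group m \<eta>)"
    and eta: "\<And>i. i \<in> {1..m} \<Longrightarrow> poly_in_vars m (\<eta> i) \<and> poly_int_valued m (\<eta> i)"
    and sigma: "poly_in_vars m s" "poly_int_valued m s"
    and cocycle: "cocycle2 (tuple_group m \<eta>) (poly_cochain m s)"
begin

sublocale G: group "tuple_group m \<eta>" by (rule grp)

lemma carrier_tuple_group: "carrier (tuple_group m \<eta>) = int_tuples m"
  by (simp add: tuple_group_def)

lemma mult_tuple_group: "x \<otimes>\<^bsub>tuple_group m \<eta>\<^esub> y = tuple_mult m \<eta> x y"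
  by (simp add: tuple_group_def)

lemma tuple_mult_closed: "tuple_mult m \<eta> x y \<in> int_tuples m"
  by (auto simp: tuple_mult_def)

lemma tuple_index_mult:
  "tuple_index m n (\<lambda>i. poly_int (\<eta> i) x y) = tuple_index m n (tuple_mult m \<eta> x y)"
  unfolding tuple_index_def by (rule arg_cong[of _ _ "enc n"], rule map_cong) (auto simp: tuple_mult_def)

lemma poly_cochain_eq: "x \<in> int_tuples m \<Longrightarrow> y \<in> int_tuples m \<Longrightarrow> poly_cochain m s (x, y) = poly_int s x y"
  by (simp only: poly_cochain_def restrict_apply mem_Times_iff fst_conv snd_conv prod.case if_True simp_thms)

lemma cocycle_eq:
  assumes "x \<in> int_tuples m" "y \<in> int_tuples m" "z \<in> int_tuples m"
  shows "poly_int s y z + poly_int s x (tuple_mult m \<eta> y z) = poly_int s x y + poly_int s (tuple_mult m \<eta> x y) z"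
proof -
  have "poly_cochain m s (y, z) - poly_cochain m s (tuple_mult m \<eta> x y, z)
      + poly_cochain m s (x, tuple_mult m \<eta> y z) - poly_cochain m s (x, y) = 0"
    using cocycle assms unfolding cocycle2_def carrier_tuple_group mult_tuple_group by blast
  then show ?thesis unfolding poly_cochain_eq[OF assms(2,3)] poly_cochain_eq[OF tuple_mult_closed assms(3)]
    poly_cochain_eq[OF assms(1) tuple_mult_closed] poly_cochain_eq[OF assms(1,2)] by simp
qed

context
  fixes n assumes adm: "n \<in> admissible_indices m \<eta> s"
begin

lemma n_pos: "n > 0" using adm by (simp add: admissible_indices_def)

text \<open>Left multiplication by \<open>x\<close> respects congruence modulo n by
  \<open>poly_int_cong\<close>. Applied to the inverse of \<open>x\<close>, the same fact gives
  injectivity, so no group structure on the residues has to be set up.\<close>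

lemma tuple_index_mult_eq_iff:
  assumes x: "x \<in> int_tuples m" and y: "y \<in> int_tuples m" "y' \<in> int_tuples m"
  shows "tuple_index m n (tuple_mult m \<eta> x y) = tuple_index m n (tuple_mult m \<eta> x y') \<longleftrightarrow>
    tuple_index m n y = tuple_index m n y'"
proof -
  have imp: "tuple_index m n (tuple_mult m \<eta> x y) = tuple_index m n (tuple_mult m \<eta> x y')"
    if "tuple_index m n y = tuple_index m n y'" "x \<in> int_tuples m" "y \<in> int_tuples m" "y' \<in> int_tuples m" for x y y'
    unfolding tuple_index_eq_iff[OF n_pos]
  proof
    fix i assume i: "i \<in> {1..m}"
    have "[poly_int (\<eta> i) x y = poly_int (\<eta> i) x y'] (mod int n)"
      using that adm eta[OF i] i tuple_index_eq_iff[OF n_pos, of m y y']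
      by (intro poly_int_cong[of m]) (auto simp: admissible_indices_def)
    then show "[tuple_mult m \<eta> x y i = tuple_mult m \<eta> x y' i] (mod int n)" using i by (simp add: tuple_mult_def)
  qed
  define x' where "x' = inv\<^bsub>tuple_group m \<eta>\<^esub> x"
  have xG: "x \<in> carrier (tuple_group m \<eta>)" using x carrier_tuple_group by simp
  have x': "x' \<in> int_tuples m" using G.inv_closed[OF xG] by (simp add: x'_def carrier_tuple_group)
  have canc: "tuple_mult m \<eta> x' (tuple_mult m \<eta> x y) = y" if "y \<in> int_tuples m" for y
    using G.inv_cancel_left(1)[OF xG, of y] that by (simp add: x'_def carrier_tuple_group mult_tuple_group)
  show ?thesis
    using imp[OF _ x y] imp[OF _ x' tuple_mult_closed tuple_mult_closed, of x y x y'] canc y by auto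
qed

lemma phase_cong:
  assumes x: "x \<in> int_tuples m" and y: "y \<in> int_tuples m" "y' \<in> int_tuples m"
    and eq: "tuple_index m n y = tuple_index m n y'"
  shows "root_exp n (poly_int s x y) = root_exp n (poly_int s x y')"
  using adm sigma eq x y
  by (intro root_exp_cong n_pos poly_int_cong[of m]) (auto simp: admissible_indices_def tuple_index_eq_iff[OF n_pos])

lemma rho_formula_iff:
  "rho_formula m \<eta> s n x A \<longleftrightarrow> (\<forall>y\<in>int_tuples m. A *\<^sub>v unit_vec (n ^ m) (tuple_index m n y) =
     root_exp n (poly_int s x y) \<cdot>\<^sub>v unit_vec (n ^ m) (tuple_index m n (tuple_mult m \<eta> x y)))"
  unfolding rho_formula_def basis_tensor_eq[OF n_pos] tuple_index_mult root_exp_def ..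

lemma mat_eq_on_tuples:
  assumes "A \<in> carrier_mat (n ^ m) (n ^ m)" "B \<in> carrier_mat (n ^ m) (n ^ m)"
    and "\<And>y. y \<in> int_tuples m \<Longrightarrow>
      A *\<^sub>v unit_vec (n ^ m) (tuple_index m n y) = B *\<^sub>v unit_vec (n ^ m) (tuple_index m n y)"
  shows "A = (B :: complex mat)"
proof (rule mat_col_eqI)
  fix j assume "j < dim_col B"
  then have j: "j < n ^ m" using assms by simp
  then obtain y where "y \<in> int_tuples m" "tuple_index m n y = j" using tuple_index_surj by blast
  then show "col A j = col B j" using assms(3)[of y] mult_unit_vec[OF assms(1) j] mult_unit_vec[OF assms(2) j] by simp
qed (use assms in auto)

text \<open>A permutation matrix with phases, built from arbitrary representatives of the residues.
  \<open>phase_cong\<close> and \<open>tuple_index_mult_eq_iff\<close> show that the formula then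
  holds for every representative. The restriction on the entries is recorded for the finiteness of
  the image of the lift.\<close>

lemma rho_matrix_exists:
  assumes x: "x \<in> int_tuples m"
  shows "\<exists>A. A \<in> carrier (unitary_group (n ^ m)) \<and> rho_formula m \<eta> s n x A \<and>
    (\<forall>i<n ^ m. \<forall>j<n ^ m. A $$ (i, j) \<in> insert 0 (root_exp n ` {0..<int n}))"
proof -
  define dec where "dec = (\<lambda>j. SOME y. y \<in> int_tuples m \<and> tuple_index m n y = j)"
  have dec: "dec j \<in> int_tuples m \<and> tuple_index m n (dec j) = j" if "j < n ^ m" for j
  proof -
    have "\<exists>y. y \<in> int_tuples m \<and> tuple_index m n y = j" using tuple_index_surj[OF that] by (elim bexE) (intro exI conjI)
    from someI_ex[OF this] show ?thesis unfolding dec_def .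
  qed
  define p where "p = (\<lambda>j. tuple_index m n (tuple_mult m \<eta> x (dec j)))"
  define w where "w = (\<lambda>j. root_exp n (poly_int s x (dec j)))"
  define A where "A = mat (n ^ m) (n ^ m) (\<lambda>(i, j). if i = p j then w j else 0)"
  have "inj_on p {..<n ^ m}"
  proof (rule inj_onI)
    fix i j assume ij: "i \<in> {..<n ^ m}" "j \<in> {..<n ^ m}" "p i = p j"
    then show "i = j" using tuple_index_mult_eq_iff[OF x, of "dec i" "dec j"] dec[of i] dec[of j] by (simp add: p_def)
  qed
  then have unit: "A \<in> carrier (unitary_group (n ^ m))"
    unfolding A_def by (intro monomial_unitary) (auto simp: p_def w_def tuple_index_less[OF n_pos])
  have "A *\<^sub>v unit_vec (n ^ m) (tuple_index m n y) =
     root_exp n (poly_int s x y) \<cdot>\<^sub>v unit_vec (n ^ m) (tuple_index m n (tuple_mult m \<eta> x y))"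
    if y: "y \<in> int_tuples m" for y
  proof -
    define j where "j = tuple_index m n y"
    have j: "j < n ^ m" unfolding j_def by (rule tuple_index_less[OF n_pos])
    have "A *\<^sub>v unit_vec (n ^ m) j = col A j" by (rule mult_unit_vec) (auto simp: A_def j)
    also have "\<dots> = w j \<cdot>\<^sub>v unit_vec (n ^ m) (p j)"
      using j by (intro eq_vecI) (auto simp: A_def unit_vec_def)
    also have "w j = root_exp n (poly_int s x y)"
      unfolding w_def using dec[OF j] y by (intro phase_cong x) (auto simp: j_def)
    also have "p j = tuple_index m n (tuple_mult m \<eta> x y)"
      unfolding p_def using tuple_index_mult_eq_iff[OF x, of "dec j" y] dec[OF j] y by (simp add: j_def)
    finally show ?thesis by (simp add: j_def)
  qed
  then have "rho_formula m \<eta> s n x A" by (simp add: rho_formula_iff)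
  moreover have "A $$ (i, j) \<in> insert 0 (root_exp n ` {0..<int n})" if "i < n ^ m" "j < n ^ m" for i j
  proof -
    have "w j = root_exp n (poly_int s x (dec j) mod int n)"
      unfolding w_def by (intro root_exp_cong n_pos) (simp add: cong_def)
    moreover have "poly_int s x (dec j) mod int n \<in> {0..<int n}" using n_pos by simp
    ultimately have "w j \<in> root_exp n ` {0..<int n}" by blast
    then show ?thesis using that by (simp add: A_def)
  qed
  ultimately show ?thesis using unit by blast
qed

lemma unitary_carrier: "A \<in> carrier (unitary_group k) \<Longrightarrow> A \<in> carrier_mat k k"
  by (simp add: unitary_group_def)

lemma rho_ex1:
  assumes x: "x \<in> int_tuples m"
  shows "\<exists>!A. A \<in> carrier (unitary_group (n ^ m)) \<and> rho_formula m \<eta> s n x A"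
proof -
  obtain A where "A \<in> carrier (unitary_group (n ^ m)) \<and> rho_formula m \<eta> s n x A"
    using rho_matrix_exists[OF x] by blast
  moreover have "A = B" if "A \<in> carrier (unitary_group (n ^ m)) \<and> rho_formula m \<eta> s n x A"
    "B \<in> carrier (unitary_group (n ^ m)) \<and> rho_formula m \<eta> s n x B" for A B
    using that by (intro mat_eq_on_tuples) (auto simp: rho_formula_iff unitary_carrier)
  ultimately show ?thesis by blast
qed

lemma rho_props:
  assumes x: "x \<in> int_tuples m"
  shows "rho m \<eta> s n x \<in> carrier (unitary_group (n ^ m))" "rho_formula m \<eta> s n x (rho m \<eta> s n x)"
  using theI'[OF rho_ex1[OF x]] unfolding rho_def by simp_all

lemma rho_entries:
  assumes x: "x \<in> int_tuples m" "i < n ^ m" "j < n ^ m"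
  shows "rho m \<eta> s n x $$ (i, j) \<in> insert 0 (root_exp n ` {0..<int n})"
proof -
  obtain A where A: "A \<in> carrier (unitary_group (n ^ m))" "rho_formula m \<eta> s n x A"
    "\<forall>i<n ^ m. \<forall>j<n ^ m. A $$ (i, j) \<in> insert 0 (root_exp n ` {0..<int n})"
    using rho_matrix_exists[OF x(1)] by blast
  then have "A = rho m \<eta> s n x" using rho_ex1[OF x(1)] rho_props[OF x(1)] by blast
  then show ?thesis using A x by blast
qed

lemma rho_mult:
  assumes x: "x \<in> int_tuples m" and y: "y \<in> int_tuples m"
  shows "rho m \<eta> s n x * rho m \<eta> s n y =
    root_exp n (poly_int s x y) \<cdot>\<^sub>m rho m \<eta> s n (tuple_mult m \<eta> x y)"
proof (rule mat_eq_on_tuples)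
  let ?r = "rho m \<eta> s n" and ?e = "\<lambda>z. unit_vec (n ^ m) (tuple_index m n z) :: complex vec"
  have xy: "tuple_mult m \<eta> x y \<in> int_tuples m" by (rule tuple_mult_closed)
  note c = rho_props(1)[THEN unitary_carrier]
  have f: "?r x *\<^sub>v ?e z = root_exp n (poly_int s x z) \<cdot>\<^sub>v ?e (tuple_mult m \<eta> x z)"
    if "x \<in> int_tuples m" "z \<in> int_tuples m" for x z
    using rho_props(2)[OF that(1)] that(2) unfolding rho_formula_iff by blast
  show "?r x * ?r y \<in> carrier_mat (n ^ m) (n ^ m)" using c[OF x] c[OF y] by simp
  show "root_exp n (poly_int s x y) \<cdot>\<^sub>m ?r (tuple_mult m \<eta> x y) \<in> carrier_mat (n ^ m) (n ^ m)" using c[OF xy] by simp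
  fix z assume z: "z \<in> int_tuples m"
  have yz: "tuple_mult m \<eta> y z \<in> int_tuples m" by (rule tuple_mult_closed)
  have assoc: "tuple_mult m \<eta> x (tuple_mult m \<eta> y z) = tuple_mult m \<eta> (tuple_mult m \<eta> x y) z"
    using G.m_assoc[of x y z] x y z by (simp add: carrier_tuple_group mult_tuple_group)
  have "(?r x * ?r y) *\<^sub>v ?e z = ?r x *\<^sub>v (?r y *\<^sub>v ?e z)"
    using c[OF x] c[OF y] by (intro assoc_mult_mat_vec) auto
  also have "\<dots> = root_exp n (poly_int s y z) \<cdot>\<^sub>v (?r x *\<^sub>v ?e (tuple_mult m \<eta> y z))"
    using c[OF x] by (simp add: f[OF y z] mult_mat_vec)
  also have "\<dots> = (root_exp n (poly_int s y z) * root_exp n (poly_int s x (tuple_mult m \<eta> y z))) \<cdot>\<^sub>v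
      ?e (tuple_mult m \<eta> x (tuple_mult m \<eta> y z))"
    by (simp add: f[OF x yz] smult_smult_assoc)
  \<comment> \<open>The cocycle identity trades the z-dependent phases for one that does not depend
    on z, so it becomes a scalar factor of the matrix.\<close>
  also have "root_exp n (poly_int s y z) * root_exp n (poly_int s x (tuple_mult m \<eta> y z)) =
      root_exp n (poly_int s x y) * root_exp n (poly_int s (tuple_mult m \<eta> x y) z)"
    by (simp only: root_exp_add[symmetric] cocycle_eq[OF x y z])
  also have "\<dots> \<cdot>\<^sub>v ?e (tuple_mult m \<eta> x (tuple_mult m \<eta> y z)) =
      root_exp n (poly_int s x y) \<cdot>\<^sub>v (?r (tuple_mult m \<eta> x y) *\<^sub>v ?e z)"
    by (simp add: f[OF xy z] smult_smult_assoc assoc)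
  also have "\<dots> = (root_exp n (poly_int s x y) \<cdot>\<^sub>m ?r (tuple_mult m \<eta> x y)) *\<^sub>v ?e z"
    by (rule smult_mat_vec[symmetric]) (use c[OF xy] in auto)
  finally show "(?r x * ?r y) *\<^sub>v ?e z = (root_exp n (poly_int s x y) \<cdot>\<^sub>m ?r (tuple_mult m \<eta> x y)) *\<^sub>v ?e z" .
qed

end

end

section \<open>Operator norms and logarithms of determinants\<close>

lemma vec_norm2_eq_L2_set: "vec_norm2 v = L2_set (\<lambda>i. cmod (vec_index v i)) {..<dim_vec v}"
  by (simp add: vec_norm2_def L2_set_def)

lemma vec_norm2_nonneg [simp]: "0 \<le> vec_norm2 v"
  by (simp add: vec_norm2_eq_L2_set L2_set_nonneg)

lemma vec_norm2_triangle:
  assumes "v \<in> carrier_vec k" "w \<in> carrier_vec k"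
  shows "vec_norm2 (v + w) \<le> vec_norm2 v + vec_norm2 w"
proof -
  have "vec_norm2 (v + w) \<le> L2_set (\<lambda>i. cmod (vec_index v i) + cmod (vec_index w i)) {..<k}"
    unfolding vec_norm2_eq_L2_set using assms by (auto intro!: L2_set_mono norm_triangle_ineq)
  also have "\<dots> \<le> vec_norm2 v + vec_norm2 w"
    unfolding vec_norm2_eq_L2_set using assms by (auto intro: L2_set_triangle_ineq)
  finally show ?thesis .
qed

lemma vec_norm2_smult: "vec_norm2 (c \<cdot>\<^sub>v v) = cmod c * vec_norm2 v"
  by (auto simp: vec_norm2_eq_L2_set L2_set_right_distrib norm_mult intro!: L2_set_cong)

lemma vec_norm2_eq_0: "v \<in> carrier_vec k \<Longrightarrow> vec_norm2 v = 0 \<longleftrightarrow> v = 0\<^sub>v k"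
  unfolding vec_norm2_eq_L2_set by (subst L2_set_eq_0_iff) (auto intro!: eq_vecI)

lemma vec_norm2_square: "of_real ((vec_norm2 v)\<^sup>2) = (\<Sum>i<dim_vec v. vec_index v i * cnj (vec_index v i))"
  by (simp add: vec_norm2_def sum_nonneg complex_norm_square del: of_real_power)

lemma vec_norm2_unitary:
  assumes U: "U \<in> carrier (unitary_group k)" and v: "v \<in> carrier_vec k"
  shows "vec_norm2 (U *\<^sub>v v) = vec_norm2 v"
proof -
  have Uc: "U \<in> carrier_mat k k" and UU: "mat_adjoint U * U = 1\<^sub>m k" using U by (simp_all add: unitary_group_def)
  have orth: "(\<Sum>i<k. cnj (U $$ (i, l)) * U $$ (i, j)) = (if l = j then 1 else 0)" if "l < k" "j < k" for l j
  proof -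
    have "(\<Sum>i<k. cnj (U $$ (i, l)) * U $$ (i, j)) = (mat_adjoint U * U) $$ (l, j)"
      using that Uc mat_adjoint_carrier[OF Uc]
      by (simp add: scalar_prod_def mat_adjoint_index lessThan_atLeast0)
    then show ?thesis using that by (simp add: UU)
  qed
  have ix: "vec_index (U *\<^sub>v v) i = (\<Sum>j<k. U $$ (i, j) * vec_index v j)" if "i < k" for i
    using that Uc v by (simp add: scalar_prod_def lessThan_atLeast0)
  have "of_real ((vec_norm2 (U *\<^sub>v v))\<^sup>2) =
      (\<Sum>i<k. \<Sum>j<k. \<Sum>l<k. (vec_index v j * cnj (vec_index v l)) * (cnj (U $$ (i, l)) * U $$ (i, j)))"
    unfolding vec_norm2_square using Uc
    by (auto simp: ix sum_product mult_ac simp del: index_mult_mat_vec intro!: sum.cong)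
  also have "\<dots> = (\<Sum>j<k. \<Sum>i<k. \<Sum>l<k. (vec_index v j * cnj (vec_index v l)) * (cnj (U $$ (i, l)) * U $$ (i, j)))"
    by (rule sum.swap)
  also have "\<dots> = (\<Sum>j<k. \<Sum>l<k. (vec_index v j * cnj (vec_index v l)) * (\<Sum>i<k. cnj (U $$ (i, l)) * U $$ (i, j)))"
    unfolding sum_distrib_left by (intro sum.cong refl sum.swap)
  also have "\<dots> = (\<Sum>j<k. \<Sum>l<k. if l = j then vec_index v j * cnj (vec_index v l) else 0)"
    by (intro sum.cong refl) (simp add: orth)
  also have "\<dots> = of_real ((vec_norm2 v)\<^sup>2)" unfolding vec_norm2_square using v by simp
  finally have "(vec_norm2 (U *\<^sub>v v))\<^sup>2 = (vec_norm2 v)\<^sup>2" by (simp only: of_real_eq_iff)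
  then show ?thesis by (simp add: power2_eq_iff_nonneg)
qed

text \<open>Estimates are carried out with this predicate, which composes without suprema;
  \<open>op_norm\<close> is met only when entering and leaving.\<close>

definition norm_le :: "nat \<Rightarrow> real \<Rightarrow> complex mat \<Rightarrow> bool" where
  "norm_le k e X \<longleftrightarrow> X \<in> carrier_mat k k \<and> (\<forall>v\<in>carrier_vec k. vec_norm2 (X *\<^sub>v v) \<le> e * vec_norm2 v)"

text \<open>The supremum in \<open>op_norm\<close> is meaningful only for a bounded set; the sum of
  the moduli of all entries is a crude bound.\<close>

lemma op_norm_bdd:
  assumes A: "A \<in> carrier_mat k l"
  shows "bdd_above {vec_norm2 (A *\<^sub>v v) | v. v \<in> carrier_vec (dim_col A) \<and> vec_norm2 v \<le> 1}"
proof (rule bdd_aboveI, clarify)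
  fix v :: "complex vec" assume v: "v \<in> carrier_vec (dim_col A)" "vec_norm2 v \<le> 1"
  have "cmod (vec_index v j) \<le> 1" if "j < l" for j
    using member_le_L2_set[of "{..<l}" j "\<lambda>i. cmod (vec_index v i)"] v A that
    by (simp add: vec_norm2_eq_L2_set)
  then have "cmod (vec_index (A *\<^sub>v v) i) \<le> (\<Sum>j<l. cmod (A $$ (i, j)))" if "i < k" for i
    using that A v
    by (auto simp: scalar_prod_def lessThan_atLeast0 norm_mult intro!: order_trans[OF norm_sum] sum_mono mult_left_le)
  then have "(\<Sum>i<k. cmod (vec_index (A *\<^sub>v v) i)) \<le> (\<Sum>i<k. \<Sum>j<l. cmod (A $$ (i, j)))" by (intro sum_mono) simp
  moreover have "vec_norm2 (A *\<^sub>v v) \<le> (\<Sum>i<k. cmod (vec_index (A *\<^sub>v v) i))"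
    unfolding vec_norm2_eq_L2_set using A L2_set_le_sum[of "{..<k}" "\<lambda>i. cmod (vec_index (A *\<^sub>v v) i)"] by simp
  ultimately show "vec_norm2 (A *\<^sub>v v) \<le> (\<Sum>i<k. \<Sum>j<l. cmod (A $$ (i, j)))" by simp
qed

lemma op_norm_nonneg: assumes A: "A \<in> carrier_mat k l" shows "0 \<le> op_norm A"
proof -
  have "vec_norm2 (A *\<^sub>v 0\<^sub>v l) \<le> op_norm A"
    unfolding op_norm_def
    by (rule cSup_upper[OF _ op_norm_bdd[OF A]]) (use A vec_norm2_eq_0[of "0\<^sub>v l" l] in auto)
  then show ?thesis using vec_norm2_nonneg order_trans by blast
qed

lemma norm_le_op_norm:
  assumes A: "A \<in> carrier_mat k k" shows "norm_le k (op_norm A) A"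
  unfolding norm_le_def
proof (intro conjI ballI A)
  fix v :: "complex vec" assume v: "v \<in> carrier_vec k"
  show "vec_norm2 (A *\<^sub>v v) \<le> op_norm A * vec_norm2 v"
  proof (cases "vec_norm2 v = 0")
    case True
    then have "A *\<^sub>v v = 0\<^sub>v k" using v A vec_norm2_eq_0[OF v] by auto
    then show ?thesis using True vec_norm2_eq_0[of "0\<^sub>v k" k] by simp
  next
    case False
    define w where "w = of_real (1 / vec_norm2 v) \<cdot>\<^sub>v v"
    have c: "cmod (complex_of_real (1 / vec_norm2 v)) = 1 / vec_norm2 v" by (simp add: norm_divide)
    have w: "w \<in> carrier_vec k" "vec_norm2 w = 1" using v False by (simp_all add: w_def vec_norm2_smult norm_divide)
    have "vec_norm2 (A *\<^sub>v w) \<le> op_norm A"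
      unfolding op_norm_def by (rule cSup_upper[OF _ op_norm_bdd[OF A]]) (use A w in auto)
    moreover have "A *\<^sub>v w = of_real (1 / vec_norm2 v) \<cdot>\<^sub>v (A *\<^sub>v v)"
      unfolding w_def using A v by (rule mult_mat_vec)
    ultimately have "1 / vec_norm2 v * vec_norm2 (A *\<^sub>v v) \<le> op_norm A" by (simp only: vec_norm2_smult c)
    then show ?thesis using False vec_norm2_nonneg[of v] by (simp add: field_simps)
  qed
qed

lemma op_norm_le: assumes "norm_le k e A" "0 \<le> e" shows "op_norm A \<le> e"
  unfolding op_norm_def
proof (rule cSup_least)
  have A: "A \<in> carrier_mat k k" using assms by (simp add: norm_le_def)
  show "{vec_norm2 (A *\<^sub>v v) | v. v \<in> carrier_vec (dim_col A) \<and> vec_norm2 v \<le> 1} \<noteq> {}"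
    using A vec_norm2_eq_0[of "0\<^sub>v k" k] by (auto intro!: exI[of _ "0\<^sub>v k"])
  fix r assume "r \<in> {vec_norm2 (A *\<^sub>v v) | v. v \<in> carrier_vec (dim_col A) \<and> vec_norm2 v \<le> 1}"
  then obtain v where v: "r = vec_norm2 (A *\<^sub>v v)" "v \<in> carrier_vec k" "vec_norm2 v \<le> 1" using A by auto
  have "r \<le> e * vec_norm2 v" using assms v by (simp add: norm_le_def)
  also have "\<dots> \<le> e" using assms(2) v(3) by (simp add: mult_left_le)
  finally show "r \<le> e" .
qed

lemma norm_le_mono: "norm_le k e X \<Longrightarrow> e \<le> f \<Longrightarrow> norm_le k f X"
  unfolding norm_le_def using mult_right_mono[OF _ vec_norm2_nonneg] order_trans by blast

lemma norm_le_add: "norm_le k e X \<Longrightarrow> norm_le k f Y \<Longrightarrow> norm_le k (e + f) (X + Y)"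
  unfolding norm_le_def
proof (intro conjI ballI)
  assume X: "X \<in> carrier_mat k k \<and> (\<forall>v\<in>carrier_vec k. vec_norm2 (X *\<^sub>v v) \<le> e * vec_norm2 v)"
    and Y: "Y \<in> carrier_mat k k \<and> (\<forall>v\<in>carrier_vec k. vec_norm2 (Y *\<^sub>v v) \<le> f * vec_norm2 v)"
  show "X + Y \<in> carrier_mat k k" using X Y by simp
  fix v :: "complex vec" assume v: "v \<in> carrier_vec k"
  have "vec_norm2 ((X + Y) *\<^sub>v v) \<le> vec_norm2 (X *\<^sub>v v) + vec_norm2 (Y *\<^sub>v v)"
    using X Y v by (subst add_mult_distrib_mat_vec[of _ k k]) (auto intro!: vec_norm2_triangle[of _ k])
  also have "\<dots> \<le> e * vec_norm2 v + f * vec_norm2 v" using X Y v by (intro add_mono) auto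
  finally show "vec_norm2 ((X + Y) *\<^sub>v v) \<le> (e + f) * vec_norm2 v" by (simp add: algebra_simps)
qed

lemma norm_le_mult:
  assumes X: "norm_le k e X" and Y: "norm_le k f Y" and e: "0 \<le> e" shows "norm_le k (e * f) (X * Y)"
  unfolding norm_le_def
proof (intro conjI ballI)
  show "X * Y \<in> carrier_mat k k" using X Y unfolding norm_le_def by (auto intro: mult_carrier_mat)
  fix v :: "complex vec" assume v: "v \<in> carrier_vec k"
  have Yv: "Y *\<^sub>v v \<in> carrier_vec k" using Y v by (auto simp: norm_le_def)
  have "vec_norm2 ((X * Y) *\<^sub>v v) = vec_norm2 (X *\<^sub>v (Y *\<^sub>v v))"
    using X Y v by (simp add: norm_le_def assoc_mult_mat_vec[of _ k k _ k])
  also have "\<dots> \<le> e * vec_norm2 (Y *\<^sub>v v)" using X Yv by (simp add: norm_le_def)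
  also have "\<dots> \<le> e * (f * vec_norm2 v)" using Y v e by (intro mult_left_mono) (auto simp: norm_le_def)
  finally show "vec_norm2 ((X * Y) *\<^sub>v v) \<le> (e * f) * vec_norm2 v" by (simp add: mult.assoc)
qed

lemma norm_le_smult: "norm_le k e X \<Longrightarrow> norm_le k (cmod c * e) (c \<cdot>\<^sub>m X)"
  unfolding norm_le_def by (auto simp: smult_mat_vec vec_norm2_smult mult.assoc intro!: mult_left_mono)

lemma norm_le_unitary: "U \<in> carrier (unitary_group k) \<Longrightarrow> norm_le k 1 U"
  using vec_norm2_unitary[of U k] by (simp add: norm_le_def unitary_group_def)

text \<open>A kernel vector v of 1 + X satisfies X v = -v, which a norm bound below 1
  forbids.\<close>

lemma norm_le_det_nonzero:
  assumes X: "norm_le k e X" and e: "e < 1" shows "det (1\<^sub>m k + X) \<noteq> 0"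
proof
  have Xc: "X \<in> carrier_mat k k" using X by (simp add: norm_le_def)
  assume "det (1\<^sub>m k + X) = 0"
  then obtain v where v: "v \<in> carrier_vec k" "v \<noteq> 0\<^sub>v k" "(1\<^sub>m k + X) *\<^sub>v v = 0\<^sub>v k"
    using det_0_iff_vec_prod_zero_field[of "1\<^sub>m k + X" k] Xc by auto
  have "v + X *\<^sub>v v = 0\<^sub>v k"
    using v Xc add_mult_distrib_mat_vec[of "1\<^sub>m k" k k X v] by simp
  then have "vec_index v i + vec_index (X *\<^sub>v v) i = 0" if "i < k" for i
    using arg_cong[of _ _ "\<lambda>u. vec_index u i"] that v(1) Xc
    by (metis index_add_vec(1) index_zero_vec(1) dim_mult_mat_vec carrier_matD(1))
  then have "X *\<^sub>v v = (-1) \<cdot>\<^sub>v v"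
    using v(1) Xc by (intro eq_vecI) (auto simp: add_eq_0_iff simp del: index_mult_mat_vec)
  then have "vec_norm2 v \<le> e * vec_norm2 v"
    using X v(1) unfolding norm_le_def by (metis vec_norm2_smult norm_minus_cancel norm_one mult_1)
  moreover have "vec_norm2 v > 0" using v vec_norm2_eq_0[OF v(1)] vec_norm2_nonneg[of v] by linarith
  ultimately show False using e by simp
qed

section \<open>Continuous logarithms of determinants\<close>

lemma continuous_on_det:
  fixes F :: "'t::topological_space \<Rightarrow> complex mat"
  assumes "\<And>t. F t \<in> carrier_mat k k"
    and "\<And>i j. i < k \<Longrightarrow> j < k \<Longrightarrow> continuous_on S (\<lambda>t. F t $$ (i, j))"
  shows "continuous_on S (\<lambda>t. det (F t))"
proof -
  have "det (F t) = (\<Sum>p\<in>{p. p permutes {0..<k}}. signof p * (\<Prod>i = 0..<k. F t $$ (i, p i)))" for t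
    by (rule det_def'[OF assms(1)])
  moreover have "continuous_on S (\<lambda>t. \<Sum>p\<in>{p. p permutes {0..<k}}. signof p * (\<Prod>i = 0..<k. F t $$ (i, p i)))"
  proof (intro continuous_on_sum continuous_on_mult continuous_on_const continuous_on_prod)
    fix p i assume "p \<in> {p. p permutes {0..<k}}" "i \<in> {0..<k}"
    then show "continuous_on S (\<lambda>t. F t $$ (i, p i))"
      using permutes_in_image[of p "{0..<k}" i] by (intro assms(2)) auto
  qed
  ultimately show ?thesis by simp
qed

text \<open>The difference of the two lifts takes values in the discrete set of multiples of 2 pi i,
  so it is constant on the interval.\<close>

lemma exp_lift_unique:
  fixes g h :: "real \<Rightarrow> complex"
  assumes "continuous_on {0..1} g" "continuous_on {0..1} h"
    "\<And>r. r \<in> {0..1} \<Longrightarrow> exp (g r) = exp (h r)" "g 0 = h 0"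
  shows "g 1 = h 1"
proof -
  have "(\<lambda>r. g r - h r) constant_on {0..1}"
  proof (rule continuous_discrete_range_constant)
    show "\<exists>e>0. \<forall>y. y \<in> {0..1} \<and> g y - h y \<noteq> g x - h x \<longrightarrow> e \<le> norm (g y - h y - (g x - h x))"
      if x: "x \<in> {0..1}" for x
    proof (intro exI[of _ 1] conjI allI impI)
      fix y assume y: "y \<in> {0..1} \<and> g y - h y \<noteq> g x - h x"
      show "1 \<le> norm (g y - h y - (g x - h x))"
      proof (rule ccontr)
        assume "\<not> 1 \<le> norm (g y - h y - (g x - h x))"
        then have "\<bar>Im (g y - h y) - Im (g x - h x)\<bar> < 2 * pi"
          using abs_Im_le_cmod[of "g y - h y - (g x - h x)"] pi_gt3 by simp
        moreover have "exp (g y - h y) = exp (g x - h x)"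
          using assms(3)[of x] assms(3)[of y] x y by (simp add: exp_diff)
        ultimately show False using exp_complex_eqI y by blast
      qed
    qed simp
  qed (use assms in \<open>auto intro: continuous_on_diff\<close>)
  then obtain c where "\<forall>r\<in>{0..1}. g r - h r = c" by (auto simp: constant_on_def)
  then have "g 0 - h 0 = c" "g 1 - h 1 = c" by simp_all
  then show ?thesis using assms(4) by simp
qed

text \<open>The value of log det (1 + X) obtained by following the segment from 1 to 1 + X, which
  need not be the principal one. It is a relation because existence requires the determinant not to
  vanish along the segment.\<close>

definition logdet :: "nat \<Rightarrow> complex mat \<Rightarrow> complex \<Rightarrow> bool" where
  "logdet k X l \<longleftrightarrow> (\<exists>g::real \<Rightarrow> complex. continuous_on {0..1} g \<and> g 0 = 0 \<and> g 1 = l \<and>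
     (\<forall>r\<in>{0..1}. exp (g r) = det (1\<^sub>m k + of_real r \<cdot>\<^sub>m X)))"

lemma one_add_zero_smult: "X \<in> carrier_mat k k \<Longrightarrow> 1\<^sub>m k + 0 \<cdot>\<^sub>m X = (1\<^sub>m k :: complex mat)"
  by (intro eq_matI) auto

lemma logdet_exists:
  assumes X: "norm_le k e X" and e: "e < 1" shows "\<exists>l. logdet k X l"
proof -
  have Xc: "X \<in> carrier_mat k k" using X by (simp add: norm_le_def)
  have cont: "continuous_on {0..1} (\<lambda>r::real. det (1\<^sub>m k + of_real r \<cdot>\<^sub>m X))"
    by (rule continuous_on_det[of _ k]) (use Xc in \<open>auto intro!: continuous_intros\<close>)
  have nz: "det (1\<^sub>m k + of_real r \<cdot>\<^sub>m X) \<noteq> 0" if "r \<in> {0..1}" for r :: real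
  proof -
    have "norm_le k (r * e) (of_real r \<cdot>\<^sub>m X)" using norm_le_smult[OF X, of "of_real r"] that by simp
    moreover have "r * e < 1"
      using that e by (cases "e \<le> 0") (auto intro: le_less_trans[OF mult_nonneg_nonpos] le_less_trans[OF mult_left_le_one_le])
    ultimately show ?thesis by (rule norm_le_det_nonzero)
  qed
  obtain g where g: "continuous_on {0..1} g" "\<And>r. r \<in> {0..1} \<Longrightarrow> det (1\<^sub>m k + of_real r \<cdot>\<^sub>m X) = exp (g r)"
    by (rule continuous_logarithm_on_contractible[OF cont convex_imp_contractible nz]) auto
  have "exp (g 0) = 1" using g(2)[of 0] one_add_zero_smult[OF Xc] by simp
  then have "continuous_on {0..1} (\<lambda>r. g r - g 0) \<and> g 0 - g 0 = 0 \<and> g 1 - g 0 = g 1 - g 0 \<and>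
     (\<forall>r\<in>{0..1}. exp (g r - g 0) = det (1\<^sub>m k + of_real r \<cdot>\<^sub>m X))"
    using g by (auto simp: exp_diff intro!: continuous_intros)
  then show ?thesis unfolding logdet_def by blast
qed

text \<open>The logarithm of \<open>det (1 + r ((1 + s X) (1 + s Y) - 1))\<close> over the square \<open>(r, s)\<close> compares the two sides.\<close>
lemma logdet_mult:
  assumes X: "norm_le k (1/4) X" and Y: "norm_le k (1/4) Y"
    and a: "logdet k X a" and b: "logdet k Y b" and c: "logdet k (X + Y + X * Y) c"
  shows "c = a + b"
proof -
  have Xc: "X \<in> carrier_mat k k" and Yc: "Y \<in> carrier_mat k k" using X Y by (simp_all add: norm_le_def)
  define W where "W = (\<lambda>s::real. of_real s \<cdot>\<^sub>m X + of_real s \<cdot>\<^sub>m Y + of_real (s * s) \<cdot>\<^sub>m (X * Y))"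
  have Wc: "W s \<in> carrier_mat k k" for s using Xc Yc by (simp add: W_def)
  define F where "F = (\<lambda>(r::real, s). det (1\<^sub>m k + of_real r \<cdot>\<^sub>m W s))"
  let ?S = "{0..1} \<times> {0..1} :: (real \<times> real) set"
  have cont: "continuous_on ?S F"
    unfolding F_def split_beta
    by (rule continuous_on_det[of _ k]) (use Wc Xc Yc in \<open>auto simp: W_def intro!: continuous_intros\<close>)
  have nz: "F z \<noteq> 0" if z: "z \<in> ?S" for z
  proof -
    obtain r s where rs: "z = (r, s)" "0 \<le> r" "r \<le> 1" "0 \<le> s" "s \<le> 1" using z by auto
    have "norm_le k (s * (1/4) + s * (1/4) + (s * s) * (1/4 * (1/4))) (W s)"
      unfolding W_def
      using norm_le_add[OF norm_le_add[OF norm_le_smult[OF X, of "of_real s"] norm_le_smult[OF Y, of "of_real s"]]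
        norm_le_smult[OF norm_le_mult[OF X Y], of "of_real (s * s)"]] rs by (simp add: norm_mult)
    \<comment> \<open>The bound is at most 1/4 + 1/4 + 1/16 = 9/16; any constant below 1 would
      do.\<close>
    then have "norm_le k (3/4) (W s)"
    proof (rule norm_le_mono)
      have "s * s \<le> 1" using rs by (simp add: mult_le_one)
      then show "s * (1/4) + s * (1/4) + (s * s) * (1/4 * (1/4)) \<le> 3/4" using rs by simp
    qed
    then have "norm_le k (r * (3/4)) (of_real r \<cdot>\<^sub>m W s)" using norm_le_smult[of k "3/4" "W s" "of_real r"] rs by simp
    moreover have "r * (3/4) < 1" using rs by simp
    ultimately show ?thesis unfolding rs F_def by (simp add: norm_le_det_nonzero)
  qed
  have "contractible ?S" by (intro convex_imp_contractible convex_Times) auto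
  then obtain G where G: "continuous_on ?S G" "\<And>z. z \<in> ?S \<Longrightarrow> F z = exp (G z)"
    using continuous_logarithm_on_contractible[OF cont _ nz] by metis
  have Gr: "continuous_on {0..1} (\<lambda>r. G (r, s))" if "s \<in> {0..1}" for s
    by (rule continuous_on_compose2[OF G(1), of _ "\<lambda>r. (r, s)"]) (use that in \<open>auto intro!: continuous_intros\<close>)
  have Gs: "continuous_on {0..1} (\<lambda>s. G (r, s))" if "r \<in> {0..1}" for r
    by (rule continuous_on_compose2[OF G(1), of _ "\<lambda>s. (r, s)"]) (use that in \<open>auto intro!: continuous_intros\<close>)
  \<comment> \<open>\<open>F\<close> equals 1 on the edges r = 0 and s = 0, so \<open>G\<close> is
    constant there. The edge s = 1 then computes \<open>c\<close>, and the edge r = 1, where the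
    matrix factors as (1 + s X)(1 + s Y), computes \<open>a + b\<close>; they share their endpoint
    (1, 1).\<close>
  have F0s: "F (0, s) = 1" for s using one_add_zero_smult[OF Wc[of s]] by (simp add: F_def)
  have "W 0 = 0\<^sub>m k k" unfolding W_def using Xc Yc by (intro eq_matI) auto
  then have Fr0: "F (r, 0) = 1" for r by (simp add: F_def)
  have e1: "exp (G (0, s)) = 1" "exp (G (s, 0)) = 1" if "s \<in> {0..1}" for s
    using G(2)[of "(0, s)"] G(2)[of "(s, 0)"] that F0s Fr0 by simp_all
  have 1: "G (0, 1) = G (0, 0)"
    using exp_lift_unique[OF Gs[of 0] continuous_on_const[of _ "G (0, 0)"]] e1 by auto
  have 2: "G (1, 0) = G (0, 0)"
    using exp_lift_unique[OF Gr[of 0] continuous_on_const[of _ "G (0, 0)"]] e1 by auto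
  obtain gX where gX: "continuous_on {0..1} gX" "gX 0 = 0" "gX 1 = a"
    "\<forall>r\<in>{0..1}. exp (gX r) = det (1\<^sub>m k + of_real r \<cdot>\<^sub>m X)" using a by (auto simp: logdet_def)
  obtain gY where gY: "continuous_on {0..1} gY" "gY 0 = 0" "gY 1 = b"
    "\<forall>r\<in>{0..1}. exp (gY r) = det (1\<^sub>m k + of_real r \<cdot>\<^sub>m Y)" using b by (auto simp: logdet_def)
  obtain gZ where gZ: "continuous_on {0..1} gZ" "gZ 0 = 0" "gZ 1 = c"
    "\<forall>r\<in>{0..1}. exp (gZ r) = det (1\<^sub>m k + of_real r \<cdot>\<^sub>m (X + Y + X * Y))" using c by (auto simp: logdet_def)
  have "W 1 = X + Y + X * Y" unfolding W_def using Xc Yc by (intro eq_matI) auto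
  then have "exp (G (r, 1) - G (0, 1)) = exp (gZ r)" if "r \<in> {0..1}" for r
    using that gZ(4) G(2)[of "(r, 1)"] e1(1)[of 1] by (simp add: exp_diff F_def)
  then have c: "G (1, 1) - G (0, 1) = c"
    using exp_lift_unique[OF continuous_on_diff[OF Gr[of 1] continuous_on_const[of _ "G (0, 1)"]] gZ(1)] gZ(2,3) by simp
  have fac: "1\<^sub>m k + of_real 1 \<cdot>\<^sub>m W s = (1\<^sub>m k + of_real s \<cdot>\<^sub>m X) * (1\<^sub>m k + of_real s \<cdot>\<^sub>m Y)" for s :: real
  proof -
    have "(1\<^sub>m k + of_real s \<cdot>\<^sub>m X) * (1\<^sub>m k + of_real s \<cdot>\<^sub>m Y) =
        (1\<^sub>m k + of_real s \<cdot>\<^sub>m X) * 1\<^sub>m k + (1\<^sub>m k + of_real s \<cdot>\<^sub>m X) * (of_real s \<cdot>\<^sub>m Y)"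
      using Xc Yc by (intro mult_add_distrib_mat[of _ k k _ k]) auto
    also have "(1\<^sub>m k + of_real s \<cdot>\<^sub>m X) * (of_real s \<cdot>\<^sub>m Y) =
        1\<^sub>m k * (of_real s \<cdot>\<^sub>m Y) + (of_real s \<cdot>\<^sub>m X) * (of_real s \<cdot>\<^sub>m Y)"
      using Xc Yc by (intro add_mult_distrib_mat[of _ k k _ _ k]) auto
    also have "(of_real s \<cdot>\<^sub>m X) * (of_real s \<cdot>\<^sub>m Y) = (of_real (s * s) \<cdot>\<^sub>m (X * Y) :: complex mat)"
      using Xc Yc by (simp add: mult_smult_assoc_mat[of X k k "of_real s \<cdot>\<^sub>m Y" k]
        mult_smult_distrib[of X k k Y k]) (intro eq_matI, auto)
    finally show ?thesis using Xc Yc unfolding W_def by (simp add: right_mult_one_mat[of _ k k]) (intro eq_matI, auto)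
  qed
  have "exp (G (1, s) - G (1, 0)) = exp (gX s + gY s)" if "s \<in> {0..1}" for s
  proof -
    have "exp (G (1, s)) = det ((1\<^sub>m k + of_real s \<cdot>\<^sub>m X) * (1\<^sub>m k + of_real s \<cdot>\<^sub>m Y))"
      using that G(2)[of "(1, s)"] fac[of s] by (simp add: F_def)
    also have "\<dots> = exp (gX s) * exp (gY s)" using that gX(4) gY(4) Xc Yc by (simp add: det_mult[of _ k])
    finally show ?thesis using e1(2)[of 1] by (simp add: exp_diff exp_add)
  qed
  then have "G (1, 1) - G (1, 0) = a + b"
    using exp_lift_unique[OF continuous_on_diff[OF Gs[of 1] continuous_on_const[of _ "G (1, 0)"]]
      continuous_on_add[OF gX(1) gY(1)]] gX(2,3) gY(2,3) by simp
  then show ?thesis using 1 2 c by simp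
qed

lemma logdet_conj:
  assumes P: "P \<in> carrier_mat k k" "Q \<in> carrier_mat k k" "P * Q = 1\<^sub>m k"
    and X: "X \<in> carrier_mat k k" and l: "logdet k X l"
  shows "logdet k (P * X * Q) l"
proof -
  have dPQ: "det P * det Q = 1" using det_mult[OF P(1,2)] P(3) by simp
  have "det (1\<^sub>m k + c \<cdot>\<^sub>m (P * X * Q)) = det (1\<^sub>m k + c \<cdot>\<^sub>m X)" for c
  proof -
    have "P * (1\<^sub>m k + c \<cdot>\<^sub>m X) * Q = (P * 1\<^sub>m k + P * (c \<cdot>\<^sub>m X)) * Q"
      using P X by (subst mult_add_distrib_mat[of P k k]) auto
    also have "\<dots> = P * 1\<^sub>m k * Q + P * (c \<cdot>\<^sub>m X) * Q"
      using P X by (subst add_mult_distrib_mat[of _ k k]) auto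
    also have "P * (c \<cdot>\<^sub>m X) = c \<cdot>\<^sub>m (P * X)" using P X by (subst mult_smult_distrib[of P k k]) auto
    also have "c \<cdot>\<^sub>m (P * X) * Q = c \<cdot>\<^sub>m (P * X * Q)" using P X by (subst mult_smult_assoc_mat[of _ k k]) auto
    finally have "P * (1\<^sub>m k + c \<cdot>\<^sub>m X) * Q = 1\<^sub>m k + c \<cdot>\<^sub>m (P * X * Q)" using P by (simp add: right_mult_one_mat[of P k k])
    then have "det (1\<^sub>m k + c \<cdot>\<^sub>m (P * X * Q)) = det P * det (1\<^sub>m k + c \<cdot>\<^sub>m X) * det Q"
      using P X by (metis det_mult mult_carrier_mat add_carrier_mat smult_carrier_mat)
    then show ?thesis using dPQ by (simp add: mult.commute mult.left_commute)
  qed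
  then show ?thesis using l by (simp add: logdet_def)
qed

text \<open>For a scalar matrix the segment stays in the right half-plane, so the principal
  logarithm is continuous along it. The bound on the angle identifies its value at the end.\<close>

lemma logdet_root_exp:
  assumes n: "n > 0" and small: "cmod (root_exp n t - 1) < 1" and pi: "\<bar>2 * pi / n * t\<bar> < pi"
  shows "logdet k ((root_exp n t - 1) \<cdot>\<^sub>m 1\<^sub>m k) (of_nat k * (2 * of_real pi * \<i> / of_nat n * of_int t))"
  unfolding logdet_def
proof (intro exI conjI ballI)
  let ?c = "root_exp n t - 1"
  define g where "g = (\<lambda>r::real. of_nat k * Ln (1 + of_real r * ?c))"
  have pos: "1 + of_real r * ?c \<notin> \<real>\<^sub>\<le>\<^sub>0" if "r \<in> {0..1}" for r
  proof -
    have "cmod (of_real r * ?c) \<le> cmod ?c" using that by (simp add: norm_mult mult_left_le_one_le)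
    then have "\<bar>Re (of_real r * ?c)\<bar> < 1" using small abs_Re_le_cmod[of "of_real r * ?c"] by linarith
    then have "Re (1 + of_real r * ?c) > 0" by simp
    then show ?thesis by (auto simp: complex_nonpos_Reals_iff)
  qed
  show "continuous_on {0..1} g"
    unfolding g_def using pos by (intro continuous_intros) auto
  show "g 0 = 0" by (simp add: g_def)
  have "Im (2 * of_real pi * \<i> / of_nat n * of_int t) = 2 * pi / n * t" by simp
  then have "Ln (root_exp n t) = 2 * of_real pi * \<i> / of_nat n * of_int t"
    unfolding root_exp_def using pi by (intro Ln_exp) (simp_all only: abs_less_iff, linarith+)
  then show "g 1 = of_nat k * (2 * of_real pi * \<i> / of_nat n * of_int t)" by (simp add: g_def)
  fix r :: real assume r: "r \<in> {0..1}"
  have "1 + of_real r * ?c \<noteq> 0" using pos[OF r] by auto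
  then have "exp (g r) = (1 + of_real r * ?c) ^ k" by (simp add: g_def exp_of_nat_mult)
  also have "\<dots> = det ((1 + of_real r * ?c) \<cdot>\<^sub>m 1\<^sub>m k)" by simp
  also have "(1 + of_real r * ?c) \<cdot>\<^sub>m 1\<^sub>m k = 1\<^sub>m k + of_real r \<cdot>\<^sub>m (?c \<cdot>\<^sub>m 1\<^sub>m k)"
    by (intro eq_matI) auto
  finally show "exp (g r) = det (1\<^sub>m k + of_real r \<cdot>\<^sub>m (?c \<cdot>\<^sub>m 1\<^sub>m k))" .
qed

section \<open>Separation of the extension\<close>

lemma (in group) finite_index_kernel:
  assumes H: "monoid H" and f: "f \<in> hom G H" and fin: "finite (f ` carrier G)"
    and one: "f \<one> = \<one>\<^bsub>H\<^esub>"
  shows "finite_index_subgroup G {x \<in> carrier G. f x = \<one>\<^bsub>H\<^esub>}"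
proof -
  interpret H: monoid H by fact
  let ?K = "{x \<in> carrier G. f x = \<one>\<^bsub>H\<^esub>}"
  have mult: "f (x \<otimes> y) = f x \<otimes>\<^bsub>H\<^esub> f y" if "x \<in> carrier G" "y \<in> carrier G" for x y
    using f that by (simp add: hom_def)
  have cl: "f x \<in> carrier H" if "x \<in> carrier G" for x using f that by (auto simp: hom_def)
  have inv1: "f (inv x) = \<one>\<^bsub>H\<^esub>" if "x \<in> carrier G" "f x = \<one>\<^bsub>H\<^esub>" for x
    using mult[of "inv x" x] that one cl[of "inv x"] by simp
  have sg: "subgroup ?K G"
  proof
    show "x \<otimes> y \<in> ?K" if "x \<in> ?K" "y \<in> ?K" for x y using that by (simp add: mult)
    show "inv x \<in> ?K" if "x \<in> ?K" for x using that inv1 by simp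
  qed (use one in auto)
  have coset: "?K #> x = {y \<in> carrier G. f y = f x}" if x: "x \<in> carrier G" for x
  proof (intro equalityI subsetI)
    fix y assume "y \<in> ?K #> x"
    then obtain z where "z \<in> ?K" "y = z \<otimes> x" by (auto simp: r_coset_def)
    then show "y \<in> {y \<in> carrier G. f y = f x}" using x cl[OF x] by (simp add: mult)
  next
    fix y assume y: "y \<in> {y \<in> carrier G. f y = f x}"
    then have "f (y \<otimes> inv x) = f y \<otimes>\<^bsub>H\<^esub> f (inv x)" using x by (intro mult) simp_all
    also have "\<dots> = f x \<otimes>\<^bsub>H\<^esub> f (inv x)" using y by simp
    also have "\<dots> = f (x \<otimes> inv x)" using x by (intro mult[symmetric]) simp_all
    finally have "y \<otimes> inv x \<in> ?K" using x y one by simp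
    moreover have "y = (y \<otimes> inv x) \<otimes> x" using x y by (simp add: m_assoc)
    then have "y \<in> {(y \<otimes> inv x) \<otimes> x}" by (simp only: singleton_iff)
    ultimately show "y \<in> ?K #> x" unfolding r_coset_def by (rule UN_I)
  qed
  have "rcosets ?K \<subseteq> (\<lambda>a. {y \<in> carrier G. f y = a}) ` (f ` carrier G)"
    using coset by (auto simp: RCOSETS_def)
  then have "finite (rcosets ?K)" using fin finite_surj by blast
  then show ?thesis using sg by (simp add: finite_index_subgroup_def)
qed

lemma unitary_group_monoid: "monoid (unitary_group k)"
proof (rule monoidI)
  fix A B assume AB: "A \<in> carrier (unitary_group k)" "B \<in> carrier (unitary_group k)"
  define A' B' where "A' = mat_adjoint A" and "B' = mat_adjoint B"
  have c: "A \<in> carrier_mat k k" "B \<in> carrier_mat k k" "A' \<in> carrier_mat k k" "B' \<in> carrier_mat k k"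
    using AB mat_adjoint_carrier by (auto simp: unitary_group_def A'_def B'_def)
  have adj: "mat_adjoint (A * B) = B' * A'"
    using c mat_adjoint_carrier[OF mult_carrier_mat[OF c(1,2)]] by (intro eq_matI)
      (auto simp: mat_adjoint_index A'_def B'_def scalar_prod_def mult.commute intro!: sum.cong)
  have "(B' * A') * (A * B) = B' * (A' * A) * B"
    using c by (simp add: assoc_mult_mat[of _ k k _ k _ k])
  then have 1: "(B' * A') * (A * B) = 1\<^sub>m k"
    using AB c by (simp add: unitary_group_def A'_def[symmetric] B'_def[symmetric])
  have "(A * B) * (B' * A') = 1\<^sub>m k"
    by (rule mat_mult_left_right_inverse[OF _ _ 1]) (use c in auto)
  then show "A \<otimes>\<^bsub>unitary_group k\<^esub> B \<in> carrier (unitary_group k)"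
    using 1 c by (simp add: unitary_group_def adj)
next
  show "\<one>\<^bsub>unitary_group k\<^esub> \<in> carrier (unitary_group k)"
  proof -
    have "mat_adjoint (1\<^sub>m k) = (1\<^sub>m k :: complex mat)"
      using mat_adjoint_carrier[OF one_carrier_mat, of k] by (intro eq_matI) (auto simp: mat_adjoint_index)
    then show ?thesis by (simp add: unitary_group_def)
  qed
qed (auto simp: unitary_group_def assoc_mult_mat[of _ k k _ k _ k])

context poly_cocycle
begin

abbreviation "adm_seq \<equiv> enumerate (admissible_indices m \<eta> s)"

lemma adm_seq: "adm_seq j \<in> admissible_indices m \<eta> s" "j \<le> adm_seq j" "adm_seq j > 0"
proof -
  show "adm_seq j \<in> admissible_indices m \<eta> s" by (rule enumerate_in_set[OF infinite_admissible_indices])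
  then show "adm_seq j > 0" by (simp add: admissible_indices_def)
  show "j \<le> adm_seq j" by (rule le_enumerate[OF infinite_admissible_indices])
qed

text \<open>\<open>\<iota> z \<theta> g \<mapsto> exp (2 \<pi> i (z - f g) / n) \<rho>\<^sub>n(g)\<close> is a homomorphism with finite image,
  \<open>f\<close> being a cochain whose coboundary is the difference of the two cocycles.\<close>
lemma extension_hom:
  fixes E :: "('e, 'f) monoid_scheme"
  assumes E: "central_extension (tuple_group m \<eta>) E \<iota> \<pi>"
    and th: "extension_section (tuple_group m \<eta>) E \<pi> \<theta>"
    and cls: "cohomology_class (tuple_group m \<eta>) (extension_cocycle (tuple_group m \<eta>) E \<iota> \<theta>) =
      cohomology_class (tuple_group m \<eta>) (poly_cochain m s)"
    and n: "n \<in> admissible_indices m \<eta> s"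
  shows "\<exists>\<Phi>. \<Phi> \<in> hom E (unitary_group (n ^ m)) \<and> finite (\<Phi> ` carrier E) \<and>
    (\<forall>z. \<Phi> (\<iota> z) = root_exp n z \<cdot>\<^sub>m 1\<^sub>m (n ^ m))"
proof -
  let ?G = "tuple_group m \<eta>" and ?K = "n ^ m"
  have ext: "group E" "\<iota> \<in> hom integer_group E" "inj \<iota>" "\<pi> \<in> hom E ?G" "kernel E ?G \<pi> = range \<iota>"
    "\<And>z x. x \<in> carrier E \<Longrightarrow> \<iota> z \<otimes>\<^bsub>E\<^esub> x = x \<otimes>\<^bsub>E\<^esub> \<iota> z"
    using E by (simp_all add: central_extension_def)
  interpret E: group E by (rule ext)
  have np: "n > 0" by (rule n_pos[OF n])
  have iot: "\<iota> z \<in> carrier E" "\<iota> (z + w) = \<iota> z \<otimes>\<^bsub>E\<^esub> \<iota> w" for z w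
    using ext(2) by (auto simp: hom_def integer_group_def)
  have io0: "\<iota> 0 = \<one>\<^bsub>E\<^esub>" using iot(2)[of 0 0] E.l_cancel_one'[of "\<iota> 0" "\<iota> 0"] iot(1)[of 0] by simp
  have pi: "\<pi> x \<in> int_tuples m" if "x \<in> carrier E" for x
    using ext(4) that by (auto simp: hom_def carrier_tuple_group)
  have pim: "\<pi> (x \<otimes>\<^bsub>E\<^esub> y) = tuple_mult m \<eta> (\<pi> x) (\<pi> y)" if "x \<in> carrier E" "y \<in> carrier E" for x y
    using ext(4) that by (simp add: hom_def mult_tuple_group)
  have tht: "\<theta> g \<in> carrier E" "\<pi> (\<theta> g) = g" if "g \<in> int_tuples m" for g
    using th that by (auto simp: extension_section_def carrier_tuple_group)
  have ex: "\<exists>z. x = \<iota> z \<otimes>\<^bsub>E\<^esub> \<theta> g" if x: "x \<in> carrier E" "\<pi> x = g" "g \<in> int_tuples m" for x g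
  proof -
    interpret pi: group_hom E ?G \<pi> using ext by unfold_locales (auto simp: hom_def)
    have "\<pi> (x \<otimes>\<^bsub>E\<^esub> inv\<^bsub>E\<^esub> \<theta> g) = \<one>\<^bsub>?G\<^esub>"
      using x tht[OF x(3)] by (simp add: carrier_tuple_group)
    then have "x \<otimes>\<^bsub>E\<^esub> inv\<^bsub>E\<^esub> \<theta> g \<in> range \<iota>"
      using x tht[OF x(3)] unfolding ext(5)[symmetric] by (simp add: kernel_def)
    then obtain z where "x \<otimes>\<^bsub>E\<^esub> inv\<^bsub>E\<^esub> \<theta> g = \<iota> z" by blast
    then have "\<iota> z \<otimes>\<^bsub>E\<^esub> \<theta> g = x" using x tht[OF x(3)] by (metis E.inv_closed E.l_inv E.m_assoc E.r_one)
    then show ?thesis by metis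
  qed
  define e where "e = extension_cocycle ?G E \<iota> \<theta>"
  have e: "\<theta> g \<otimes>\<^bsub>E\<^esub> \<theta> h = \<iota> (e (g, h)) \<otimes>\<^bsub>E\<^esub> \<theta> (tuple_mult m \<eta> g h)"
    if gh: "g \<in> int_tuples m" "h \<in> int_tuples m" for g h
  proof -
    have gt: "tuple_mult m \<eta> g h \<in> int_tuples m" by (rule tuple_mult_closed)
    obtain z where z: "\<theta> g \<otimes>\<^bsub>E\<^esub> \<theta> h = \<iota> z \<otimes>\<^bsub>E\<^esub> \<theta> (tuple_mult m \<eta> g h)"
      using ex[of "\<theta> g \<otimes>\<^bsub>E\<^esub> \<theta> h" "tuple_mult m \<eta> g h"] gh tht pim gt by auto
    have iz: "\<iota> z = \<theta> g \<otimes>\<^bsub>E\<^esub> \<theta> h \<otimes>\<^bsub>E\<^esub> inv\<^bsub>E\<^esub> (\<theta> (tuple_mult m \<eta> g h))"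
      unfolding z using tht(1)[OF gt] iot(1)[of z] by (simp add: E.m_assoc)
    have "e (g, h) = (THE w. \<iota> w = \<theta> g \<otimes>\<^bsub>E\<^esub> \<theta> h \<otimes>\<^bsub>E\<^esub> inv\<^bsub>E\<^esub> (\<theta> (tuple_mult m \<eta> g h)))"
      unfolding e_def extension_cocycle_def carrier_tuple_group mult_tuple_group using gh by simp
    also have "\<dots> = z" unfolding iz[symmetric] inj_eq[OF ext(3)] by (rule the_eq_trivial)
    finally have "e (g, h) = z" .
    then show ?thesis using z by simp
  qed
  obtain f where f: "\<And>g h. g \<in> int_tuples m \<Longrightarrow> h \<in> int_tuples m \<Longrightarrow>
      poly_int s g h = f h - f (tuple_mult m \<eta> g h) + f g + e (g, h)"
  proof -
    have "poly_cochain m s \<in> cohomology_class ?G e"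
      unfolding e_def cls by (rule cohomology_class_self[OF cocycle])
    then obtain f where f: "poly_cochain m s = (\<lambda>p\<in>carrier ?G \<times> carrier ?G. coboundary1 ?G f p + e p)"
      by (auto simp: cohomology_class_def r_coset_def coboundaries_def cocycle_group_def)
    have "poly_int s g h = f h - f (tuple_mult m \<eta> g h) + f g + e (g, h)"
      if "g \<in> int_tuples m" "h \<in> int_tuples m" for g h
    proof -
      have "poly_int s g h = poly_cochain m s (g, h)" using poly_cochain_eq[OF that] by simp
      also have "\<dots> = coboundary1 ?G f (g, h) + e (g, h)" unfolding f using that by (simp add: carrier_tuple_group)
      finally show ?thesis using that by (simp add: coboundary1_def carrier_tuple_group mult_tuple_group)
    qed
    then show thesis using that by blast
  qed
  define zc where "zc = (\<lambda>x. THE z. x = \<iota> z \<otimes>\<^bsub>E\<^esub> \<theta> (\<pi> x))"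
  have zc_eq: "zc (\<iota> z \<otimes>\<^bsub>E\<^esub> \<theta> g) = z \<and> \<pi> (\<iota> z \<otimes>\<^bsub>E\<^esub> \<theta> g) = g" if g: "g \<in> int_tuples m" for z g
  proof -
    have "\<iota> z \<in> kernel E ?G \<pi>" using ext(5) by blast
    then have "\<pi> (\<iota> z) = \<one>\<^bsub>?G\<^esub>" by (simp add: kernel_def)
    then have p: "\<pi> (\<iota> z \<otimes>\<^bsub>E\<^esub> \<theta> g) = g"
      using pim[OF iot(1) tht(1)[OF g], of z] tht(2)[OF g] g G.l_one[of g]
      by (simp add: carrier_tuple_group mult_tuple_group)
    have "(\<iota> z \<otimes>\<^bsub>E\<^esub> \<theta> g = \<iota> w \<otimes>\<^bsub>E\<^esub> \<theta> g) \<longleftrightarrow> w = z" for w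
      using E.right_cancel[OF tht(1)[OF g] iot(1)[of z] iot(1)[of w]] inj_eq[OF ext(3), of z w] by auto
    then show ?thesis unfolding zc_def p by simp
  qed
  define \<Phi> where "\<Phi> = (\<lambda>x. root_exp n (zc x - f (\<pi> x)) \<cdot>\<^sub>m rho m \<eta> s n (\<pi> x))"
  have unit: "c \<cdot>\<^sub>m U \<in> carrier (unitary_group ?K)" if "U \<in> carrier (unitary_group ?K)" "cmod c = 1" for c U
  proof -
    have U: "U \<in> carrier_mat ?K ?K" "mat_adjoint U * U = 1\<^sub>m ?K" using that by (simp_all add: unitary_group_def)
    have adj: "mat_adjoint (c \<cdot>\<^sub>m U) = cnj c \<cdot>\<^sub>m mat_adjoint U"
      using U mat_adjoint_carrier[OF U(1)] mat_adjoint_carrier[of "c \<cdot>\<^sub>m U" ?K ?K]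
      by (intro eq_matI) (auto simp: mat_adjoint_index)
    have cc: "cnj c * c = 1" using that(2) complex_norm_square[of c] by (simp add: mult.commute)
    have ac: "mat_adjoint U \<in> carrier_mat ?K ?K" by (rule mat_adjoint_carrier[OF U(1)])
    have "mat_adjoint (c \<cdot>\<^sub>m U) * (c \<cdot>\<^sub>m U) = cnj c \<cdot>\<^sub>m (c \<cdot>\<^sub>m (mat_adjoint U * U))"
      unfolding adj using U(1) ac
      by (subst mult_smult_assoc_mat[of _ ?K ?K _ ?K], simp, simp, subst mult_smult_distrib[of _ ?K ?K _ ?K]) auto
    also have "\<dots> = 1\<^sub>m ?K" unfolding U(2) by (intro eq_matI) (auto simp: cc mult.assoc[symmetric])
    finally have 1: "mat_adjoint (c \<cdot>\<^sub>m U) * (c \<cdot>\<^sub>m U) = 1\<^sub>m ?K" .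
    have cU: "c \<cdot>\<^sub>m U \<in> carrier_mat ?K ?K" using U by simp
    show ?thesis
      using 1 cU mat_mult_left_right_inverse[OF mat_adjoint_carrier[OF cU] cU 1] by (simp add: unitary_group_def)
  qed
  have rc: "rho m \<eta> s n g \<in> carrier_mat ?K ?K" if "g \<in> int_tuples m" for g
    using rho_props(1)[OF n that] by (rule unitary_carrier[OF n])
  have dec: "\<exists>z g. g \<in> int_tuples m \<and> x = \<iota> z \<otimes>\<^bsub>E\<^esub> \<theta> g" if "x \<in> carrier E" for x
    using ex[OF that refl pi[OF that]] pi[OF that] by blast
  have Phi: "\<Phi> (\<iota> z \<otimes>\<^bsub>E\<^esub> \<theta> g) = root_exp n (z - f g) \<cdot>\<^sub>m rho m \<eta> s n g" if "g \<in> int_tuples m" for z g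
    using zc_eq[OF that] by (simp add: \<Phi>_def)
  have hom: "\<Phi> \<in> hom E (unitary_group ?K)"
  proof (rule homI)
    fix x assume x: "x \<in> carrier E"
    then show "\<Phi> x \<in> carrier (unitary_group ?K)"
      unfolding \<Phi>_def by (intro unit rho_props(1)[OF n] pi) auto
    fix y assume y: "y \<in> carrier E"
    obtain z g where x': "g \<in> int_tuples m" "x = \<iota> z \<otimes>\<^bsub>E\<^esub> \<theta> g" using dec[OF x] by blast
    obtain w h where y': "h \<in> int_tuples m" "y = \<iota> w \<otimes>\<^bsub>E\<^esub> \<theta> h" using dec[OF y] by blast
    have gh: "tuple_mult m \<eta> g h \<in> int_tuples m" by (rule tuple_mult_closed)
    note cl = iot(1) tht(1)[OF x'(1)] tht(1)[OF y'(1)] tht(1)[OF gh]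
    have "x \<otimes>\<^bsub>E\<^esub> y = \<iota> z \<otimes>\<^bsub>E\<^esub> (\<theta> g \<otimes>\<^bsub>E\<^esub> \<iota> w) \<otimes>\<^bsub>E\<^esub> \<theta> h" using x' y' cl by (simp add: E.m_assoc)
    also have "\<theta> g \<otimes>\<^bsub>E\<^esub> \<iota> w = \<iota> w \<otimes>\<^bsub>E\<^esub> \<theta> g" by (rule ext(6)[symmetric, OF tht(1)[OF x'(1)]])
    also have "\<iota> z \<otimes>\<^bsub>E\<^esub> (\<iota> w \<otimes>\<^bsub>E\<^esub> \<theta> g) \<otimes>\<^bsub>E\<^esub> \<theta> h = \<iota> z \<otimes>\<^bsub>E\<^esub> \<iota> w \<otimes>\<^bsub>E\<^esub> (\<theta> g \<otimes>\<^bsub>E\<^esub> \<theta> h)" using cl by (simp add: E.m_assoc)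
    also have "\<dots> = \<iota> (z + w + e (g, h)) \<otimes>\<^bsub>E\<^esub> \<theta> (tuple_mult m \<eta> g h)"
      unfolding e[OF x'(1) y'(1)] using cl by (simp add: E.m_assoc iot(2))
    finally have xy: "x \<otimes>\<^bsub>E\<^esub> y = \<iota> (z + w + e (g, h)) \<otimes>\<^bsub>E\<^esub> \<theta> (tuple_mult m \<eta> g h)" .
    have "\<Phi> x * \<Phi> y = root_exp n (z - f g) \<cdot>\<^sub>m (root_exp n (w - f h) \<cdot>\<^sub>m (rho m \<eta> s n g * rho m \<eta> s n h))"
      unfolding x'(2) y'(2) Phi[OF x'(1)] Phi[OF y'(1)]
      using rc[OF x'(1)] rc[OF y'(1)]
      by (subst mult_smult_assoc_mat[of _ ?K ?K _ ?K], simp, simp, subst mult_smult_distrib[of _ ?K ?K _ ?K]) auto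
    also have "\<dots> = root_exp n (z - f g + (w - f h) + poly_int s g h) \<cdot>\<^sub>m rho m \<eta> s n (tuple_mult m \<eta> g h)"
      unfolding rho_mult[OF n x'(1) y'(1)] using rc[OF gh] by (intro eq_matI) (auto simp: root_exp_add)
    also have "z - f g + (w - f h) + poly_int s g h = z + w + e (g, h) - f (tuple_mult m \<eta> g h)"
      using f[OF x'(1) y'(1)] by simp
    finally show "\<Phi> (x \<otimes>\<^bsub>E\<^esub> y) = \<Phi> x \<otimes>\<^bsub>unitary_group ?K\<^esub> \<Phi> y"
      unfolding xy Phi[OF gh] by (simp add: unitary_group_def)
  qed
  \<comment> \<open>All entries are 0 or n-th roots of unity, and the phase of \<Phi> only permutes
    these finitely many values.\<close>
  have "finite (\<Phi> ` carrier E)"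
  proof -
    let ?S = "insert 0 (root_exp n ` {0..<int n})" and ?I = "{0..<?K} \<times> {0..<?K}"
    have "\<Phi> x \<in> mat ?K ?K ` (?I \<rightarrow>\<^sub>E ?S)" if x: "x \<in> carrier E" for x
    proof -
      let ?c = "zc x - f (\<pi> x)"
      have mem: "root_exp n ?c * a \<in> ?S" if a: "a \<in> ?S" for a
      proof (cases "a = 0")
        case False
        then obtain b where b: "a = root_exp n b" using a by auto
        have "root_exp n ?c * a = root_exp n ((?c + b) mod int n)"
          unfolding b root_exp_add[symmetric] by (intro root_exp_cong np) (simp add: cong_def)
        moreover have "(?c + b) mod int n \<in> {0..<int n}" using np by simp
        ultimately show ?thesis by blast
      qed simp
      have "restrict (\<lambda>(i, j). root_exp n ?c * rho m \<eta> s n (\<pi> x) $$ (i, j)) ?I \<in> ?I \<rightarrow>\<^sub>E ?S"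
      proof (rule restrict_PiE_iff[THEN iffD2], rule ballI)
        fix q assume "q \<in> ?I"
        then obtain i j where q: "q = (i, j)" "i < ?K" "j < ?K" by auto
        then show "(case q of (i, j) \<Rightarrow> root_exp n ?c * rho m \<eta> s n (\<pi> x) $$ (i, j)) \<in> ?S"
          using mem[OF rho_entries[OF n pi[OF x] q(2,3)]] by (simp only: q(1) prod.case)
      qed
      moreover have "\<Phi> x = mat ?K ?K (restrict (\<lambda>(i, j). root_exp n ?c * rho m \<eta> s n (\<pi> x) $$ (i, j)) ?I)"
        unfolding \<Phi>_def using rc[OF pi[OF x]] by (intro eq_matI) auto
      ultimately show ?thesis by blast
    qed
    then have "\<Phi> ` carrier E \<subseteq> mat ?K ?K ` (?I \<rightarrow>\<^sub>E ?S)" by blast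
    moreover have "finite (mat ?K ?K ` (?I \<rightarrow>\<^sub>E ?S))" by (intro finite_imageI finite_PiE) auto
    ultimately show ?thesis by (rule finite_subset)
  qed
  \<comment> \<open>The target is treated as a monoid, so this is not automatic: the image of the
    unit is idempotent and unitary.\<close>
  moreover have one: "\<Phi> \<one>\<^bsub>E\<^esub> = 1\<^sub>m ?K"
  proof -
    have U: "\<Phi> \<one>\<^bsub>E\<^esub> \<in> carrier (unitary_group ?K)" using hom by (auto simp: hom_def)
    then have Uc: "\<Phi> \<one>\<^bsub>E\<^esub> \<in> carrier_mat ?K ?K" "mat_adjoint (\<Phi> \<one>\<^bsub>E\<^esub>) * \<Phi> \<one>\<^bsub>E\<^esub> = 1\<^sub>m ?K"
      by (simp_all add: unitary_group_def)
    have UU: "\<Phi> \<one>\<^bsub>E\<^esub> * \<Phi> \<one>\<^bsub>E\<^esub> = \<Phi> \<one>\<^bsub>E\<^esub>"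
      using hom_mult[OF hom E.one_closed E.one_closed] by (simp add: unitary_group_def)
    have "\<Phi> \<one>\<^bsub>E\<^esub> = (mat_adjoint (\<Phi> \<one>\<^bsub>E\<^esub>) * \<Phi> \<one>\<^bsub>E\<^esub>) * \<Phi> \<one>\<^bsub>E\<^esub>" using Uc by simp
    also have "\<dots> = mat_adjoint (\<Phi> \<one>\<^bsub>E\<^esub>) * (\<Phi> \<one>\<^bsub>E\<^esub> * \<Phi> \<one>\<^bsub>E\<^esub>)"
      by (rule assoc_mult_mat[OF mat_adjoint_carrier[OF Uc(1)] Uc(1) Uc(1)])
    finally show ?thesis by (simp add: UU Uc)
  qed
  moreover have "\<Phi> (\<iota> z) = root_exp n z \<cdot>\<^sub>m 1\<^sub>m ?K" for z
  proof -
    \<comment> \<open>The section need not send the unit to the unit. The integer \<open>w\<close>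
      measures the deviation and is absorbed by \<Phi> at the unit.\<close>
    obtain w g where w: "g \<in> int_tuples m" "\<one>\<^bsub>E\<^esub> = \<iota> w \<otimes>\<^bsub>E\<^esub> \<theta> g" using dec[OF E.one_closed] by blast
    have "\<iota> z = \<iota> (z + w) \<otimes>\<^bsub>E\<^esub> \<theta> g"
      using w iot tht(1)[OF w(1)] by (metis E.m_assoc E.r_one)
    then have "\<Phi> (\<iota> z) = root_exp n (z + w - f g) \<cdot>\<^sub>m rho m \<eta> s n g" using Phi[OF w(1)] by simp
    also have "\<dots> = root_exp n z \<cdot>\<^sub>m (root_exp n (w - f g) \<cdot>\<^sub>m rho m \<eta> s n g)"
      using root_exp_add[of n z "w - f g"] rc[OF w(1)] by (intro eq_matI) (auto simp: add_diff_eq)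
    also have "root_exp n (w - f g) \<cdot>\<^sub>m rho m \<eta> s n g = 1\<^sub>m ?K" using Phi[OF w(1), of w] w(2) one by simp
    finally show ?thesis .
  qed
  ultimately show ?thesis using hom by blast
qed

text \<open>The subgroups are the kernels of the homomorphisms from \<open>extension_hom\<close>,
  one for each admissible n. An element \<open>\<iota> z\<close> in all of them has z divisible by
  arbitrarily large numbers, hence z = 0.\<close>

lemma extension_separated:
  "extension_separated (tuple_group m \<eta>) (cohomology_class (tuple_group m \<eta>) (poly_cochain m s))"
  unfolding extension_separated_def
proof (intro allI impI)
  fix E :: "((nat \<Rightarrow> int) \<times> int) monoid" and \<iota> \<pi>
  let ?G = "tuple_group m \<eta>"
  assume "extension_corresponds ?G E \<iota> \<pi> (cohomology_class ?G (poly_cochain m s))"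
  then obtain \<theta> where E: "central_extension ?G E \<iota> \<pi>" "extension_section ?G E \<pi> \<theta>"
    "cohomology_class ?G (extension_cocycle ?G E \<iota> \<theta>) = cohomology_class ?G (poly_cochain m s)"
    by (auto simp: extension_corresponds_def)
  interpret E: group E using E(1) by (simp add: central_extension_def)
  have "\<forall>j. \<exists>\<Phi>. \<Phi> \<in> hom E (unitary_group (adm_seq j ^ m)) \<and> finite (\<Phi> ` carrier E) \<and>
    (\<forall>z. \<Phi> (\<iota> z) = root_exp (adm_seq j) z \<cdot>\<^sub>m 1\<^sub>m (adm_seq j ^ m))"
    using extension_hom[OF E adm_seq(1)] by blast
  then obtain \<Phi> where Phi: "\<And>j. \<Phi> j \<in> hom E (unitary_group (adm_seq j ^ m))" "\<And>j. finite (\<Phi> j ` carrier E)"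
    "\<And>j z. \<Phi> j (\<iota> z) = root_exp (adm_seq j) z \<cdot>\<^sub>m 1\<^sub>m (adm_seq j ^ m)"
    by metis
  have iot: "\<iota> z \<in> carrier E" "\<iota> (z + w) = \<iota> z \<otimes>\<^bsub>E\<^esub> \<iota> w" for z w
    using E(1) by (auto simp: central_extension_def hom_def integer_group_def)
  have io0: "\<iota> 0 = \<one>\<^bsub>E\<^esub>" using iot(2)[of 0 0] E.l_cancel_one'[of "\<iota> 0" "\<iota> 0"] iot(1)[of 0] by simp
  define K where "K = (\<lambda>j. {x \<in> carrier E. \<Phi> j x = 1\<^sub>m (adm_seq j ^ m)})"
  have one: "\<Phi> j \<one>\<^bsub>E\<^esub> = 1\<^sub>m (adm_seq j ^ m)" for j
    unfolding io0[symmetric] Phi(3) by (intro eq_matI) auto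
  have "finite_index_subgroup E (K j)" for j
    using E.finite_index_kernel[OF unitary_group_monoid Phi(1,2), of j] one[of j]
    by (simp add: K_def unitary_group_def)
  moreover have "range \<iota> \<inter> (\<Inter>j. K j) = {\<one>\<^bsub>E\<^esub>}"
  proof
    have "\<one>\<^bsub>E\<^esub> \<in> range \<iota>" using rangeI[of \<iota> 0] io0 by simp
    then show "{\<one>\<^bsub>E\<^esub>} \<subseteq> range \<iota> \<inter> (\<Inter>j. K j)" using one by (simp add: K_def)
    show "range \<iota> \<inter> (\<Inter>j. K j) \<subseteq> {\<one>\<^bsub>E\<^esub>}"
    proof
      fix x assume "x \<in> range \<iota> \<inter> (\<Inter>j. K j)"
      then obtain z where z: "x = \<iota> z" "\<And>j. \<iota> z \<in> K j" by blast
      have dvd: "int (adm_seq j) dvd z" for j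
      proof -
        have "root_exp (adm_seq j) z \<cdot>\<^sub>m 1\<^sub>m (adm_seq j ^ m) = (1\<^sub>m (adm_seq j ^ m) :: complex mat)"
          using z(2)[of j] Phi(3)[of j z] by (simp add: K_def)
        then have "(root_exp (adm_seq j) z \<cdot>\<^sub>m 1\<^sub>m (adm_seq j ^ m)) $$ (0, 0) = (1\<^sub>m (adm_seq j ^ m) :: complex mat) $$ (0, 0)"
          by simp
        then have "root_exp (adm_seq j) z = 1" using adm_seq(3)[of j] by simp
        then show ?thesis using root_exp_eq_1_iff[OF adm_seq(3)] by blast
      qed
      have "z = 0"
      proof (rule ccontr)
        assume "z \<noteq> 0"
        then have "int (adm_seq (Suc (nat \<bar>z\<bar>))) \<le> \<bar>z\<bar>" using dvd_imp_le_int[OF _ dvd] by simp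
        then show False using adm_seq(2)[of "Suc (nat \<bar>z\<bar>)"] by linarith
      qed
      then show "x \<in> {\<one>\<^bsub>E\<^esub>}" using z io0 by simp
    qed
  qed
  ultimately show "\<exists>K::nat \<Rightarrow> ((nat \<Rightarrow> int) \<times> int) set.
      (\<forall>k. finite_index_subgroup E (K k)) \<and> range \<iota> \<inter> (\<Inter>k. K k) = {\<one>\<^bsub>E\<^esub>}" by blast
qed

end

section \<open>Asymptotic representation and perturbations\<close>

lemma unitary_groupD:
  assumes "U \<in> carrier (unitary_group k)"
  shows "U \<in> carrier_mat k k" "mat_adjoint U \<in> carrier_mat k k" "mat_adjoint U * U = 1\<^sub>m k" "U * mat_adjoint U = 1\<^sub>m k"
  using assms mat_adjoint_carrier by (auto simp: unitary_group_def)

lemma mat_adjoint_adjoint: "(U :: complex mat) \<in> carrier_mat k k \<Longrightarrow> mat_adjoint (mat_adjoint U) = U"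
  using carrier_matD[OF mat_adjoint_carrier[of U k k]]
    carrier_matD[OF mat_adjoint_carrier[OF mat_adjoint_carrier[of U k k]]]
  by (intro eq_matI) (simp_all add: mat_adjoint_index carrier_matD)

lemma mat_adjoint_unitary:
  assumes "U \<in> carrier (unitary_group k)" shows "mat_adjoint U \<in> carrier (unitary_group k)"
  using unitary_groupD[OF assms] mat_adjoint_adjoint[of U k] by (simp add: unitary_group_def)

context poly_cocycle
begin

lemma root_exp_tendsto_1: "(\<lambda>j. root_exp (adm_seq j) t) \<longlonglongrightarrow> 1"
proof -
  have "filterlim (\<lambda>j. real (adm_seq j)) at_top sequentially"
    by (rule filterlim_at_top_mono[OF filterlim_real_sequentially]) (use adm_seq(2) in auto)
  then have "(\<lambda>j. 2 * pi * of_int t / real (adm_seq j)) \<longlonglongrightarrow> 0"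
    by (intro tendsto_divide_0[OF tendsto_const] filterlim_at_top_imp_at_infinity)
  then have "(\<lambda>j. exp (\<i> * of_real (2 * pi * of_int t / real (adm_seq j)))) \<longlonglongrightarrow> exp (\<i> * of_real 0)"
    by (intro tendsto_intros)
  then show ?thesis by (simp add: root_exp_def field_simps)
qed

text \<open>By \<open>rho_mult\<close> the defect at (g, h) is the scalar 1 - exp(2 pi i \<sigma>(g,
  h) / n) times a unitary matrix. The integer \<sigma>(g, h) is fixed while n grows.\<close>

lemma asymptotic_representation:
  "asymptotic_representation (tuple_group m \<eta>) (\<lambda>j. adm_seq j ^ m) (\<lambda>j. rho m \<eta> s (adm_seq j))"
  unfolding asymptotic_representation_def carrier_tuple_group mult_tuple_group
proof (intro conjI allI ballI)
  fix j show "rho m \<eta> s (adm_seq j) \<in> int_tuples m \<rightarrow> carrier (unitary_group (adm_seq j ^ m))"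
    using rho_props(1)[OF adm_seq(1)] by blast
next
  fix g h assume gh: "g \<in> int_tuples m" "h \<in> int_tuples m"
  let ?r = "\<lambda>j. rho m \<eta> s (adm_seq j)" and ?c = "\<lambda>j. 1 - root_exp (adm_seq j) (poly_int s g h)"
  have gh': "tuple_mult m \<eta> g h \<in> int_tuples m" by (rule tuple_mult_closed)
  have nl: "norm_le (adm_seq j ^ m) (cmod (?c j)) (?r j (tuple_mult m \<eta> g h) - ?r j g * ?r j h)" for j
  proof -
    have U: "?r j (tuple_mult m \<eta> g h) \<in> carrier (unitary_group (adm_seq j ^ m))"
      by (rule rho_props(1)[OF adm_seq(1) gh'])
    have "?r j (tuple_mult m \<eta> g h) - ?r j g * ?r j h = ?c j \<cdot>\<^sub>m ?r j (tuple_mult m \<eta> g h)"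
      unfolding rho_mult[OF adm_seq(1) gh] using unitary_groupD(1)[OF U]
      by (intro eq_matI) (auto simp: left_diff_distrib)
    then show ?thesis using norm_le_smult[OF norm_le_unitary[OF U], of "?c j"] by simp
  qed
  have lim: "(\<lambda>j. cmod (?c j)) \<longlonglongrightarrow> 0"
    using tendsto_norm[OF tendsto_diff[OF tendsto_const root_exp_tendsto_1, of 1]] by simp
  show "(\<lambda>j. op_norm (?r j (tuple_mult m \<eta> g h) - ?r j g * ?r j h)) \<longlonglongrightarrow> 0"
  proof (rule tendsto_sandwich[OF _ _ tendsto_const lim])
    have c: "?r j (tuple_mult m \<eta> g h) - ?r j g * ?r j h \<in> carrier_mat (adm_seq j ^ m) (adm_seq j ^ m)" for j
      using nl[of j] by (simp add: norm_le_def)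
    show "\<forall>\<^sub>F j in sequentially. 0 \<le> op_norm (?r j (tuple_mult m \<eta> g h) - ?r j g * ?r j h)"
      using op_norm_nonneg[OF c] by simp
    show "\<forall>\<^sub>F j in sequentially. op_norm (?r j (tuple_mult m \<eta> g h) - ?r j g * ?r j h) \<le> cmod (?c j)"
      using op_norm_le[OF nl] by simp
  qed
qed

text \<open>With \<open>u = \<rho> \<rho>'\<^sup>*\<close> one has \<open>\<rho>(g) u(h) \<rho>(g)\<^sup>* u(g) = exp (2 \<pi> i \<sigma>(g, h) / n) u(g h)\<close>;
  taking logarithms of determinants turns \<open>\<sigma>\<close> into a coboundary.\<close>
lemma logdet_coboundary:
  assumes n: "n \<in> admissible_indices m \<eta> s"
    and g: "g \<in> int_tuples m" and h: "h \<in> int_tuples m"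
    and r': "r' \<in> hom (tuple_group m \<eta>) (unitary_group (n ^ m))"
    and close: "\<And>x. x \<in> {g, h, tuple_mult m \<eta> g h} \<Longrightarrow> op_norm (rho m \<eta> s n x - r' x) \<le> 1/4"
    and root: "cmod (root_exp n (poly_int s g h) - 1) \<le> 1/4" "\<bar>2 * pi / n * poly_int s g h\<bar> < pi"
    and L: "\<And>x. x \<in> {g, h, tuple_mult m \<eta> g h} \<Longrightarrow>
      logdet (n ^ m) ((rho m \<eta> s n x - r' x) * mat_adjoint (r' x)) (L x)"
  shows "L h - L (tuple_mult m \<eta> g h) + L g =
    of_nat (n ^ m) * (2 * of_real pi * \<i> / of_nat n * of_int (poly_int s g h))"
proof -
  let ?K = "n ^ m" and ?gh = "tuple_mult m \<eta> g h" and ?r = "rho m \<eta> s n"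
  define w where "w = root_exp n (poly_int s g h)"
  define X where "X = (\<lambda>x. (?r x - r' x) * mat_adjoint (r' x))"
  have gh: "?gh \<in> int_tuples m" by (rule tuple_mult_closed)
  have U: "?r x \<in> carrier (unitary_group ?K)" "r' x \<in> carrier (unitary_group ?K)" if "x \<in> int_tuples m" for x
    using rho_props(1)[OF n that] r' that by (auto simp: hom_def carrier_tuple_group)
  note rc = unitary_groupD[OF U(1)] and sc = unitary_groupD[OF U(2)]
  have Xn: "norm_le ?K (1/4) (X x)" if "x \<in> {g, h, ?gh}" for x
  proof -
    have x: "x \<in> int_tuples m" using that g h gh by blast
    have "norm_le ?K (1/4) (?r x - r' x)"
      using norm_le_mono[OF norm_le_op_norm[OF minus_carrier_mat[OF sc(1)[OF x]]] close[OF that]] by simp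
    from norm_le_mult[OF this norm_le_unitary[OF mat_adjoint_unitary[OF U(2)[OF x]]]]
    show ?thesis by (simp add: X_def)
  qed
  have Xc: "X x \<in> carrier_mat ?K ?K" if "x \<in> {g, h, ?gh}" for x using Xn[OF that] by (simp add: norm_le_def)
  have u: "1\<^sub>m ?K + X x = ?r x * mat_adjoint (r' x)" if x: "x \<in> int_tuples m" for x
  proof -
    have "X x = ?r x * mat_adjoint (r' x) - r' x * mat_adjoint (r' x)"
      unfolding X_def by (rule minus_mult_distrib_mat[OF rc(1)[OF x] sc(1)[OF x] sc(2)[OF x]])
    then show ?thesis using rc(1)[OF x] sc[OF x] by (auto intro!: eq_matI)
  qed
  \<comment> \<open>Conjugation by rho(g) preserves \<open>logdet\<close> and brings rho(g) next to
    rho(h): the product of 1 + Y and 1 + X g becomes rho(g) rho(h) r'(h)^* r'(g)^*.\<close>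
  define Y where "Y = ?r g * X h * mat_adjoint (?r g)"
  have Xh: "X h \<in> carrier_mat ?K ?K" "X g \<in> carrier_mat ?K ?K" "X ?gh \<in> carrier_mat ?K ?K" using Xc by simp_all
  have Yn: "norm_le ?K (1/4) Y"
    using norm_le_mult[OF norm_le_mult[OF norm_le_unitary[OF U(1)[OF g]] Xn[of h]]
        norm_le_unitary[OF mat_adjoint_unitary[OF U(1)[OF g]]]] by (simp add: Y_def)
  have Yc: "Y \<in> carrier_mat ?K ?K" using Yn by (simp add: norm_le_def)
  have LY: "logdet ?K Y (L h)"
    unfolding Y_def using L[of h] Xh rc[OF g] by (intro logdet_conj) (simp_all add: X_def)
  have oneY: "1\<^sub>m ?K + Y = ?r g * (1\<^sub>m ?K + X h) * mat_adjoint (?r g)"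
  proof -
    have "?r g * (1\<^sub>m ?K + X h) * mat_adjoint (?r g) = (?r g * 1\<^sub>m ?K + ?r g * X h) * mat_adjoint (?r g)"
      using rc[OF g] Xh by (subst mult_add_distrib_mat[of "?r g" ?K ?K]) auto
    also have "\<dots> = ?r g * 1\<^sub>m ?K * mat_adjoint (?r g) + Y"
      unfolding Y_def using rc[OF g] Xh by (subst add_mult_distrib_mat[of _ ?K ?K]) auto
    finally show ?thesis using rc[OF g] by (simp add: right_mult_one_mat[of _ ?K ?K])
  qed
  define V where "V = (w - 1) \<cdot>\<^sub>m 1\<^sub>m ?K"
  have Vc: "V \<in> carrier_mat ?K ?K" by (simp add: V_def)
  have oneV: "1\<^sub>m ?K + V = w \<cdot>\<^sub>m 1\<^sub>m ?K" unfolding V_def by (intro eq_matI) auto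
  have expand: "A + B + A * B = (1\<^sub>m ?K + A) * (1\<^sub>m ?K + B) - 1\<^sub>m ?K"
    if "A \<in> carrier_mat ?K ?K" "B \<in> carrier_mat ?K ?K" for A B :: "complex mat"
  proof -
    have "(1\<^sub>m ?K + A) * (1\<^sub>m ?K + B) = (1\<^sub>m ?K + A) * 1\<^sub>m ?K + (1\<^sub>m ?K + A) * B"
      using that by (intro mult_add_distrib_mat[of _ ?K ?K _ ?K]) auto
    also have "(1\<^sub>m ?K + A) * B = 1\<^sub>m ?K * B + A * B"
      using that by (intro add_mult_distrib_mat[of _ ?K ?K _ _ ?K]) auto
    finally have e: "(1\<^sub>m ?K + A) * (1\<^sub>m ?K + B) = 1\<^sub>m ?K + A + (B + A * B)"
      using that by (simp add: right_mult_one_mat[of _ ?K ?K])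
    show ?thesis unfolding e using that by (intro eq_matI) auto
  qed
  have inner: "(1\<^sub>m ?K + Y) * (1\<^sub>m ?K + X g) = (1\<^sub>m ?K + V) * (1\<^sub>m ?K + X ?gh)"
  proof -
    let ?a = "mat_adjoint"
    have r'gh: "r' ?gh = r' g * r' h"
      using hom_mult[OF r', of g h] g h by (simp add: carrier_tuple_group mult_tuple_group unitary_group_def)
    have adj: "?a (r' ?gh) = ?a (r' h) * ?a (r' g)"
      unfolding r'gh using sc[OF g] sc[OF h] mat_adjoint_carrier[OF mult_carrier_mat[OF sc(1)[OF g] sc(1)[OF h]]]
      by (intro eq_matI) (auto simp: mat_adjoint_index scalar_prod_def mult.commute intro!: sum.cong)
    note as = assoc_mult_mat[of _ ?K ?K _ ?K _ ?K]
    note cs = rc[OF g] rc[OF h] sc[OF g] sc[OF h] rc[OF gh] sc[OF gh]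
    have "(1\<^sub>m ?K + Y) * (1\<^sub>m ?K + X g) = ?r g * (?r h * ?a (r' h)) * ?a (?r g) * (?r g * ?a (r' g))"
      unfolding oneY u[OF h] u[OF g] ..
    also have "\<dots> = ?r g * ?r h * (?a (r' h) * ((?a (?r g) * ?r g) * ?a (r' g)))"
      using cs(1,2,5,6,9,10,13,14) by (simp add: as)
    also have "\<dots> = ?r g * ?r h * ?a (r' ?gh)"
      unfolding cs(3) adj using cs by simp
    also have "\<dots> = w \<cdot>\<^sub>m ?r ?gh * ?a (r' ?gh)" unfolding rho_mult[OF n g h] w_def ..
    also have "\<dots> = w \<cdot>\<^sub>m (?r ?gh * ?a (r' ?gh))" using cs by (intro mult_smult_assoc_mat[of _ ?K ?K _ ?K]) auto
    also have "\<dots> = w \<cdot>\<^sub>m (1\<^sub>m ?K + X ?gh)" unfolding u[OF gh] ..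
    also have "\<dots> = (w \<cdot>\<^sub>m 1\<^sub>m ?K) * (1\<^sub>m ?K + X ?gh)"
      using Xh by (subst mult_smult_assoc_mat[of "1\<^sub>m ?K" ?K ?K _ ?K]) auto
    finally show ?thesis by (simp only: oneV)
  qed
  have eq: "Y + X g + Y * X g = V + X ?gh + V * X ?gh"
    unfolding expand[OF Yc Xh(2)] expand[OF Vc Xh(3)] inner ..
  have Vn: "norm_le ?K (1/4) V"
  proof -
    have "1\<^sub>m ?K \<in> carrier (unitary_group ?K)"
      using monoid.one_closed[OF unitary_group_monoid[of ?K]] by (simp add: unitary_group_def)
    from norm_le_mono[OF norm_le_smult[OF norm_le_unitary[OF this], of "w - 1"]] root(1)
    show ?thesis by (simp add: V_def w_def)
  qed
  have np: "n > 0" by (rule n_pos[OF n])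
  have LV: "logdet ?K V (of_nat ?K * (2 * of_real pi * \<i> / of_nat n * of_int (poly_int s g h)))" (is "logdet _ _ ?t")
    unfolding V_def w_def by (rule logdet_root_exp[OF np _ root(2)]) (use root(1) in simp)
  \<comment> \<open>The bound 9/16 guarantees a logarithm l, which is then evaluated from both
    factorizations of the same matrix.\<close>
  have "norm_le ?K (1/4 + 1/4 + 1/4 * (1/4)) (Y + X g + Y * X g)"
    by (intro norm_le_add norm_le_mult Yn Xn) auto
  then obtain l where l: "logdet ?K (Y + X g + Y * X g) l" using logdet_exists by fastforce
  have l1: "l = L h + L g"
    by (rule logdet_mult[OF Yn Xn[of g] LY _ l]) (use L[of g] in \<open>auto simp: X_def\<close>)
  have l2: "l = ?t + L ?gh"
    using logdet_mult[OF Vn Xn[of ?gh] LV _ l[unfolded eq]] L[of ?gh] by (simp add: X_def)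
  have "L h - L ?gh + L g = l - L ?gh" unfolding l1 by simp
  also have "\<dots> = ?t" unfolding l2 by simp
  finally show ?thesis .
qed

text \<open>The cycle involves finitely many group elements, so a single far index satisfies all
  smallness conditions at once. Pairing the coboundary identity for \<open>L\<close> with the cycle
  gives 0 on one side and a nonzero multiple of the pairing with the cocycle on the other.\<close>

lemma not_perturbable:
  assumes c: "Poly_Mapping.keys c \<subseteq> carrier (tuple_group m \<eta>) \<times> carrier (tuple_group m \<eta>)"
    "boundary2 (tuple_group m \<eta>) c = 0" and ne: "chain_pairing (poly_cochain m s) c \<noteq> 0"
  shows "\<not> perturbable (tuple_group m \<eta>) (\<lambda>j. adm_seq j ^ m) (\<lambda>j. rho m \<eta> s (adm_seq j))"
proof
  let ?G = "tuple_group m \<eta>"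
  assume "perturbable ?G (\<lambda>j. adm_seq j ^ m) (\<lambda>j. rho m \<eta> s (adm_seq j))"
  then obtain r' where r': "\<And>j. r' j \<in> hom ?G (unitary_group (adm_seq j ^ m))"
    and lim: "\<And>g. g \<in> int_tuples m \<Longrightarrow> (\<lambda>j. op_norm (rho m \<eta> s (adm_seq j) g - r' j g)) \<longlonglongrightarrow> 0"
    unfolding perturbable_def carrier_tuple_group by blast
  define T where "T = (\<Union>(g, h)\<in>Poly_Mapping.keys c. {g, h, tuple_mult m \<eta> g h})"
  have keys: "g \<in> int_tuples m" "h \<in> int_tuples m" "g \<in> T" "h \<in> T" "tuple_mult m \<eta> g h \<in> T"
    if "(g, h) \<in> Poly_Mapping.keys c" for g h
    using c(1) that by (auto simp: carrier_tuple_group T_def)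
  have T: "finite T" "T \<subseteq> int_tuples m"
  proof -
    show "finite T" by (auto simp: T_def)
    show "T \<subseteq> int_tuples m"
    proof
      fix x assume "x \<in> T"
      then obtain g h where gh: "(g, h) \<in> Poly_Mapping.keys c" "x \<in> {g, h, tuple_mult m \<eta> g h}"
        by (auto simp: T_def)
      then show "x \<in> int_tuples m" using keys(1,2)[OF gh(1)] tuple_mult_closed[of g h] by blast
    qed
  qed
  have 1: "\<forall>\<^sub>F j in sequentially. \<forall>x\<in>T. op_norm (rho m \<eta> s (adm_seq j) x - r' j x) < 1/4"
  proof (rule eventually_ball_finite[OF T(1)], rule ballI)
    fix x assume "x \<in> T"
    then show "\<forall>\<^sub>F j in sequentially. op_norm (rho m \<eta> s (adm_seq j) x - r' j x) < 1/4"
      using T(2) lim by (intro order_tendstoD(2)[of _ 0]) auto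
  qed
  have 2: "\<forall>\<^sub>F j in sequentially. \<forall>p\<in>Poly_Mapping.keys c.
      cmod (root_exp (adm_seq j) (poly_cochain m s p) - 1) < 1/4"
  proof (rule eventually_ball_finite, simp, rule ballI)
    fix p
    show "\<forall>\<^sub>F j in sequentially. cmod (root_exp (adm_seq j) (poly_cochain m s p) - 1) < 1/4"
      using tendsto_norm[OF tendsto_diff[OF root_exp_tendsto_1 tendsto_const, of _ 1]]
      by (intro order_tendstoD(2)[of _ 0]) auto
  qed
  \<comment> \<open>For n larger than 2 \<bar>\<sigma>\<bar> the angle is in the open principal
    strip, as \<open>logdet_root_exp\<close> requires.\<close>
  have 3: "\<forall>\<^sub>F j in sequentially. \<forall>p\<in>Poly_Mapping.keys c. \<bar>2 * pi / adm_seq j * poly_cochain m s p\<bar> < pi"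
  proof (rule eventually_ball_finite, simp, rule ballI)
    fix p
    show "\<forall>\<^sub>F j in sequentially. \<bar>2 * pi / adm_seq j * poly_cochain m s p\<bar> < pi"
    proof (rule eventually_sequentiallyI)
      fix j assume j: "Suc (nat (2 * \<bar>poly_cochain m s p\<bar>)) \<le> j"
      then have "2 * \<bar>poly_cochain m s p\<bar> < int (adm_seq j)" using adm_seq(2)[of j] by linarith
      then have "real_of_int (2 * \<bar>poly_cochain m s p\<bar>) < real_of_int (int (adm_seq j))"
        by (simp only: of_int_less_iff)
      then have "2 * \<bar>real_of_int (poly_cochain m s p)\<bar> < real (adm_seq j)" by simp
      then have "pi * (2 * \<bar>real_of_int (poly_cochain m s p)\<bar>) < pi * real (adm_seq j)"
        by (intro mult_strict_left_mono pi_gt_zero)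
      then show "\<bar>2 * pi / adm_seq j * poly_cochain m s p\<bar> < pi"
        using adm_seq(3)[of j] by (simp add: abs_mult field_simps)
    qed
  qed
  obtain j where j: "\<forall>x\<in>T. op_norm (rho m \<eta> s (adm_seq j) x - r' j x) < 1/4"
    "\<forall>p\<in>Poly_Mapping.keys c. cmod (root_exp (adm_seq j) (poly_cochain m s p) - 1) < 1/4"
    "\<forall>p\<in>Poly_Mapping.keys c. \<bar>2 * pi / adm_seq j * poly_cochain m s p\<bar> < pi"
    using eventually_happens'[OF sequentially_bot eventually_conj[OF 1 eventually_conj[OF 2 3]]]
    by (elim exE conjE)
  define n where "n = adm_seq j"
  have n: "n \<in> admissible_indices m \<eta> s" "n > 0" using adm_seq[of j] by (simp_all add: n_def)
  define X where "X = (\<lambda>x. (rho m \<eta> s n x - r' j x) * mat_adjoint (r' j x))"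
  have "\<exists>l. logdet (n ^ m) (X x) l" if x: "x \<in> T" for x
  proof -
    have xt: "x \<in> int_tuples m" using x T by blast
    have U: "rho m \<eta> s n x \<in> carrier (unitary_group (n ^ m))" "r' j x \<in> carrier (unitary_group (n ^ m))"
      using rho_props(1)[OF n(1) xt] r'[of j] xt by (auto simp: hom_def carrier_tuple_group n_def)
    have "norm_le (n ^ m) (1/4) (rho m \<eta> s n x - r' j x)"
    proof (rule norm_le_mono[OF norm_le_op_norm])
      show "rho m \<eta> s n x - r' j x \<in> carrier_mat (n ^ m) (n ^ m)"
        by (rule minus_carrier_mat[OF unitary_groupD(1)[OF U(2)]])
      show "op_norm (rho m \<eta> s n x - r' j x) \<le> 1/4" using bspec[OF j(1) x] unfolding n_def by (rule less_imp_le)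
    qed
    from norm_le_mult[OF this norm_le_unitary[OF mat_adjoint_unitary[OF U(2)]]]
    show ?thesis unfolding X_def by (intro logdet_exists[of _ "1/4"]) simp_all
  qed
  then obtain L where L: "\<And>x. x \<in> T \<Longrightarrow> logdet (n ^ m) (X x) (L x)" by metis
  \<comment> \<open>The dimension n^m counts the equal eigenvalues of the scalar matrix; only
    \<open>t \<noteq> 0\<close> will matter.\<close>
  define t where "t = of_nat (n ^ m) * (2 * of_real pi * \<i> / of_nat n :: complex)"
  have cob: "L h - L (g \<otimes>\<^bsub>?G\<^esub> h) + L g = t * of_int (poly_cochain m s (g, h))"
    if gh: "(g, h) \<in> Poly_Mapping.keys c" for g h
  proof -
    note k = keys[OF gh]
    have e: "poly_cochain m s (g, h) = poly_int s g h" by (rule poly_cochain_eq[OF k(1,2)])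
    have "L h - L (tuple_mult m \<eta> g h) + L g =
        of_nat (n ^ m) * (2 * of_real pi * \<i> / of_nat n * of_int (poly_int s g h))"
    proof (rule logdet_coboundary[OF n(1) k(1,2)])
      show "r' j \<in> hom ?G (unitary_group (n ^ m))" using r'[of j] by (simp add: n_def)
      show "op_norm (rho m \<eta> s n x - r' j x) \<le> 1/4" if "x \<in> {g, h, tuple_mult m \<eta> g h}" for x
      proof -
        have "x \<in> T" using k that by blast
        from bspec[OF j(1) this] show ?thesis unfolding n_def by (rule less_imp_le)
      qed
      show "cmod (root_exp n (poly_int s g h) - 1) \<le> 1/4"
        using bspec[OF j(2) gh] unfolding n_def e by (rule less_imp_le)
      show "\<bar>2 * pi / n * poly_int s g h\<bar> < pi" using bspec[OF j(3) gh] unfolding n_def e .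
      show "logdet (n ^ m) ((rho m \<eta> s n x - r' j x) * mat_adjoint (r' j x)) (L x)"
        if "x \<in> {g, h, tuple_mult m \<eta> g h}" for x
      proof -
        have "x \<in> T" using k that by blast
        from L[OF this] show ?thesis unfolding X_def .
      qed
    qed
    then show ?thesis by (simp add: t_def e mult_tuple_group mult.assoc)
  qed
  have "ring_pairing (\<lambda>(g, h). L h - L (g \<otimes>\<^bsub>?G\<^esub> h) + L g) c =
      ring_pairing (\<lambda>p. t * of_int (poly_cochain m s p)) c"
    by (intro ring_pairing_cong) (auto simp: cob)
  also have "\<dots> = t * of_int (chain_pairing (poly_cochain m s) c)"
    unfolding chain_pairing_eq of_int_ring_pairing by (simp add: ring_pairing_def sum_distrib_left mult_ac)
  finally have "t * of_int (chain_pairing (poly_cochain m s) c) = 0"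
    using ring_pairing_boundary2[of L ?G c] c(2) by simp
  moreover have "t \<noteq> 0" using n(2) by (simp add: t_def)
  ultimately show False using ne by simp
qed

end

section \<open>The theorem\<close>

lemma (in group) exists_central_sequence:
  assumes "torsion_free_group G" "finitely_generated_group G" "nilpotent_group G"
  shows "\<exists>m N a. central_sequence G m N a"
proof -
  obtain c where c: "lower_central_series G c = {\<one>}" using assms by (auto simp: nilpotent_group_def)
  have noeth: "noetherian (carrier G)" using fin_gen_nilpotent_noetherian assms by blast
  have iso: "isolated {\<one>}"
    using assms(1) unfolding isolated_def torsion_free_group_def torsion_element_def by blast
  have top: "isolated (carrier G)" by (simp add: isolated_def)
  obtain xs where xs: "central_chain {\<one>} (carrier G) xs"
    using central_chain_exists[OF noeth c one_is_normal iso normal_self top] by auto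
  obtain N a where N: "N 0 = carrier G" "N (length xs) = {\<one>}" "\<forall>i\<le>length xs. N i \<lhd> G"
    "\<forall>i<length xs. N i = adjoin (N (Suc i)) (a (Suc i)) \<and> a (Suc i) \<in> central_mod (N (Suc i)) \<and>
       (\<forall>k::int. k \<noteq> 0 \<longrightarrow> a (Suc i) [^] k \<notin> N (Suc i))"
    using central_chain_sequence[OF xs one_is_normal] by (elim exE conjE)
  have "central_sequence G (length xs) N a"
  proof (intro central_sequence.intro is_group central_sequence_axioms.intro)
    show "N 0 = carrier G" "N (length xs) = {\<one>}" by (rule N)+
    show "N i \<lhd> G" if "i \<le> length xs" for i using N(3) that by simp
    show "N i = adjoin (N (Suc i)) (a (Suc i))" if "i < length xs" for i using N(4) that by simp
    show "a (Suc i) \<in> central_mod (N (Suc i))" if "i < length xs" for i using N(4) that by simp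
    show "a (Suc i) [^] k \<notin> N (Suc i)" if "i < length xs" "k \<noteq> 0" for i and k :: int using N(4) that by simp
  qed
  then show ?thesis by blast
qed

context central_sequence
begin

lemma infinite_cyclic_if_length_1: assumes "m = 1" shows "G \<cong> integer_group"
proof -
  have m: "0 < m" using assms by simp
  have N1: "N (Suc 0) = {\<one>}" using N_m assms by simp
  have mem: "g \<in> N 0" if "g \<in> carrier G" for g using that N_0 by simp
  have hom: "kap 0 \<in> hom G integer_group"
    using kap_mult[OF m] N_0 by (auto simp: hom_def integer_group_def)
  have rep: "g = a 1 [^] kap 0 g" if "g \<in> carrier G" for g
    using nu_kap[OF m mem[OF that]] nu_in[OF m mem[OF that]] N1 a_carrier[OF m] by simp
  have "inj_on (kap 0) (carrier G)" by (rule inj_onI) (metis rep)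
  moreover have "k \<in> kap 0 ` carrier G" for k
    using expo_gen[OF step_facts[OF m], of k] a_carrier[OF m] by (intro image_eqI[of _ _ "a 1 [^] k"]) auto
  then have "kap 0 ` carrier G = UNIV" by blast
  ultimately have "kap 0 \<in> iso G integer_group"
    using hom by (simp add: iso_def bij_betw_def)
  then show ?thesis by (auto simp: is_iso_def)
qed

lemma trivial_if_length_0: "m = 0 \<Longrightarrow> carrier G = {\<one>}"
  using N_0 N_m by simp

definition coords :: "'a \<Rightarrow> nat \<Rightarrow> int" where
  "coords g = (\<lambda>i\<in>{1..m}. coord i g)"

lemma coords_in: "coords g \<in> int_tuples m"
  by (auto simp: coords_def)

lemma coords_element: "x \<in> int_tuples m \<Longrightarrow> coords (element m x) = x"
  using coord_element by (auto simp: coords_def fun_eq_iff PiE_def extensional_def)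

lemma element_coords: assumes "g \<in> carrier G" shows "element m (coords g) = g"
proof -
  have "element m (coords g) = element m (\<lambda>j. coord j g)" by (rule element_cong) (simp add: coords_def)
  then show ?thesis using element_coord[OF assms] by simp
qed

lemma polynomial_multiplication:
  obtains \<eta> where "\<And>i. i \<in> {1..m} \<Longrightarrow> poly_in_vars m (\<eta> i)"
    "\<And>i x y. i \<in> {1..m} \<Longrightarrow> poly_eval (\<eta> i) x y = of_int (coord i (element m x \<otimes> element m y))"
proof -
  have "\<forall>i\<in>{1..m}. \<exists>p. poly_in_vars m p \<and> (\<forall>x y. poly_eval p x y = of_int (coord i (element m x \<otimes> element m y)))"
    using poly_function_product[OF weight_le_coord] unfolding poly_function_def by blast
  then obtain \<eta> where eta: "\<forall>i\<in>{1..m}. poly_in_vars m (\<eta> i) \<and>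
      (\<forall>x y. poly_eval (\<eta> i) x y = of_int (coord i (element m x \<otimes> element m y)))"
    by (rule bchoice[THEN exE])
  show ?thesis by (rule that[of \<eta>]) (use eta in blast)+
qed

context
  fixes \<eta> assumes eta: "\<And>i x y. i \<in> {1..m} \<Longrightarrow> poly_eval (\<eta> i) x y = of_int (coord i (element m x \<otimes> element m y))"
begin

lemma coords_mult:
  assumes "g \<in> carrier G" "h \<in> carrier G" shows "coords (g \<otimes> h) = tuple_mult m \<eta> (coords g) (coords h)"
  using eta assms by (auto simp: tuple_mult_def poly_int_def element_coords coords_def[of "g \<otimes> h"])

lemma tuple_mult_eq:
  assumes "x \<in> int_tuples m" "y \<in> int_tuples m"
  shows "tuple_mult m \<eta> x y = coords (element m x \<otimes> element m y)"
  using coords_mult[of "element m x" "element m y"] assms by (simp add: coords_element element_closed)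

text \<open>The unit of the record is a definite description, so it has to be identified before the
  group axioms can be checked.\<close>

lemma tuple_group_one: "\<one>\<^bsub>tuple_group m \<eta>\<^esub> = coords \<one>"
proof -
  have unit: "tuple_mult m \<eta> (coords \<one>) x = x" "tuple_mult m \<eta> x (coords \<one>) = x" if "x \<in> int_tuples m" for x
    using coords_mult[of \<one> "element m x"] coords_mult[of "element m x" \<one>] that
    by (simp_all add: coords_element element_closed)
  have "(THE e. e \<in> int_tuples m \<and> (\<forall>x\<in>int_tuples m. tuple_mult m \<eta> e x = x \<and> tuple_mult m \<eta> x e = x)) = coords \<one>"
  proof (rule the_equality)
    show "coords \<one> \<in> int_tuples m \<and> (\<forall>x\<in>int_tuples m. tuple_mult m \<eta> (coords \<one>) x = x \<and> tuple_mult m \<eta> x (coords \<one>) = x)"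
      using unit coords_in by blast
    fix e assume "e \<in> int_tuples m \<and> (\<forall>x\<in>int_tuples m. tuple_mult m \<eta> e x = x \<and> tuple_mult m \<eta> x e = x)"
    then show "e = coords \<one>" using unit(1)[of e] coords_in[of \<one>] by metis
  qed
  then show ?thesis by (simp add: tuple_group_def)
qed

lemma tuple_group_is_group: "group (tuple_group m \<eta>)"
proof (rule groupI, simp_all only: tuple_group_one)
  have car: "carrier (tuple_group m \<eta>) = int_tuples m" by (simp add: tuple_group_def)
  have mul: "x \<otimes>\<^bsub>tuple_group m \<eta>\<^esub> y = coords (element m x \<otimes> element m y)" if "x \<in> int_tuples m" "y \<in> int_tuples m" for x y
    using tuple_mult_eq[OF that] by (simp add: tuple_group_def)
  fix x assume "x \<in> carrier (tuple_group m \<eta>)"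
  then have x: "x \<in> int_tuples m" by (simp only: car)
  have ec: "element m z \<in> carrier G" for z :: "nat \<Rightarrow> int" by (rule element_closed) simp
  show "coords \<one> \<otimes>\<^bsub>tuple_group m \<eta>\<^esub> x = x"
    using x coords_in[of \<one>] ec by (simp add: mul element_coords coords_element)
  show "\<exists>y\<in>carrier (tuple_group m \<eta>). y \<otimes>\<^bsub>tuple_group m \<eta>\<^esub> x = coords \<one>"
    using x coords_in[of "inv (element m x)"] ec
    by (intro bexI[of _ "coords (inv (element m x))"]) (simp_all add: mul element_coords car)
  fix y assume "y \<in> carrier (tuple_group m \<eta>)"
  then have y: "y \<in> int_tuples m" by (simp only: car)
  show "x \<otimes>\<^bsub>tuple_group m \<eta>\<^esub> y \<in> carrier (tuple_group m \<eta>)"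
    using x y coords_in by (simp only: mul car)
  fix z assume "z \<in> carrier (tuple_group m \<eta>)"
  then have z: "z \<in> int_tuples m" by (simp only: car)
  show "x \<otimes>\<^bsub>tuple_group m \<eta>\<^esub> y \<otimes>\<^bsub>tuple_group m \<eta>\<^esub> z = x \<otimes>\<^bsub>tuple_group m \<eta>\<^esub> (y \<otimes>\<^bsub>tuple_group m \<eta>\<^esub> z)"
    using x y z coords_in ec by (simp add: mul element_coords m_assoc)
qed (use coords_in in \<open>simp add: tuple_group_def\<close>)

lemma coords_iso: "coords \<in> iso G (tuple_group m \<eta>)"
proof -
  have "coords \<in> hom G (tuple_group m \<eta>)"
    using coords_mult coords_in by (auto simp: hom_def tuple_group_def simp del: PiE_iff)
  moreover have "bij_betw coords (carrier G) (int_tuples m)"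
    using coords_in coords_element element_coords element_closed
    by (intro bij_betw_byWitness[of _ "element m"]) blast+
  ultimately show ?thesis by (simp add: iso_def tuple_group_def)
qed

end

end

section \<open>Transport of cycles along homomorphisms\<close>

lemma ring_pairing_image:
  "ring_pairing s (frag_extend (frag_of \<circ> F) c) = ring_pairing (s \<circ> F) c"
proof -
  have "Poly_Mapping.keys c \<subseteq> UNIV" by simp
  then show ?thesis
    by (induction c rule: frag_induction) (simp_all add: frag_extend_diff ring_pairing_diff)
qed

lemma transport_cycle:
  assumes F: "F \<in> hom G H" and c: "Poly_Mapping.keys c \<subseteq> carrier G \<times> carrier G" "boundary2 G c = 0"
  shows "\<exists>d. Poly_Mapping.keys d \<subseteq> carrier H \<times> carrier H \<and> boundary2 H d = 0 \<and>
    (\<forall>s. chain_pairing s d = chain_pairing (s \<circ> map_prod F F) c)"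
proof (intro exI conjI allI)
  let ?d = "frag_extend (frag_of \<circ> map_prod F F) c"
  have "Poly_Mapping.keys ?d \<subseteq> map_prod F F ` Poly_Mapping.keys c"
    using keys_frag_extend[of "frag_of \<circ> map_prod F F" c] by auto
  also have "\<dots> \<subseteq> carrier H \<times> carrier H" using c(1) F by (auto simp: hom_def)
  finally show "Poly_Mapping.keys ?d \<subseteq> carrier H \<times> carrier H" .
  have "boundary2 H ?d = frag_extend (frag_of \<circ> F) (boundary2 G c)"
    using c(1)
  proof (induction c rule: frag_induction)
    case (one p)
    then obtain g h where "p = (g, h)" "g \<in> carrier G" "h \<in> carrier G" by auto
    then show ?case using F by (simp add: hom_def frag_extend_add frag_extend_diff)
  qed (simp_all add: frag_extend_diff)
  then show "boundary2 H ?d = 0" by (simp add: c(2))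
  show "chain_pairing s ?d = chain_pairing (s \<circ> map_prod F F) c" for s
    by (simp add: chain_pairing_eq ring_pairing_image)
qed

theorem theorem4p2:
  fixes \<Gamma> :: "('a, 'b) monoid_scheme"
  assumes "group \<Gamma>"
    and "torsion_free_group \<Gamma>"
    and "finitely_generated_group \<Gamma>"
    and "nilpotent_group \<Gamma>"
    and "carrier \<Gamma> \<noteq> {\<one>\<^bsub>\<Gamma>\<^esub>}"
    and "\<not> \<Gamma> \<cong> integer_group"
  shows "\<exists>(m::nat) (\<eta> :: nat \<Rightarrow> xy_poly) (\<sigma> :: xy_poly).
    m \<ge> 1 \<and>
    (\<forall>i\<in>{1..m}. poly_in_vars m (\<eta> i) \<and> poly_int_valued m (\<eta> i)) \<and>
    poly_in_vars m \<sigma> \<and> poly_int_valued m \<sigma> \<and>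
    \<comment> \<open>(a)\<close>
    group (tuple_group m \<eta>) \<and> \<Gamma> \<cong> tuple_group m \<eta> \<and>
    \<comment> \<open>(b)\<close>
    cocycle2 (tuple_group m \<eta>) (poly_cochain m \<sigma>) \<and>
    \<not> torsion_element (cohomology2 (tuple_group m \<eta>))
        (cohomology_class (tuple_group m \<eta>) (poly_cochain m \<sigma>)) \<and>
    cohomology_class (tuple_group m \<eta>) (poly_cochain m \<sigma>)
      \<notin> kronecker_kernel (tuple_group m \<eta>) \<and>
    extension_separated (tuple_group m \<eta>)
      (cohomology_class (tuple_group m \<eta>) (poly_cochain m \<sigma>)) \<and>
    \<comment> \<open>(c)\<close>
    (\<forall>n\<in>admissible_indices m \<eta> \<sigma>. \<forall>x\<in>carrier (tuple_group m \<eta>).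
       \<exists>!A. A \<in> carrier (unitary_group (n ^ m)) \<and> rho_formula m \<eta> \<sigma> n x A) \<and>
    (let n = enumerate (admissible_indices m \<eta> \<sigma>) in
       asymptotic_representation (tuple_group m \<eta>) (\<lambda>j. n j ^ m) (\<lambda>j. rho m \<eta> \<sigma> (n j)) \<and>
       \<not> perturbable (tuple_group m \<eta>) (\<lambda>j. n j ^ m) (\<lambda>j. rho m \<eta> \<sigma> (n j)))"
proof -
  interpret group \<Gamma> by fact
  obtain m N a where "central_sequence \<Gamma> m N a" using exists_central_sequence assms by blast
  then interpret central_sequence \<Gamma> m N a .
  \<comment> \<open>The two excluded groups are the cases m = 0 and m = 1. From m = 2 on,
    \<open>N 1\<close> is nontrivial and carries the homomorphism \<phi>.\<close>
  have m: "1 < m"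
    using trivial_if_length_0 infinite_cyclic_if_length_1 assms(5,6) by (metis less_one linorder_neqE_nat)
  then have m0: "0 < m" by simp
  obtain d where d: "lower_central_series \<Gamma> d = {\<one>\<^bsub>\<Gamma>\<^esub>}" using assms(4) by (auto simp: nilpotent_group_def)
  have noeth: "noetherian (carrier \<Gamma>)" using fin_gen_nilpotent_noetherian assms(3,4) by blast
  obtain \<eta> where eta: "\<And>i. i \<in> {1..m} \<Longrightarrow> poly_in_vars m (\<eta> i)"
    "\<And>i x y. i \<in> {1..m} \<Longrightarrow> poly_eval (\<eta> i) x y = of_int (coord i (element m x \<otimes>\<^bsub>\<Gamma>\<^esub> element m y))"
    using polynomial_multiplication by blast
  obtain n k and \<phi> :: "'a \<Rightarrow> int" where n: "n \<in> N 1" "\<phi> n = 1" "0 < (k::nat)"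
    "commutator \<Gamma> (a 1) n [^]\<^bsub>\<Gamma>\<^esub> k \<in> derived \<Gamma> (N 1)"
    and hom: "\<And>u v. u \<in> N 1 \<Longrightarrow> v \<in> N 1 \<Longrightarrow> \<phi> (u \<otimes>\<^bsub>\<Gamma>\<^esub> v) = \<phi> u + \<phi> v"
    using exists_hom[OF m noeth d] by metis
  obtain \<sigma> where sigma: "poly_in_vars m \<sigma>"
    "\<And>x y. poly_eval \<sigma> x y = of_int (ext_cocycle \<phi> (element m x) (element m y))"
    using poly_function_ext_cocycle[OF m0 hom] unfolding poly_function_def by blast
  let ?H = "tuple_group m \<eta>"
  have H: "group ?H" by (rule tuple_group_is_group[OF eta(2)])
  have car: "carrier ?H = int_tuples m" by (simp add: tuple_group_def)
  have iso: "coords \<in> iso \<Gamma> ?H" by (rule coords_iso[OF eta(2)])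
  have cochain: "poly_cochain m \<sigma> (x, y) = ext_cocycle \<phi> (element m x) (element m y)"
    if "x \<in> int_tuples m" "y \<in> int_tuples m" for x y
    using that by (simp add: poly_cochain_def poly_int_def sigma(2) del: PiE_iff)
  have mult: "element m (x \<otimes>\<^bsub>?H\<^esub> y) = element m x \<otimes>\<^bsub>\<Gamma>\<^esub> element m y" if "x \<in> int_tuples m" "y \<in> int_tuples m" for x y
    using tuple_mult_eq[OF eta(2) that] element_closed[OF order_refl]
    by (simp add: tuple_group_def element_coords)
  have coc: "cocycle2 ?H (poly_cochain m \<sigma>)"
    unfolding cocycle2_def car
  proof (intro conjI ballI)
    show "poly_cochain m \<sigma> \<in> int_tuples m \<times> int_tuples m \<rightarrow>\<^sub>E UNIV"
      unfolding poly_cochain_def by (rule restrict_PiE_iff[THEN iffD2]) simp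
    fix x y z assume xyz: "x \<in> int_tuples m" "y \<in> int_tuples m" "z \<in> int_tuples m"
    have ec: "element m v \<in> carrier \<Gamma>" for v :: "nat \<Rightarrow> int" by (rule element_closed[OF order_refl])
    have cl: "x \<otimes>\<^bsub>?H\<^esub> y \<in> int_tuples m" "y \<otimes>\<^bsub>?H\<^esub> z \<in> int_tuples m"
      using monoid.m_closed[OF group.is_monoid[OF H]] xyz unfolding car by blast+
    show "poly_cochain m \<sigma> (y, z) - poly_cochain m \<sigma> (x \<otimes>\<^bsub>?H\<^esub> y, z) + poly_cochain m \<sigma> (x, y \<otimes>\<^bsub>?H\<^esub> z) -
        poly_cochain m \<sigma> (x, y) = 0"
      using ext_cocycle_identity[OF m0 hom ec[of x] ec[of y] ec[of z]]
      by (simp only: cochain xyz cl mult order_refl)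
  qed
  interpret poly_cocycle m \<eta> \<sigma>
  proof (rule poly_cocycle.intro)
    show "group ?H" by (rule H)
    show "poly_in_vars m (\<eta> i) \<and> poly_int_valued m (\<eta> i)" if "i \<in> {1..m}" for i
      using eta that by (simp add: poly_int_valued_def)
    show "poly_in_vars m \<sigma>" "poly_int_valued m \<sigma>" using sigma by (simp_all add: poly_int_valued_def)
    show "cocycle2 ?H (poly_cochain m \<sigma>)" by (rule coc)
  qed
  have a1: "a 1 \<in> carrier \<Gamma>" using a_carrier[OF m0] by simp
  have N1: "N 1 \<lhd> \<Gamma>" using N_normal m by simp
  have w: "commutator \<Gamma> (a 1) n \<in> N 1" by (rule commutator_in_normal[OF N1 a1 n(1)])
  obtain c0 where c0: "Poly_Mapping.keys c0 \<subseteq> carrier \<Gamma> \<times> carrier \<Gamma>" "boundary2 \<Gamma> c0 = 0"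
    "chain_pairing (\<lambda>(g, h). ext_cocycle \<phi> g h) c0 = int k * ext_cocycle \<phi> (a 1) n"
    using exists_cycle[OF normal_imp_subgroup[OF N1] a1 n(1) w n(4), of "\<lambda>(g, h). ext_cocycle \<phi> g h"]
      ext_cocycle_N_1[OF m0 hom] by auto
  obtain c where c: "Poly_Mapping.keys c \<subseteq> carrier ?H \<times> carrier ?H" "boundary2 ?H c = 0"
    "\<And>s. chain_pairing s c = chain_pairing (s \<circ> map_prod coords coords) c0"
    using transport_cycle[OF _ c0(1,2), of coords ?H] iso by (auto simp: iso_def)
  have "chain_pairing (poly_cochain m \<sigma>) c = chain_pairing (poly_cochain m \<sigma> \<circ> map_prod coords coords) c0"
    by (rule c(3))
  also have "\<dots> = chain_pairing (\<lambda>(g, h). ext_cocycle \<phi> g h) c0"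
    unfolding chain_pairing_eq
  proof (rule ring_pairing_cong)
    fix p assume "p \<in> Poly_Mapping.keys c0"
    then obtain g h where p: "p = (g, h)" "g \<in> carrier \<Gamma>" "h \<in> carrier \<Gamma>" using c0(1) by blast
    then show "(poly_cochain m \<sigma> \<circ> map_prod coords coords) p = (case p of (g, h) \<Rightarrow> ext_cocycle \<phi> g h)"
      using cochain[OF coords_in coords_in, of g h] by (simp add: element_coords)
  qed
  \<comment> \<open>The pairing equals k times \<phi> n, that is k.\<close>
  finally have ne: "chain_pairing (poly_cochain m \<sigma>) c \<noteq> 0"
    using c0(3) n ext_cocycle_a_1[OF m0 hom n(1)] by simp
  show ?thesis
    unfolding Let_def
  proof (intro exI conjI ballI)
    show "1 \<le> m" using m by simp
    show "poly_in_vars m (\<eta> i)" "poly_int_valued m (\<eta> i)" if "i \<in> {1..m}" for i using eta that by simp_all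
    show "\<Gamma> \<cong> ?H" using iso by (auto simp: is_iso_def)
    show "\<not> torsion_element (cohomology2 ?H) (cohomology_class ?H (poly_cochain m \<sigma>))"
      by (rule not_torsion_cohomology_class[OF c(1,2) ne])
    show "cohomology_class ?H (poly_cochain m \<sigma>) \<notin> kronecker_kernel ?H"
      by (rule not_in_kronecker_kernel[OF H coc c(1,2) ne])
    show "\<exists>!A. A \<in> carrier (unitary_group (j ^ m)) \<and> rho_formula m \<eta> \<sigma> j x A"
      if "j \<in> admissible_indices m \<eta> \<sigma>" "x \<in> carrier ?H" for j x
      using rho_ex1[OF that(1)] that(2) unfolding car by blast
    show "\<not> perturbable ?H (\<lambda>j. adm_seq j ^ m) (\<lambda>j. rho m \<eta> \<sigma> (adm_seq j))"
      by (rule not_perturbable[OF c(1,2) ne])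
  qed (rule H sigma coc extension_separated asymptotic_representation)+
qed

end
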